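(* Let $p \ge q \ge 2$ be integers. The packing orbitope $\mathrm{O}^{\le}_{p,q}(\mathfrak{S}_q)$ with respect to the symmetric group $\mathfrak{S}_q$ equals the set of all $x \in \mathbb{R}^{\mathcal{I}_{p,q}}$ that satisfy the following linear constraints: (a) the row-sum inequalities $x(\mathrm{row}_i) \le 1$ for all $i \in [p]$; (b) the nonnegativity constraints $x_{ij} \ge 0$ for all $(i,j) \in \mathcal{I}_{p,q} \setminus \{(j,j) : j < q\}$; (c) the shifted column inequalities $x(B) - x(S) \le 0$ for all bars $B = \{(i,j),(i,j+1),\dots,(i,\min\{i,q\})\}$ with $(i,j) = \langle \eta,j\rangle \in \mathcal{I}_{p,q}$, $j \ge 2$, and all shifted columns $S = \{\langle 1,c_1\rangle, \langle 2,c_2\rangle,\dots,\langle \eta,c_\eta\rangle\}$ with $c_1 = c_2 \le \dots \le c_\eta \le j-1$, where in case of $\eta = 1$ we additionally require $j = c_1+1$. This system of constraints is non-redundant. The corresponding separation problem can be solved in time $O(pq)$.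
   Context: Notation: $[n] = \{1,\dots,n\}$. The symmetric group $\mathfrak{S}_q$ acts on the set $\{0,1\}^{[p]\times[q]}$ of $0/1$-matrices by permuting columns. Let $\prec$ be the lexicographic order on $\{0,1\}^{[p]\times[q]}$ with respect to the row-wise ordering $(1,1)<(1,2)<\dots<(1,q)<(2,1)<\dots<(p,q)$ of positions, i.e. $A\prec B$ iff $a_{k\ell}<b_{k\ell}$ at the first position $(k,\ell)$ where $A,B$ differ. The packing orbitope $\mathrm{O}^{\le}_{p,q}(\mathfrak{S}_q)$ is the convex hull of all $0/1$-matrices of size $p\times q$ that have at most one $1$-entry in each row and are $\prec$-maximal within their $\mathfrak{S}_q$-orbit. All these matrices satisfy $x_{ij}=0$ for $i<j$; these coordinates are dropped, and the orbitope is regarded as a subset of $\mathbb{R}^{\mathcal{I}_{p,q}}$, where $\mathcal{I}_{p,q}=\{(i,j)\in[p]\times[q] : i\ge j\}$. For $T\subseteq\mathcal{I}_{p,q}$ write $x(T)=\sum_{(i,j)\in T}x_{ij}$. Let $\mathrm{row}_i=\{(i,1),\dots,(i,\min\{i,q\})\}$. Diagonal coordinates: $\langle\eta,j\rangle := (j+\eta-1,j)$ for $j\in[q]$, $1\le\eta\le p-j+1$. Column indices $c_k$ of a shifted column are elements of $[q]$. A system of constraints is non-redundant if dropping any single constraint enlarges its solution set. The separation problem: given $x^\star\in\mathbb{Q}^{\mathcal{I}_{p,q}}$, decide whether $x^\star$ satisfies all constraints of the system and, if not, output a violated one. Running times are counted in the unit-cost (arithmetic operation) model. *)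

theory Defs
  imports
    "HOL-Analysis.Analysis"
    "HOL-Analysis.Finite_Function_Topology"
    "HOL-Algebra.Group_Action"
    "HOL-Algebra.Sym_Groups"
begin

section \<open>Matrices and orbitopes\<close>

text \<open>
  For a finite set \<open>T\<close> of positions, the space \<open>\<real>\<^sup>T\<close> is rendered as the set of all finitely supported
  functions on \<open>nat \<times> nat\<close> whose support (\<^const>\<open>Poly_Mapping.keys\<close>) is contained in \<open>T\<close>.
  Under this rendering, dropping coordinates that are constantly zero is the identity.
  Row and column indices start at 1.
\<close>

type_synonym pos = "nat \<times> nat"

abbreviation entry :: "(pos \<Rightarrow>\<^sub>0 'a::zero) \<Rightarrow> pos \<Rightarrow> 'a" where
  "entry \<equiv> Poly_Mapping.lookup"

definition vectors_on :: "pos set \<Rightarrow> (pos \<Rightarrow>\<^sub>0 'a::zero) set" where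
  "vectors_on T = {x. Poly_Mapping.keys x \<subseteq> T}"

definition zero_one_matrices :: "nat \<Rightarrow> nat \<Rightarrow> (pos \<Rightarrow>\<^sub>0 real) set" where
  "zero_one_matrices p q = {A \<in> vectors_on ({1..p} \<times> {1..q}). \<forall>e. entry A e \<in> {0, 1}}"

text \<open>The \<open>j\<close>-th column of \<open>A\<close> becomes the \<open>\<pi> j\<close>-th column of \<open>permute_columns \<pi> A\<close>.\<close>

definition permute_columns :: "(nat \<Rightarrow> nat) \<Rightarrow> (pos \<Rightarrow>\<^sub>0 'a::zero) \<Rightarrow> (pos \<Rightarrow>\<^sub>0 'a)" where
  "permute_columns \<pi> A = Poly_Mapping.map_key (\<lambda>(i, j). (i, inv_into UNIV \<pi> j)) A"

definition pos_less :: "pos \<Rightarrow> pos \<Rightarrow> bool" where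
  "pos_less e f \<longleftrightarrow> fst e < fst f \<or> (fst e = fst f \<and> snd e < snd f)"

definition lex_less :: "nat \<Rightarrow> nat \<Rightarrow> (pos \<Rightarrow>\<^sub>0 real) \<Rightarrow> (pos \<Rightarrow>\<^sub>0 real) \<Rightarrow> bool" where
  "lex_less p q A B \<longleftrightarrow>
     (\<exists>e \<in> {1..p} \<times> {1..q}. entry A e < entry B e \<and>
        (\<forall>f \<in> {1..p} \<times> {1..q}. pos_less f e \<longrightarrow> entry A f = entry B f))"

definition packing_orbitope :: "nat \<Rightarrow> nat \<Rightarrow> (pos \<Rightarrow>\<^sub>0 real) set" where
  "packing_orbitope p q = convex hull
     {A \<in> zero_one_matrices p q.
        (\<forall>i \<in> {1..p}. card {j \<in> {1..q}. entry A (i, j) = 1} \<le> 1) \<and>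
        (\<forall>B \<in> orbit (sym_group q) permute_columns A. \<not> lex_less p q A B)}"


section \<open>The linear system\<close>

definition positions :: "nat \<Rightarrow> nat \<Rightarrow> pos set" where
  "positions p q = {(i, j). i \<in> {1..p} \<and> j \<in> {1..q} \<and> j \<le> i}"

definition row :: "nat \<Rightarrow> nat \<Rightarrow> pos set" where
  "row q i = {i} \<times> {1..min i q}"

text \<open>The position \<open>diagonal \<eta> j\<close> is the one with diagonal coordinates \<open>\<langle>\<eta>,j\<rangle>\<close>.\<close>

definition diagonal :: "nat \<Rightarrow> nat \<Rightarrow> pos" where
  "diagonal \<eta> j = (j + \<eta> - 1, j)"

definition bar :: "nat \<Rightarrow> pos \<Rightarrow> pos set" where
  "bar q e = {fst e} \<times> {snd e..min (fst e) q}"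

definition shifted_column :: "nat \<Rightarrow> (nat \<Rightarrow> nat) \<Rightarrow> pos set" where
  "shifted_column \<eta> c = (\<lambda>k. diagonal k (c k)) ` {1..\<eta>}"

datatype lin_constraint =
    Row_Sum "pos set"
  | Nonneg pos
  | Shifted_Column "pos set" "pos set"

primrec satisfies :: "(pos \<Rightarrow>\<^sub>0 'a::linordered_field) \<Rightarrow> lin_constraint \<Rightarrow> bool" where
  "satisfies x (Row_Sum R) \<longleftrightarrow> (\<Sum>e\<in>R. entry x e) \<le> 1"
| "satisfies x (Nonneg e) \<longleftrightarrow> entry x e \<ge> 0"
| "satisfies x (Shifted_Column B S) \<longleftrightarrow> (\<Sum>e\<in>B. entry x e) - (\<Sum>e\<in>S. entry x e) \<le> 0"

text \<open>For \<open>\<eta> = 1\<close> the requirement \<open>c 1 = c 2\<close> is void.\<close>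

definition orbitope_system :: "nat \<Rightarrow> nat \<Rightarrow> lin_constraint set" where
  "orbitope_system p q =
     {Row_Sum (row q i) | i. i \<in> {1..p}}
   \<union> {Nonneg e | e. e \<in> positions p q - {(j, j) | j. j < q}}
   \<union> {Shifted_Column (bar q (diagonal \<eta> j)) (shifted_column \<eta> c) | \<eta> j c.
        1 \<le> \<eta> \<and> 2 \<le> j \<and> diagonal \<eta> j \<in> positions p q \<and>
        (\<forall>k \<in> {1..\<eta>}. c k \<in> {1..q} \<and> c k \<le> j - 1) \<and>
        mono_on {1..\<eta>} c \<and>
        (2 \<le> \<eta> \<longrightarrow> c 1 = c 2) \<and>
        (\<eta> = 1 \<longrightarrow> j = c 1 + 1)}"

definition solution_set :: "nat \<Rightarrow> nat \<Rightarrow> lin_constraint set \<Rightarrow> (pos \<Rightarrow>\<^sub>0 real) set" where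
  "solution_set p q L = {x \<in> vectors_on (positions p q). \<forall>c\<in>L. satisfies x c}"

definition non_redundant :: "nat \<Rightarrow> nat \<Rightarrow> lin_constraint set \<Rightarrow> bool" where
  "non_redundant p q L \<longleftrightarrow> (\<forall>c\<in>L. solution_set p q L \<subset> solution_set p q (L - {c}))"


section \<open>Programs in the unit-cost arithmetic model\<close>

text \<open>
  Programs work on integer cells (for indices and control) and rational cells, organised in named
  arrays; an array name with the empty index list serves as a scalar variable. In each reference
  the number of indices is fixed by the program text. Every constant, memory access, arithmetic
  operation, comparison, Boolean connective and control step costs 1, regardless of the size of
  the numbers involved. There is no rounding and no conversion between the two kinds of cells.
\<close>

type_synonym vname = string

record state =
  ints :: "vname \<Rightarrow> int list \<Rightarrow> int"
  rats :: "vname \<Rightarrow> int list \<Rightarrow> rat"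

datatype iexp =
    IConst int
  | IRef vname "iexp list"
  | IAdd iexp iexp
  | ISub iexp iexp
  | IMul iexp iexp

datatype rexp =
    RConst rat
  | RRef vname "iexp list"
  | RAdd rexp rexp
  | RSub rexp rexp
  | RMul rexp rexp
  | RDiv rexp rexp

datatype bexp =
    ILess iexp iexp
  | RLess rexp rexp
  | Neg bexp
  | Conj bexp bexp

primrec ival :: "state \<Rightarrow> iexp \<Rightarrow> int" where
  "ival s (IConst n) = n"
| "ival s (IRef a es) = ints s a (map (ival s) es)"
| "ival s (IAdd e f) = ival s e + ival s f"
| "ival s (ISub e f) = ival s e - ival s f"
| "ival s (IMul e f) = ival s e * ival s f"

primrec icost :: "iexp \<Rightarrow> nat" where
  "icost (IConst n) = 1"
| "icost (IRef a es) = 1 + sum_list (map icost es)"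
| "icost (IAdd e f) = 1 + icost e + icost f"
| "icost (ISub e f) = 1 + icost e + icost f"
| "icost (IMul e f) = 1 + icost e + icost f"

primrec rval :: "state \<Rightarrow> rexp \<Rightarrow> rat" where
  "rval s (RConst r) = r"
| "rval s (RRef a es) = rats s a (map (ival s) es)"
| "rval s (RAdd e f) = rval s e + rval s f"
| "rval s (RSub e f) = rval s e - rval s f"
| "rval s (RMul e f) = rval s e * rval s f"
| "rval s (RDiv e f) = rval s e / rval s f"

primrec rcost :: "rexp \<Rightarrow> nat" where
  "rcost (RConst r) = 1"
| "rcost (RRef a es) = 1 + sum_list (map icost es)"
| "rcost (RAdd e f) = 1 + rcost e + rcost f"
| "rcost (RSub e f) = 1 + rcost e + rcost f"
| "rcost (RMul e f) = 1 + rcost e + rcost f"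
| "rcost (RDiv e f) = 1 + rcost e + rcost f"

primrec bval :: "state \<Rightarrow> bexp \<Rightarrow> bool" where
  "bval s (ILess e f) \<longleftrightarrow> ival s e < ival s f"
| "bval s (RLess e f) \<longleftrightarrow> rval s e < rval s f"
| "bval s (Neg b) \<longleftrightarrow> \<not> bval s b"
| "bval s (Conj b d) \<longleftrightarrow> bval s b \<and> bval s d"

primrec bcost :: "bexp \<Rightarrow> nat" where
  "bcost (ILess e f) = 1 + icost e + icost f"
| "bcost (RLess e f) = 1 + rcost e + rcost f"
| "bcost (Neg b) = 1 + bcost b"
| "bcost (Conj b d) = 1 + bcost b + bcost d"

datatype com =
    Skip
  | IAssign vname "iexp list" iexp
  | RAssign vname "iexp list" rexp
  | Seq com com
  | Cond bexp com com
  | While bexp com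

text \<open>\<open>exec P s t s'\<close>: started in \<open>s\<close>, program \<open>P\<close> terminates in \<open>s'\<close> after \<open>t\<close> elementary steps.\<close>

inductive exec :: "com \<Rightarrow> state \<Rightarrow> nat \<Rightarrow> state \<Rightarrow> bool" where
  Skip: "exec Skip s 1 s"
| IAssign: "exec (IAssign a es e) s (1 + sum_list (map icost es) + icost e)
     (s\<lparr>ints := (ints s)(a := (ints s a)(map (ival s) es := ival s e))\<rparr>)"
| RAssign: "exec (RAssign a es e) s (1 + sum_list (map icost es) + rcost e)
     (s\<lparr>rats := (rats s)(a := (rats s a)(map (ival s) es := rval s e))\<rparr>)"
| Seq: "exec P s t s' \<Longrightarrow> exec Q s' u s'' \<Longrightarrow> exec (Seq P Q) s (t + u) s''"
| CondTrue: "bval s b \<Longrightarrow> exec P s t s' \<Longrightarrow> exec (Cond b P Q) s (1 + bcost b + t) s'"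
| CondFalse: "\<not> bval s b \<Longrightarrow> exec Q s t s' \<Longrightarrow> exec (Cond b P Q) s (1 + bcost b + t) s'"
| WhileFalse: "\<not> bval s b \<Longrightarrow> exec (While b P) s (1 + bcost b) s"
| WhileTrue: "bval s b \<Longrightarrow> exec P s t s' \<Longrightarrow> exec (While b P) s' u s'' \<Longrightarrow>
     exec (While b P) s (1 + bcost b + t + u) s''"

lemma exec_deterministic:
  assumes "exec P s t s'" "exec P s u s''"
  shows "u = t \<and> s'' = s'"
  using assms
proof (induction arbitrary: u s'' rule: exec.induct)
  case (Seq P s t s' Q u' s1)
  from Seq.prems show ?case by cases (use Seq.IH in blast)
next
  case (CondTrue s b P t s' Q)
  from CondTrue.prems show ?case by cases (use CondTrue in blast)+
next
  case (CondFalse s b Q t s' P)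
  from CondFalse.prems show ?case by cases (use CondFalse in blast)+
next
  case (WhileTrue s b P t s' u' s1)
  from WhileTrue.prems show ?case by cases (use WhileTrue in blast)+
qed (auto elim: exec.cases)


section \<open>The separation problem\<close>

text \<open>
  Input: scalars \<open>p\<close>, \<open>q\<close> and the two-dimensional rational array \<open>x\<close>; all other cells are 0.
\<close>

definition separation_input :: "nat \<Rightarrow> nat \<Rightarrow> (pos \<Rightarrow>\<^sub>0 rat) \<Rightarrow> state" where
  "separation_input p q x =
     \<lparr>ints = (\<lambda>a is. if is = [] \<and> a = ''p'' then int p
                      else if is = [] \<and> a = ''q'' then int q else 0),
      rats = (\<lambda>a is. case is of
                [i, j] \<Rightarrow> if a = ''x'' then entry x (nat i, nat j) else 0
              | _ \<Rightarrow> 0)\<rparr>"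

text \<open>
  Output: the scalar \<open>verdict\<close> is 0 if all constraints are satisfied; otherwise it is 1, 2 or 3
  according to the kind of the violated constraint. That constraint is described by the row \<open>i\<close>;
  by the position \<open>(i,j)\<close>; or by the leftmost position \<open>(i,j) = \<langle>\<eta>,j\<rangle>\<close> of its bar together with the
  column indices \<open>c\<^sub>1, \<dots>, c\<^sub>\<eta>\<close> of its shifted column, where \<open>\<eta> = i - j + 1\<close>.
\<close>

definition reports :: "nat \<Rightarrow> state \<Rightarrow> lin_constraint \<Rightarrow> bool" where
  "reports q s d \<longleftrightarrow>
     (let v = ints s ''verdict'' []; i = nat (ints s ''i'' []); j = nat (ints s ''j'' []);
          c = (\<lambda>k. nat (ints s ''c'' [int k]))
      in (v = 1 \<and> d = Row_Sum (row q i)) \<or>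
         (v = 2 \<and> d = Nonneg (i, j)) \<or>
         (v = 3 \<and> d = Shifted_Column (bar q (i, j)) (shifted_column (i + 1 - j) c)))"

definition correct_answer :: "nat \<Rightarrow> nat \<Rightarrow> (pos \<Rightarrow>\<^sub>0 rat) \<Rightarrow> state \<Rightarrow> bool" where
  "correct_answer p q x s \<longleftrightarrow>
     (if \<forall>d \<in> orbitope_system p q. satisfies x d
      then ints s ''verdict'' [] = 0
      else \<exists>d \<in> orbitope_system p q. reports q s d \<and> \<not> satisfies x d)"

end

theory Submission
  imports Defs
begin

text \<open>
  A generator is read row by row: in every row, either nothing happens, or an already opened column
  receives a one, or the next column is opened. A point \<open>x\<close> is thus a convex combination of generators
  iff there are probabilities \<open>D i j\<close> (that column \<open>j\<close> is opened in the first \<open>i\<close> rows) with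
  \<open>D i j \<le> D (i - 1) (j - 1)\<close>, with increments between \<open>0\<close> and \<open>x\<^sub>i\<^sub>j\<close>, and with \<open>x(B) \<le> D i j\<close> for the
  bar \<open>B\<close> starting at \<open>(i, j)\<close>. The largest candidate obeys the recursion
  \<open>D i j = min (D (i - 1) (j - 1)) (D (i - 1) j + x\<^sub>i\<^sub>j)\<close>; unrolled, it is the minimum of \<open>1\<close> and of \<open>x(S)\<close> over
  shifted columns \<open>S\<close>, so the conditions become the shifted column inequalities. The same
  recursion solves the separation problem in time \<open>O(pq)\<close>.

  A constraint is not redundant since for every other constraint some generator is tight for
  the former and slack for the latter: the average of such generators can be moved slightly
  beyond the facet.
\<close>

section \<open>Generators\<close>

text \<open>All conditions on \<open>D\<close> except the bar bounds and monotonicity in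
  \<open>i\<close> cap \<open>D\<close> from above, so the largest candidate serves the bar bounds
  best; that it is also monotone in \<open>i\<close> has to be proved. On the main diagonal the
  recursion has no alternative from the left: comparing \<open>x\<close> at \<open>(j, j)\<close>
  with \<open>x\<close> at \<open>(j - 1, j - 1)\<close> is itself a constraint, the one with \<eta>
  = 1. Hence the shifted columns produced by the recursion stay in one column on the first two
  diagonals, which is the origin of \<open>c 1 = c 2\<close>. Chained from \<open>(q, q)\<close>
  back to \<open>(1, 1)\<close>, the same constraints supply the nonnegativity of the diagonal
  entries that the system does not list.

  \<open>D\<close> fixes only the marginals of a random generator. A joint law is built row by row:
  given how many columns are open, part of the mass opens the next column, and the remaining ones
  must be placed in columns already open. The latter is a transport problem with nested sets of
  allowed targets; its Hall condition is precisely the bar bound.\<close>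

definition matrix_of :: "pos set \<Rightarrow> (pos \<Rightarrow>\<^sub>0 real)" where
  "matrix_of F = (\<Sum>e\<in>F. Poly_Mapping.single e 1)"

lemma entry_sum: "entry (\<Sum>e\<in>F. f e) e' = (\<Sum>e\<in>F. entry (f e) e')"
  by (induction F rule: infinite_finite_induct) (simp_all add: lookup_add)

lemma entry_matrix_of: "finite F \<Longrightarrow> entry (matrix_of F) e = (if e \<in> F then 1 else 0)"
  by (simp add: matrix_of_def entry_sum lookup_single when_def)

lemma sum_matrix_of:
  "finite F \<Longrightarrow> finite T \<Longrightarrow> (\<Sum>e\<in>T. entry (matrix_of F) e) = real (card (T \<inter> F))"
  by (simp add: entry_matrix_of flip: sum.inter_restrict)

lemma keys_matrix_of: "finite F \<Longrightarrow> Poly_Mapping.keys (matrix_of F) = F"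
  by (auto simp: in_keys_iff entry_matrix_of split: if_splits)

text \<open>Supports of the generators, in a form that suits the row-by-row reading: among
  0/1-matrices with at most one one per row, maximality in the orbit means that every column starts
  strictly after its left neighbour. Asking this of every one in column \<open>j\<close>, and not
  only of the first, is the same and avoids a least element.\<close>

definition packing_pattern :: "nat \<Rightarrow> nat \<Rightarrow> pos set \<Rightarrow> bool" where
  "packing_pattern p q F \<longleftrightarrow> F \<subseteq> {1..p} \<times> {1..q} \<and>
     (\<forall>i j j'. (i, j) \<in> F \<longrightarrow> (i, j') \<in> F \<longrightarrow> j = j') \<and>
     (\<forall>i j. (i, j) \<in> F \<longrightarrow> 2 \<le> j \<longrightarrow> (\<exists>i'<i. (i', j - 1) \<in> F))"

lemma packing_patternI:
  assumes bounds: "\<And>i j. (i, j) \<in> F \<Longrightarrow> 1 \<le> i \<and> i \<le> p \<and> 1 \<le> j \<and> j \<le> q"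
    and unique: "\<And>i j j'. (i, j) \<in> F \<Longrightarrow> (i, j') \<in> F \<Longrightarrow> j = j'"
    and earlier: "\<And>i j. (i, j) \<in> F \<Longrightarrow> 2 \<le> j \<Longrightarrow> \<exists>i'<i. (i', j - 1) \<in> F"
  shows "packing_pattern p q F"
  unfolding packing_pattern_def
proof (intro conjI allI impI)
  show "F \<subseteq> {1..p} \<times> {1..q}"
  proof
    fix e assume "e \<in> F"
    then show "e \<in> {1..p} \<times> {1..q}"
      using bounds[of "fst e" "snd e"] by (cases e) simp
  qed
qed (fact unique earlier)+

lemma packing_pattern_finite: "packing_pattern p q F \<Longrightarrow> finite F"
  unfolding packing_pattern_def by (rule finite_subset[of _ "{1..p} \<times> {1..q}"]) simp_all

lemma packing_pattern_unique:
  "packing_pattern p q F \<Longrightarrow> (i, j) \<in> F \<Longrightarrow> (i, j') \<in> F \<Longrightarrow> j = j'"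
  unfolding packing_pattern_def by blast

text \<open>Each step to the left goes up by at least one row; recording this gain later locates the
  ones on diagonals.\<close>

lemma packing_pattern_earlier:
  assumes F: "packing_pattern p q F" and "(i, j) \<in> F" "1 \<le> m" "m \<le> j"
  shows "\<exists>i'. i' + (j - m) \<le> i \<and> (i', m) \<in> F"
  using assms(2-)
proof (induction "j - m" arbitrary: i j)
  case 0
  then show ?case by auto
next
  case (Suc n)
  have "2 \<le> j"
    using Suc.hyps(2) Suc.prems by linarith
  then obtain i' where i': "i' < i" "(i', j - 1) \<in> F"
    using F Suc.prems(1) unfolding packing_pattern_def by blast
  have "n = (j - 1) - m" "m \<le> j - 1"
    using Suc.hyps(2) by auto
  from Suc.hyps(1)[OF this(1) i'(2) Suc.prems(2) this(2)]
  obtain i'' where i'': "i'' + (j - 1 - m) \<le> i'" "(i'', m) \<in> F" by blast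
  then have "i'' + (j - m) \<le> i"
    using i'(1) Suc.hyps(2) by linarith
  with i''(2) show ?case by blast
qed

lemma packing_pattern_le:
  assumes "packing_pattern p q F" "(i, j) \<in> F"
  shows "1 \<le> j" "j \<le> i" "i \<le> p" "j \<le> q"
proof -
  show *: "1 \<le> j" "i \<le> p" "j \<le> q"
    using assms unfolding packing_pattern_def by auto
  obtain i' where "i' + (j - 1) \<le> i" "(i', 1) \<in> F"
    using packing_pattern_earlier[OF assms, of 1] * by auto
  moreover from this have "1 \<le> i'"
    using assms unfolding packing_pattern_def by auto
  ultimately show "j \<le> i"
    by simp
qed

lemma packing_pattern_row_card:
  assumes "packing_pattern p q F" "T \<subseteq> {i} \<times> UNIV"
  shows "card (T \<inter> F) \<le> 1"
proof -
  have "a = b" if "a \<in> T \<inter> F" "b \<in> T \<inter> F" for a b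
  proof -
    have "fst a = i" "fst b = i"
      using that assms(2) by auto
    then obtain j j' where "a = (i, j)" "b = (i, j')"
      by (metis prod.collapse)
    then show ?thesis
      using that packing_pattern_unique[OF assms(1), of i j j'] by simp
  qed
  then show ?thesis
    using packing_pattern_finite[OF assms(1)] by (simp add: card_le_Suc0_iff_eq)
qed

section \<open>Lexicographic maximality under column permutations\<close>

lemma entry_permute_columns:
  assumes "\<pi> permutes {1..q}"
  shows "entry (permute_columns \<pi> A) (i, j) = entry A (i, inv_into UNIV \<pi> j)"
proof -
  have "inj (\<lambda>(i :: nat, j). (i, inv_into UNIV \<pi> j))"
    using permutes_inv[OF assms] by (auto simp: inj_on_def dest: permutes_inj injD)
  then show ?thesis
    unfolding permute_columns_def by (simp add: map_key.rep_eq)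
qed

text \<open>If a one in column \<open>j\<close> has no one of column \<open>j - 1\<close> in an
  earlier row, swapping these two columns yields a lexicographically larger matrix.\<close>

lemma generator_imp_packing_pattern:
  assumes A: "A \<in> zero_one_matrices p q"
    and row: "\<forall>i \<in> {1..p}. card {j \<in> {1..q}. entry A (i, j) = 1} \<le> 1"
    and lex: "\<forall>B \<in> orbit (sym_group q) permute_columns A. \<not> lex_less p q A B"
  shows "packing_pattern p q (Poly_Mapping.keys A)"
proof -
  have keys: "Poly_Mapping.keys A \<subseteq> {1..p} \<times> {1..q}"
    and val: "\<And>e. entry A e = (if e \<in> Poly_Mapping.keys A then 1 else 0)"
    using A by (auto simp: zero_one_matrices_def vectors_on_def in_keys_iff)
  have unique: "j = j'" if "(i, j) \<in> Poly_Mapping.keys A" "(i, j') \<in> Poly_Mapping.keys A" for i j j'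
  proof -
    let ?J = "{j \<in> {1..q}. entry A (i, j) = 1}"
    have "i \<in> {1..p}" and J: "j \<in> ?J" "j' \<in> ?J"
      using that keys by (auto simp: val)
    then have "card ?J \<le> Suc 0" "finite ?J"
      using row by auto
    with J show ?thesis
      using card_le_Suc0_iff_eq by blast
  qed
  have "\<exists>i'<i. (i', j - 1) \<in> Poly_Mapping.keys A" if ij: "(i, j) \<in> Poly_Mapping.keys A" "2 \<le> j" for i j
  proof (rule ccontr)
    assume none: "\<not> (\<exists>i'<i. (i', j - 1) \<in> Poly_Mapping.keys A)"
    define \<tau> where "\<tau> = Transposition.transpose (j - 1) j"
    \<comment> \<open>The first one of column \<open>j\<close>. Above row \<open>i0\<close> both
      swapped columns are empty, so the first change is the gain at
      \<open>(i0, j - 1)\<close>.\<close>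
    define i0 where "i0 = (LEAST i. (i, j) \<in> Poly_Mapping.keys A)"
    have i0: "(i0, j) \<in> Poly_Mapping.keys A" "i0 \<le> i"
      unfolding i0_def using ij by (auto intro: LeastI Least_le)
    have before: "(i', j) \<notin> Poly_Mapping.keys A" if "i' < i0" for i'
      using that unfolding i0_def by (rule not_less_Least)
    have bounds: "i0 \<in> {1..p}" "j \<in> {1..q}"
      using i0 keys by auto
    have \<tau>: "\<tau> permutes {1..q}"
      unfolding \<tau>_def using bounds ij(2) by (intro permutes_swap_id) auto
    have inv: "inv_into UNIV \<tau> = \<tau>"
      unfolding \<tau>_def by (rule inv_unique_comp) auto
    have B: "entry (permute_columns \<tau> A) (i', j') = entry A (i', \<tau> j')" for i' j'
      using entry_permute_columns[OF \<tau>] inv by simp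
    have "lex_less p q A (permute_columns \<tau> A)"
      unfolding lex_less_def
    proof (intro bexI[of _ "(i0, j - 1)"] conjI ballI impI)
      have "(i0, j - 1) \<notin> Poly_Mapping.keys A"
        using unique[OF i0(1), of "j - 1"] ij(2) by auto
      then show "entry A (i0, j - 1) < entry (permute_columns \<tau> A) (i0, j - 1)"
        using i0 B[of i0 "j - 1"] by (simp add: val \<tau>_def)
      show "(i0, j - 1) \<in> {1..p} \<times> {1..q}"
        using bounds ij(2) by auto
      fix f assume "pos_less f (i0, j - 1)"
      then show "entry A f = entry (permute_columns \<tau> A) f"
        using none i0 before ij(2)
        by (cases f, simp only: B) (auto simp: pos_less_def val \<tau>_def Transposition.transpose_def)
    qed
    moreover have "permute_columns \<tau> A \<in> orbit (sym_group q) permute_columns A"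
      using \<tau> by (auto simp: orbit_def sym_group_carrier)
    ultimately show False
      using lex by blast
  qed
  with keys unique show ?thesis
    unfolding packing_pattern_def by blast
qed

text \<open>At the first position \<open>(i, j)\<close> of a gain, a one arrives from some column
  \<open>l\<close>. If \<open>l < j\<close>, agreement at \<open>(i, l)\<close> forces the inverse
  permutation to map both \<open>j\<close> and \<open>l\<close> to \<open>l\<close>. If
  \<open>l > j\<close>, column \<open>j\<close> has a one in an earlier row, and agreement there
  puts a second one of that row into column \<open>l\<close>.\<close>

lemma packing_pattern_lex_maximal:
  assumes F: "packing_pattern p q F" and \<pi>: "\<pi> permutes {1..q}"
  shows "\<not> lex_less p q (matrix_of F) (permute_columns \<pi> (matrix_of F))"
proof
  note fin = packing_pattern_finite[OF F]
  assume "lex_less p q (matrix_of F) (permute_columns \<pi> (matrix_of F))"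
  then obtain i j where ij: "i \<in> {1..p}" "j \<in> {1..q}"
    and less: "entry (matrix_of F) (i, j) < entry (permute_columns \<pi> (matrix_of F)) (i, j)"
    and eq: "\<And>i' j'. i' \<in> {1..p} \<Longrightarrow> j' \<in> {1..q} \<Longrightarrow> i' < i \<or> i' = i \<and> j' < j \<Longrightarrow>
      entry (matrix_of F) (i', j') = entry (permute_columns \<pi> (matrix_of F)) (i', j')"
    unfolding lex_less_def pos_less_def by fastforce
  have less': "(i, j) \<notin> F" "(i, inv_into UNIV \<pi> j) \<in> F"
    using less by (auto simp: entry_permute_columns[OF \<pi>] entry_matrix_of[OF fin] split: if_splits)
  note ij = ij less'
  have same: "(i', j') \<in> F \<longleftrightarrow> (i', inv_into UNIV \<pi> j') \<in> F"
    if "i' \<in> {1..p}" "j' \<in> {1..q}" "i' < i \<or> i' = i \<and> j' < j" for i' j'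
    using eq[OF that] by (auto simp: entry_permute_columns[OF \<pi>] entry_matrix_of[OF fin] split: if_splits)
  define l where "l = inv_into UNIV \<pi> j"
  have lF: "(i, l) \<in> F" "l \<noteq> j" "l \<in> {1..q}"
    using ij F by (auto simp: l_def packing_pattern_def)
  show False
  proof (cases "l < j")
    case True
    then have "(i, inv_into UNIV \<pi> l) \<in> F"
      using same[of i l] ij lF by auto
    then have "inv_into UNIV \<pi> l = l"
      using packing_pattern_unique[OF F] lF by blast
    then have "inv_into UNIV \<pi> l = inv_into UNIV \<pi> j"
      by (simp add: l_def)
    then show False
      using permutes_inj[OF permutes_inv[OF \<pi>]] lF by (auto dest: injD)
  next
    case False
    then obtain i' where i': "i' + (l - j) \<le> i" "(i', j) \<in> F"
      using packing_pattern_earlier[OF F lF(1), of j] ij by auto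
    moreover have "i' < i" "i' \<in> {1..p}"
      using i' False lF F by (auto simp: packing_pattern_def)
    ultimately have "(i', l) \<in> F"
      using same[of i' j] ij by (auto simp: l_def)
    then show False
      using packing_pattern_unique[OF F] i'(2) lF by blast
  qed
qed

lemma packing_orbitope_eq: "packing_orbitope p q = convex hull (matrix_of ` {F. packing_pattern p q F})"
proof -
  let ?G = "{A \<in> zero_one_matrices p q.
        (\<forall>i \<in> {1..p}. card {j \<in> {1..q}. entry A (i, j) = 1} \<le> 1) \<and>
        (\<forall>B \<in> orbit (sym_group q) permute_columns A. \<not> lex_less p q A B)}"
  have "?G = matrix_of ` {F. packing_pattern p q F}"
  proof (intro equalityI subsetI)
    fix A assume A: "A \<in> ?G"
    then have "A = matrix_of (Poly_Mapping.keys A)"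
      by (intro poly_mapping_eqI) (auto simp: entry_matrix_of in_keys_iff zero_one_matrices_def)
    with A generator_imp_packing_pattern show "A \<in> matrix_of ` {F. packing_pattern p q F}"
      by blast
  next
    fix A assume "A \<in> matrix_of ` {F. packing_pattern p q F}"
    then obtain F where A: "A = matrix_of F" and F: "packing_pattern p q F" by blast
    note fin = packing_pattern_finite[OF F]
    have "A \<in> zero_one_matrices p q"
      using F fin by (auto simp: A zero_one_matrices_def vectors_on_def keys_matrix_of entry_matrix_of packing_pattern_def)
    moreover have "card {j \<in> {1..q}. entry A (i, j) = 1} \<le> 1" for i
      using packing_pattern_unique[OF F] fin
      by (auto simp: A entry_matrix_of card_le_Suc0_iff_eq split: if_splits)
    moreover have "\<not> lex_less p q A B" if "B \<in> orbit (sym_group q) permute_columns A" for B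
      using that packing_pattern_lex_maximal[OF F] by (auto simp: A orbit_def sym_group_carrier)
    ultimately show "A \<in> ?G"
      by blast
  qed
  then show ?thesis
    unfolding packing_orbitope_def by simp
qed

section \<open>Shifted columns\<close>

text \<open>For \<open>m = j - 1\<close> these are the shifted columns that the system combines with bars starting in column \<open>j\<close>.\<close>

definition admissible :: "nat \<Rightarrow> (nat \<Rightarrow> nat) \<Rightarrow> nat \<Rightarrow> bool" where
  "admissible \<eta> c m \<longleftrightarrow> (\<forall>k \<in> {1..\<eta>}. 1 \<le> c k \<and> c k \<le> m) \<and> mono_on {1..\<eta>} c \<and>
     (2 \<le> \<eta> \<longrightarrow> c 1 = c 2) \<and> (\<eta> = 1 \<longrightarrow> c 1 = m)"

lemma admissible_bounds: "admissible \<eta> c m \<Longrightarrow> 1 \<le> k \<Longrightarrow> k \<le> \<eta> \<Longrightarrow> 1 \<le> c k \<and> c k \<le> m"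
  by (simp add: admissible_def)

lemma admissible_mono: "admissible \<eta> c m \<Longrightarrow> 1 \<le> k \<Longrightarrow> k \<le> l \<Longrightarrow> l \<le> \<eta> \<Longrightarrow> c k \<le> c l"
  by (auto simp: admissible_def elim: mono_onD)

section \<open>The linear system in diagonal coordinates\<close>

lemma positions_iff_diagonal:
  assumes "1 \<le> \<eta>"
  shows "diagonal \<eta> j \<in> positions p q \<longleftrightarrow> 1 \<le> j \<and> j \<le> q \<and> j + \<eta> - 1 \<le> p"
  using assms by (auto simp: diagonal_def positions_def)

lemma orbitope_system_shifted_column_iff:
  "d \<in> orbitope_system p q \<and> d \<notin> range Row_Sum \<union> range Nonneg \<longleftrightarrow>
     (\<exists>\<eta> j c. d = Shifted_Column (bar q (diagonal \<eta> j)) (shifted_column \<eta> c) \<and>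
        1 \<le> \<eta> \<and> 2 \<le> j \<and> j \<le> q \<and> j + \<eta> - 1 \<le> p \<and> admissible \<eta> c (j - 1))"
  (is "?L \<longleftrightarrow> ?R")
proof -
  have *: "(1 \<le> \<eta> \<and> 2 \<le> j \<and> diagonal \<eta> j \<in> positions p q \<and>
        (\<forall>k \<in> {1..\<eta>}. c k \<in> {1..q} \<and> c k \<le> j - 1) \<and> mono_on {1..\<eta>} c \<and>
        (2 \<le> \<eta> \<longrightarrow> c 1 = c 2) \<and> (\<eta> = 1 \<longrightarrow> j = c 1 + 1)) \<longleftrightarrow>
      (1 \<le> \<eta> \<and> 2 \<le> j \<and> j \<le> q \<and> j + \<eta> - 1 \<le> p \<and> admissible \<eta> c (j - 1))" for \<eta> j c
    unfolding admissible_def using positions_iff_diagonal[of \<eta> j p q] by auto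
  show ?thesis
    unfolding orbitope_system_def * by auto
qed

lemma orbitope_system_cases [consumes 1, case_names row nonneg shifted]:
  assumes "d \<in> orbitope_system p q"
  obtains
    i where "d = Row_Sum (row q i)" "1 \<le> i" "i \<le> p"
  | i j where "d = Nonneg (i, j)" "1 \<le> j" "j \<le> i" "i \<le> p" "j \<le> q" "j < i \<or> j = q"
  | \<eta> j c where "d = Shifted_Column (bar q (diagonal \<eta> j)) (shifted_column \<eta> c)"
      "1 \<le> \<eta>" "2 \<le> j" "j \<le> q" "j + \<eta> - 1 \<le> p" "admissible \<eta> c (j - 1)"
proof (cases d)
  case (Row_Sum R)
  with assms that(1) show ?thesis by (auto simp: orbitope_system_def)
next
  case (Nonneg e)
  then obtain i j where "d = Nonneg (i, j)" and ij: "(i, j) \<in> positions p q" "\<not> (i = j \<and> j < q)"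
    using assms by (auto simp: orbitope_system_def)
  moreover from ij have "1 \<le> j" "j \<le> i" "i \<le> p" "j \<le> q" "j < i \<or> j = q"
    by (auto simp: positions_def)
  ultimately show ?thesis
    using that(2) by blast
next
  case (Shifted_Column B S)
  with assms that(3) orbitope_system_shifted_column_iff[of d p q] show ?thesis by blast
qed

lemma row_sum_in_system: "1 \<le> i \<Longrightarrow> i \<le> p \<Longrightarrow> Row_Sum (row q i) \<in> orbitope_system p q"
  by (auto simp: orbitope_system_def)

lemma nonneg_in_system:
  "1 \<le> j \<Longrightarrow> j \<le> i \<Longrightarrow> i \<le> p \<Longrightarrow> j \<le> q \<Longrightarrow> j < i \<or> j = q \<Longrightarrow>
    Nonneg (i, j) \<in> orbitope_system p q"
  by (auto simp: orbitope_system_def positions_def)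

lemma shifted_column_in_system:
  "1 \<le> \<eta> \<Longrightarrow> 2 \<le> j \<Longrightarrow> j \<le> q \<Longrightarrow> j + \<eta> - 1 \<le> p \<Longrightarrow> admissible \<eta> c (j - 1) \<Longrightarrow>
    Shifted_Column (bar q (diagonal \<eta> j)) (shifted_column \<eta> c) \<in> orbitope_system p q"
  using orbitope_system_shifted_column_iff by blast

lemma finite_orbitope_system: "finite (orbitope_system p q)"
proof -
  have "orbitope_system p q \<subseteq> Row_Sum ` (row q ` {1..p}) \<union> Nonneg ` ({1..p} \<times> {1..q}) \<union>
     case_prod Shifted_Column ` (bar q ` ({1..p} \<times> {1..q}) \<times> Pow ({1..p + q} \<times> {1..q}))"
    (is "_ \<subseteq> ?A \<union> ?B \<union> ?C")
  proof
    fix d assume "d \<in> orbitope_system p q"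
    then show "d \<in> ?A \<union> ?B \<union> ?C"
    proof (cases rule: orbitope_system_cases)
      case (shifted \<eta> j c)
      have "diagonal \<eta> j \<in> {1..p} \<times> {1..q}"
        using shifted by (auto simp: diagonal_def)
      moreover have "shifted_column \<eta> c \<in> Pow ({1..p + q} \<times> {1..q})"
        using shifted admissible_bounds[OF shifted(6)]
        by (fastforce simp: shifted_column_def diagonal_def)
      ultimately show ?thesis
        unfolding shifted(1) by (intro UnI2 image_eqI[of _ _ "(_, _)"]) auto
    qed auto
  qed
  then show ?thesis
    by (rule finite_subset) auto
qed

lemma shifted_column_finite [simp]: "finite (shifted_column \<eta> c)"
  by (simp add: shifted_column_def)

lemma bar_finite [simp]: "finite (bar q e)"
  by (simp add: bar_def)

lemma row_finite [simp]: "finite (row q i)"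
  by (simp add: row_def)

text \<open>A shifted column has exactly one position on each of its first \<eta> diagonals, so
  membership is decided on the diagonal \<open>h\<close> alone.\<close>

lemma shifted_column_iff:
  assumes "1 \<le> h" "1 \<le> m"
  shows "(m + h - 1, m) \<in> shifted_column \<eta> c \<longleftrightarrow> h \<le> \<eta> \<and> c h = m"
proof
  assume "(m + h - 1, m) \<in> shifted_column \<eta> c"
  then obtain k where "k \<in> {1..\<eta>}" "m = c k" "m + h - 1 = c k + k - 1"
    by (auto simp: shifted_column_def diagonal_def)
  moreover from this assms have "h = k"
    by simp
  ultimately show "h \<le> \<eta> \<and> c h = m"
    by simp
next
  assume "h \<le> \<eta> \<and> c h = m"
  with assms show "(m + h - 1, m) \<in> shifted_column \<eta> c"
    by (auto simp: shifted_column_def diagonal_def)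
qed

lemma bar_iff: "(i', j') \<in> bar q (i, j) \<longleftrightarrow> i' = i \<and> j \<le> j' \<and> j' \<le> i \<and> j' \<le> q"
  by (auto simp: bar_def)

lemma sum_shifted_column:
  assumes "admissible \<eta> c m"
  shows "(\<Sum>e\<in>shifted_column \<eta> c. f e) = (\<Sum>k=1..\<eta>. f (c k + k - 1, c k))"
proof -
  have "inj_on (\<lambda>k. diagonal k (c k)) {1..\<eta>}"
    by (auto simp: inj_on_def diagonal_def)
  then show ?thesis
    by (simp add: shifted_column_def sum.reindex diagonal_def)
qed

text \<open>If the bar contains a one, the first ones of the columns form a path that must cross the shifted
  column; the crossing is a fixed point of a monotone self-map of \<open>{1..<j}\<close>.\<close>

lemma packing_pattern_meets_shifted_column:
  assumes F: "packing_pattern p q F" and c: "admissible \<eta> c (j - 1)" and "1 \<le> \<eta>" "2 \<le> j"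
    and l: "(j + \<eta> - 1, l) \<in> F" "j \<le> l"
  shows "shifted_column \<eta> c \<inter> F \<noteq> {}"
proof -
  define f where "f m = (LEAST i. (i, m) \<in> F)" for m
  \<comment> \<open>The index of the diagonal on which column \<open>m\<close> starts. It is weakly
    increasing because the starts move down by at least one row per column.\<close>
  define h where "h m = f m + 1 - m" for m
  have ex: "\<exists>i. (i, m) \<in> F \<and> i + (l - m) \<le> j + \<eta> - 1" if "1 \<le> m" "m < j" for m
    using packing_pattern_earlier[OF F l(1), of m] that l(2) by auto
  have f: "(f m, m) \<in> F" "f m + (l - m) \<le> j + \<eta> - 1" "m \<le> f m" if "1 \<le> m" "m < j" for m
  proof -
    obtain i where i: "(i, m) \<in> F" "i + (l - m) \<le> j + \<eta> - 1"
      using ex[OF \<open>1 \<le> m\<close> \<open>m < j\<close>] by blast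
    then show *: "(f m, m) \<in> F"
      unfolding f_def by (metis (mono_tags) LeastI)
    have "f m \<le> i"
      unfolding f_def using i(1) by (rule Least_le)
    with i show "f m + (l - m) \<le> j + \<eta> - 1" by simp
    show "m \<le> f m"
      using packing_pattern_le[OF F *] by simp
  qed
  have h_range: "1 \<le> h m \<and> h m \<le> \<eta>" if "1 \<le> m" "m < j" for m
    using f(2,3)[OF that] that l(2) \<open>1 \<le> \<eta>\<close> unfolding h_def by linarith
  have h_mono: "h m \<le> h n" if mn: "1 \<le> m" "m \<le> n" "n < j" for m n
  proof -
    have "1 \<le> n" using mn by simp
    obtain i where i: "i + (n - m) \<le> f n" "(i, m) \<in> F"
      using packing_pattern_earlier[OF F f(1)[OF \<open>1 \<le> n\<close> \<open>n < j\<close>] mn(1,2)] by blast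
    have "f m \<le> i"
      unfolding f_def using i(2) by (rule Least_le)
    with i(1) mn show ?thesis
      by (simp add: h_def)
  qed
  \<comment> \<open>The self-map sends \<open>m\<close> to \<open>c (h m)\<close>. As in the
    Knaster-Tarski theorem, the largest \<open>m\<close> not exceeding its image is a fixed
    point.\<close>
  define M where "M = {m \<in> {1..<j}. m \<le> c (h m)}"
  have c_range: "1 \<le> c (h m) \<and> c (h m) < j" if "1 \<le> m" "m < j" for m
    using admissible_bounds[OF c, of "h m"] h_range[OF that] \<open>2 \<le> j\<close> by auto
  have "1 \<in> M"
    using c_range[of 1] \<open>2 \<le> j\<close> by (simp add: M_def)
  moreover have "finite M"
    by (simp add: M_def)
  ultimately have "Max M \<in> M"
    by (metis Max_in empty_iff)
  define m where "m = Max M"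
  have m: "1 \<le> m" "m < j" "m \<le> c (h m)"
    using \<open>Max M \<in> M\<close> by (auto simp: M_def m_def)
  define n where "n = c (h m)"
  have n: "1 \<le> n" "n < j" "m \<le> n"
    using c_range[OF m(1,2)] m(3) by (auto simp: n_def)
  have "n \<le> c (h n)"
    unfolding n_def
  proof (rule admissible_mono[OF c])
    show "1 \<le> h m" "h m \<le> h (c (h m))" "h (c (h m)) \<le> \<eta>"
      using h_range[OF m(1,2)] h_range[OF n(1,2)] h_mono[OF m(1) n(3,2)] by (auto simp: n_def)
  qed
  then have "n \<in> M"
    using n by (simp add: M_def)
  then have "n \<le> m"
    unfolding m_def using \<open>finite M\<close> by simp
  then have "c (h m) = m"
    using m(3) by (simp add: n_def)
  then have "(f m, m) = diagonal (h m) (c (h m))"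
    using f(3)[OF m(1,2)] by (simp add: diagonal_def h_def)
  moreover have "h m \<in> {1..\<eta>}"
    using h_range[OF m(1,2)] by simp
  ultimately have "(f m, m) \<in> shifted_column \<eta> c"
    unfolding shifted_column_def by (rule image_eqI)
  then show ?thesis
    using f(1)[OF m(1,2)] by blast
qed

text \<open>A bar holds at most one one, so a single crossing with the shifted column is
  enough.\<close>

lemma packing_pattern_solution:
  assumes F: "packing_pattern p q F"
  shows "matrix_of F \<in> solution_set p q (orbitope_system p q)"
  unfolding solution_set_def
proof (intro CollectI conjI ballI)
  note fin = packing_pattern_finite[OF F]
  show "matrix_of F \<in> vectors_on (positions p q)"
    unfolding vectors_on_def
  proof (intro CollectI subsetI)
    fix e assume "e \<in> Poly_Mapping.keys (matrix_of F)"
    then have "e \<in> F"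
      by (simp add: keys_matrix_of[OF fin])
    then show "e \<in> positions p q"
      using packing_pattern_le[OF F, of "fst e" "snd e"] by (simp add: positions_def case_prod_beta)
  qed
  fix d assume "d \<in> orbitope_system p q"
  then show "satisfies (matrix_of F) d"
  proof (cases rule: orbitope_system_cases)
    case (row i)
    then show ?thesis
      using packing_pattern_row_card[OF F, of "row q i" i]
      by (simp add: sum_matrix_of[OF fin]) (auto simp: row_def)
  next
    case (nonneg i j)
    then show ?thesis by (simp add: entry_matrix_of[OF fin])
  next
    case (shifted \<eta> j c)
    let ?B = "bar q (diagonal \<eta> j)" and ?S = "shifted_column \<eta> c"
    have "card (?B \<inter> F) \<le> card (?S \<inter> F)"
    proof (cases "?B \<inter> F = {}")
      case False
      then obtain l where "(j + \<eta> - 1, l) \<in> F" "j \<le> l"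
        by (auto simp: bar_def diagonal_def)
      then have "?S \<inter> F \<noteq> {}"
        using packing_pattern_meets_shifted_column[OF F shifted(6)] shifted by blast
      then have "1 \<le> card (?S \<inter> F)"
        using fin by (simp add: Suc_le_eq card_gt_0_iff)
      moreover have "card (?B \<inter> F) \<le> 1"
        using packing_pattern_row_card[OF F, of ?B] by (auto simp: bar_def)
      ultimately show ?thesis by simp
    qed simp
    then show ?thesis
      by (simp add: shifted(1) sum_matrix_of[OF fin])
  qed
qed

section \<open>Minimal shifted columns\<close>

text \<open>For \<open>x\<close> supported on \<open>positions p q\<close>, the value \<open>min_shifted x i j\<close> at \<open>(i, j) = \<langle>\<eta>,j\<rangle>\<close> is the minimum
  of \<open>x(S)\<close> over the shifted columns \<open>S\<close> with \<open>c\<^sub>1 = c\<^sub>2 \<le> \<dots> \<le> c\<^sub>\<eta> \<le> j\<close> (with \<open>c\<^sub>1 = j\<close> if \<open>\<eta> = 1\<close>),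
  and \<open>last_column x i j\<close> is the index \<open>c\<^sub>\<eta>\<close> of a minimizer. Above the diagonal both are
  dummies, chosen such that the recursion needs no case distinction there.\<close>

fun min_shifted :: "(pos \<Rightarrow>\<^sub>0 'a::linordered_field) \<Rightarrow> nat \<Rightarrow> nat \<Rightarrow> 'a" where
  "min_shifted x 0 j = 0"
| "min_shifted x (Suc i) j =
     (if 1 < j \<and> j < Suc i \<and> min_shifted x i (j - 1) < min_shifted x i j + entry x (Suc i, j)
      then min_shifted x i (j - 1) else min_shifted x i j + entry x (Suc i, j))"

fun last_column :: "(pos \<Rightarrow>\<^sub>0 'a::linordered_field) \<Rightarrow> nat \<Rightarrow> nat \<Rightarrow> nat" where
  "last_column x 0 j = j"
| "last_column x (Suc i) j =
     (if 1 < j \<and> j < Suc i \<and> min_shifted x i (j - 1) < min_shifted x i j + entry x (Suc i, j)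
      then last_column x i (j - 1) else j)"

lemma entry_outside:
  "x \<in> vectors_on (positions p q) \<Longrightarrow> \<not> (1 \<le> j \<and> j \<le> i \<and> i \<le> p \<and> j \<le> q) \<Longrightarrow> entry x (i, j) = 0"
  by (auto simp: vectors_on_def positions_def in_keys_iff)

lemma min_shifted_above:
  assumes "x \<in> vectors_on (positions p q)"
  shows "i < j \<Longrightarrow> min_shifted x i j = 0"
  by (induction i) (simp_all add: entry_outside[OF assms])

lemma min_shifted_diagonal:
  assumes "x \<in> vectors_on (positions p q)"
  shows "min_shifted x j j = entry x (j, j)"
  using min_shifted_above[OF assms, of "j - 1" j] entry_outside[OF assms, of 0 0]
  by (cases j) auto

lemma min_shifted_le_left:
  "2 \<le> j \<Longrightarrow> j \<le> i \<Longrightarrow> min_shifted x (Suc i) j \<le> min_shifted x i (j - 1)"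
  by auto

lemma min_shifted_le_above:
  "min_shifted x (Suc i) j \<le> min_shifted x i j + entry x (Suc i, j)"
  by auto

lemma last_column_bounds: "1 \<le> j \<Longrightarrow> 1 \<le> last_column x i j \<and> last_column x i j \<le> j"
proof (induction x i j rule: last_column.induct)
  case (2 x i j)
  show ?case
  proof (cases "1 < j \<and> j < Suc i \<and> min_shifted x i (j - 1) < min_shifted x i j + entry x (Suc i, j)")
    case True
    moreover from True have "1 \<le> last_column x i (j - 1) \<and> last_column x i (j - 1) \<le> j - 1"
      by (intro 2(1)) auto
    ultimately show ?thesis
      by auto
  next
    case False
    then have "last_column x (Suc i) j = j"
      by (simp only: last_column.simps if_False)
    with 2(2) show ?thesis
      by simp
  qed
qed simp

lemma last_column_diagonal: "i \<le> j \<Longrightarrow> last_column x i j = j"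
  by (cases i) auto

text \<open>Left steps of the recursion stay on diagonal \<open>Suc e\<close> and keep the value.
  \<open>last_column\<close> is where they stop; there the recursion adds the entry and moves up to
  diagonal \<open>e\<close>.\<close>

lemma min_shifted_last_column:
  assumes "1 \<le> j"
  shows "min_shifted x (Suc e + j - 1) j =
    min_shifted x (e + last_column x (Suc e + j - 1) j - 1) (last_column x (Suc e + j - 1) j) +
    entry x (e + last_column x (Suc e + j - 1) j, last_column x (Suc e + j - 1) j)"
  using assms
proof (induction j)
  case (Suc j)
  show ?case
  proof (cases "0 < j \<and> 0 < e \<and>
      min_shifted x (e + j) j < min_shifted x (e + j) (Suc j) + entry x (Suc (e + j), Suc j)")
    case True
    then have "last_column x (Suc e + Suc j - 1) (Suc j) = last_column x (Suc e + j - 1) j"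
      "min_shifted x (Suc e + Suc j - 1) (Suc j) = min_shifted x (Suc e + j - 1) j"
      by simp_all
    with Suc.IH True show ?thesis
      by simp
  next
    case False
    then have "last_column x (Suc e + Suc j - 1) (Suc j) = Suc j"
      "min_shifted x (Suc e + Suc j - 1) (Suc j) =
        min_shifted x (e + j) (Suc j) + entry x (Suc (e + j), Suc j)"
      by auto
    then show ?thesis
      by simp
  qed
qed simp

definition shifted_sum :: "(pos \<Rightarrow>\<^sub>0 'a::linordered_field) \<Rightarrow> nat \<Rightarrow> (nat \<Rightarrow> nat) \<Rightarrow> 'a" where
  "shifted_sum x \<eta> c = (\<Sum>k=1..\<eta>. entry x (c k + k - 1, c k))"

text \<open>The induction on \<eta> + j mirrors the two branches of the recursion: if
  \<open>c \<eta> = j\<close>, the last position is dropped and the minimum moves up; otherwise all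
  of \<open>c\<close> fits into the first \<open>j - 1\<close> columns and the minimum moves left
  along its diagonal.\<close>

lemma min_shifted_le_shifted_sum:
  assumes x: "x \<in> vectors_on (positions p q)"
  shows "admissible \<eta> c j \<Longrightarrow> 1 \<le> \<eta> \<Longrightarrow> 1 \<le> j \<Longrightarrow> min_shifted x (\<eta> + j - 1) j \<le> shifted_sum x \<eta> c"
proof (induction "\<eta> + j" arbitrary: \<eta> j)
  case (Suc n)
  show ?case
  proof (cases "\<eta> = 1")
    case True
    with Suc.prems show ?thesis
      by (simp add: shifted_sum_def admissible_def min_shifted_diagonal[OF x])
  next
    case False
    then obtain e where \<eta>: "\<eta> = Suc e" "1 \<le> e"
      using Suc.prems(2) by (cases \<eta>) auto
    note adm = Suc.prems(1)[unfolded \<eta>(1)]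
    have cj: "c \<eta> \<le> j"
      using admissible_bounds[OF adm, of \<eta>] \<eta> by simp
    show ?thesis
    proof (cases "c \<eta> = j")
      case True
      \<comment> \<open>For \<eta> = 2 the truncation has length 1 and must consist of column
        \<open>j\<close> itself; \<open>c 1 = c 2\<close> provides this.\<close>
      have "admissible e c j"
        using adm True \<eta> unfolding admissible_def
        by (auto intro: mono_on_subset simp: numeral_2_eq_2)
      then have "min_shifted x (e + j - 1) j \<le> shifted_sum x e c"
        using Suc.hyps(2) \<eta> Suc.prems by (intro Suc.hyps(1)) auto
      moreover have "min_shifted x (\<eta> + j - 1) j \<le> min_shifted x (e + j - 1) j + entry x (j + \<eta> - 1, j)"
        using min_shifted_le_above[of x "e + j - 1" j] \<eta> by (simp add: add.commute)
      moreover have "shifted_sum x \<eta> c = shifted_sum x e c + entry x (j + \<eta> - 1, j)"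
        using True by (simp add: shifted_sum_def \<eta>(1))
      ultimately show ?thesis
        by linarith
    next
      case False
      have le: "c k \<le> j - 1" if "1 \<le> k" "k \<le> \<eta>" for k
        using admissible_mono[OF adm, of k \<eta>] that \<eta> False cj by simp
      have "1 \<le> c \<eta>"
        using admissible_bounds[OF adm, of \<eta>] \<eta> by simp
      then have "2 \<le> j"
        using False cj by simp
      have "admissible \<eta> c (j - 1)"
        using adm le \<eta> unfolding admissible_def by auto
      then have "min_shifted x (\<eta> + (j - 1) - 1) (j - 1) \<le> shifted_sum x \<eta> c"
        using Suc.hyps(2) \<eta> \<open>2 \<le> j\<close> by (intro Suc.hyps(1)) auto
      moreover have "min_shifted x (\<eta> + j - 1) j \<le> min_shifted x (e + j - 1) (j - 1)"
        using min_shifted_le_left[of j "e + j - 1" x] \<open>2 \<le> j\<close> \<eta> by simp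
      ultimately show ?thesis
        using \<eta> \<open>2 \<le> j\<close> by simp
    qed
  qed
qed simp

text \<open>The columns read backwards from the table of \<open>last_column\<close>:
  \<open>c k\<close> is looked up on diagonal \<open>k\<close> in the column
  \<open>c (k + 1)\<close> found before, starting from \<open>j\<close>. It is a predicate
  constraining only the indices 1 to \<eta>, so that the output array of the program can satisfy it
  whatever its other cells contain.\<close>

definition is_trace :: "(pos \<Rightarrow>\<^sub>0 'a::linordered_field) \<Rightarrow> nat \<Rightarrow> nat \<Rightarrow> (nat \<Rightarrow> nat) \<Rightarrow> bool" where
  "is_trace x \<eta> j c \<longleftrightarrow> (\<forall>k \<in> {1..\<eta>}.
     c k = (if k = \<eta> then last_column x (k + j - 1) j else last_column x (k + c (k + 1) - 1) (c (k + 1))))"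

lemma is_traceD:
  assumes "is_trace x \<eta> j c" "1 \<le> k" "k \<le> \<eta>"
  shows "k = \<eta> \<Longrightarrow> c k = last_column x (k + j - 1) j"
    and "k < \<eta> \<Longrightarrow> c k = last_column x (k + c (k + 1) - 1) (c (k + 1))"
  using bspec[OF assms(1)[unfolded is_trace_def], of k] assms(2,3) by simp_all

lemma is_traceI:
  assumes "1 \<le> \<eta> \<Longrightarrow> c \<eta> = last_column x (\<eta> + j - 1) j"
    and "\<And>k. 1 \<le> k \<Longrightarrow> k < \<eta> \<Longrightarrow> c k = last_column x (k + c (k + 1) - 1) (c (k + 1))"
  shows "is_trace x \<eta> j c"
  unfolding is_trace_def
proof
  fix k assume k: "k \<in> {1..\<eta>}"
  show "c k = (if k = \<eta> then last_column x (k + j - 1) j else last_column x (k + c (k + 1) - 1) (c (k + 1)))"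
  proof (cases "k = \<eta>")
    case True
    with assms(1) k show ?thesis by simp
  next
    case False
    with k have "1 \<le> k" "k < \<eta>" by simp_all
    with assms(2) False show ?thesis by simp
  qed
qed

lemma is_trace_Suc:
  assumes "is_trace x (Suc e) j c"
  shows "c (Suc e) = last_column x (Suc e + j - 1) j" "is_trace x e (c (Suc e)) c"
proof -
  show "c (Suc e) = last_column x (Suc e + j - 1) j"
    using is_traceD(1)[OF assms, of "Suc e"] by simp
  show "is_trace x e (c (Suc e)) c"
  proof (rule is_traceI)
    show "c e = last_column x (e + c (Suc e) - 1) (c (Suc e))" if "1 \<le> e"
      using is_traceD(2)[OF assms, of e] that by simp
    show "c k = last_column x (k + c (k + 1) - 1) (c (k + 1))" if "1 \<le> k" "k < e" for k
      using is_traceD(2)[OF assms, of k] that by simp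
  qed
qed

lemma is_trace_exists: "\<exists>c. is_trace x \<eta> j c"
proof (induction \<eta> arbitrary: j)
  case (Suc \<eta>)
  define m where "m = last_column x (Suc \<eta> + j - 1) j"
  obtain c where c: "is_trace x \<eta> m c"
    using Suc.IH by blast
  have "is_trace x (Suc \<eta>) j (c(Suc \<eta> := m))"
  proof (rule is_traceI)
    show "(c(Suc \<eta> := m)) (Suc \<eta>) = last_column x (Suc \<eta> + j - 1) j"
      by (simp add: m_def)
    fix k assume k: "1 \<le> k" "k < Suc \<eta>"
    show "(c(Suc \<eta> := m)) k =
      last_column x (k + (c(Suc \<eta> := m)) (k + 1) - 1) ((c(Suc \<eta> := m)) (k + 1))"
      using is_traceD[OF c, of k] k by (cases "k = \<eta>") simp_all
  qed
  then show ?case by (intro exI[of _ "c(Suc \<eta> := m)"])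
next
  case 0
  then show ?case by (intro exI[of _ id]) (simp add: is_trace_def)
qed

text \<open>A trace attains the minimum: one entry is split off per diagonal, and the rest is a
  trace that starts in the column just found.\<close>

lemma is_trace_sum:
  assumes x: "x \<in> vectors_on (positions p q)"
  shows "is_trace x \<eta> j c \<Longrightarrow> 1 \<le> j \<Longrightarrow>
    (\<forall>k \<in> {1..\<eta>}. 1 \<le> c k \<and> c k \<le> j) \<and> mono_on {1..\<eta>} c \<and>
    (1 \<le> \<eta> \<longrightarrow> shifted_sum x \<eta> c = min_shifted x (\<eta> + j - 1) j)"
proof (induction \<eta> arbitrary: j)
  case (Suc e)
  note trace = is_trace_Suc[OF Suc.prems(1)]
  let ?m = "c (Suc e)"
  have m: "1 \<le> ?m" "?m \<le> j"
    using last_column_bounds[OF Suc.prems(2)] trace(1) by auto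
  note IH = Suc.IH[OF trace(2) m(1)]
  have "1 \<le> c k \<and> c k \<le> j" if "k \<in> {1..Suc e}" for k
    using IH m that by (cases "k = Suc e") force+
  moreover have "mono_on {1..Suc e} c"
  proof (rule mono_onI)
    fix k l assume *: "k \<in> {1..Suc e}" "l \<in> {1..Suc e}" "k \<le> l"
    have mono: "mono_on {1..e} c" and bound: "\<forall>k \<in> {1..e}. c k \<le> ?m"
      using IH by auto
    show "c k \<le> c l"
    proof (cases "l = Suc e")
      case True
      then show ?thesis
        using bound * by (cases "k = Suc e") auto
    next
      case False
      with * show ?thesis
        by (intro mono_onD[OF mono]) auto
    qed
  qed
  moreover have "shifted_sum x (Suc e) c = min_shifted x (Suc e + j - 1) j"
  proof -
    have "min_shifted x (Suc e + j - 1) j = min_shifted x (e + ?m - 1) ?m + entry x (e + ?m, ?m)"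
      using min_shifted_last_column[OF Suc.prems(2), of x e] by (simp add: trace(1))
    moreover have "shifted_sum x e c = min_shifted x (e + ?m - 1) ?m"
    proof (cases e)
      \<comment> \<open>On the first diagonal nothing is left to sum, and the dummy value 0 of
        \<open>min_shifted\<close> above the diagonal matches the empty sum.\<close>
      case 0
      then show ?thesis
        using min_shifted_above[OF x, of "?m - 1" ?m] m by (simp add: shifted_sum_def)
    qed (use IH in auto)
    ultimately show ?thesis
      by (simp add: shifted_sum_def add.commute)
  qed
  ultimately show ?case
    by blast
qed (auto simp: shifted_sum_def mono_on_def)

text \<open>\<open>last_column\<close> is the identity on the main diagonal. This gives both special
  requirements: \<open>c 1 = c 2\<close> for longer traces and \<open>c 1 = j\<close> for length
  1.\<close>

lemma is_trace_admissible:
  assumes x: "x \<in> vectors_on (positions p q)" and c: "is_trace x \<eta> j c" "1 \<le> \<eta>" "1 \<le> j"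
  shows "admissible \<eta> c j"
proof -
  have "c 1 = c 2" if "2 \<le> \<eta>"
    using is_traceD(2)[OF c(1), of 1] that last_column_diagonal[of "c 2" "c 2" x]
    by (simp add: numeral_2_eq_2)
  moreover have "c 1 = j" if "\<eta> = 1"
    using is_traceD(1)[OF c(1), of 1] that last_column_diagonal[of j j x] by simp
  ultimately show ?thesis
    using is_trace_sum[OF x c(1,3)] unfolding admissible_def by blast
qed

lemma satisfies_shifted_column:
  assumes "admissible \<eta> c m"
  shows "satisfies x (Shifted_Column (bar q e) (shifted_column \<eta> c)) \<longleftrightarrow>
    (\<Sum>e\<in>bar q e. entry x e) \<le> shifted_sum x \<eta> c"
  by (simp add: sum_shifted_column[OF assms] shifted_sum_def)

text \<open>Serves twice: by contradiction in the reduction to one test per bar, and as the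
  certificate that the program outputs.\<close>

lemma shifted_column_violated:
  assumes x: "x \<in> vectors_on (positions p q)" and ij: "2 \<le> j" "j \<le> i" "i \<le> p" "j \<le> q"
    and viol: "min_shifted x (i - 1) (j - 1) < (\<Sum>e\<in>bar q (i, j). entry x e)"
    and c: "is_trace x (i + 1 - j) (j - 1) c"
  shows "Shifted_Column (bar q (i, j)) (shifted_column (i + 1 - j) c) \<in> orbitope_system p q"
    and "\<not> satisfies x (Shifted_Column (bar q (i, j)) (shifted_column (i + 1 - j) c))"
proof -
  let ?\<eta> = "i + 1 - j"
  have adm: "admissible ?\<eta> c (j - 1)"
    using ij by (intro is_trace_admissible[OF x c]) auto
  have "diagonal ?\<eta> j = (i, j)"
    using ij by (simp add: diagonal_def)
  then show "Shifted_Column (bar q (i, j)) (shifted_column ?\<eta> c) \<in> orbitope_system p q"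
    using shifted_column_in_system[of ?\<eta> j q p c] adm ij by simp
  have "shifted_sum x ?\<eta> c = min_shifted x (i - 1) (j - 1)"
    using is_trace_sum[OF x c] ij by simp
  then show "\<not> satisfies x (Shifted_Column (bar q (i, j)) (shifted_column ?\<eta> c))"
    using viol by (simp only: satisfies_shifted_column[OF adm] not_le)
qed

text \<open>For each bar, the whole family of shifted columns is replaced by one comparison with
  their minimum. The position \<open>(i - 1, j - 1)\<close> lies on the same diagonal as
  \<open>(i, j)\<close>, so the minimum there ranges over exactly the lengths and columns that the
  bar requires.\<close>

lemma shifted_columns_satisfied_iff:
  assumes x: "x \<in> vectors_on (positions p q)"
  shows "(\<forall>d \<in> orbitope_system p q - (range Row_Sum \<union> range Nonneg). satisfies x d) \<longleftrightarrow>
    (\<forall>i j. 2 \<le> j \<longrightarrow> j \<le> i \<longrightarrow> i \<le> p \<longrightarrow> j \<le> q \<longrightarrow>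
      (\<Sum>e\<in>bar q (i, j). entry x e) \<le> min_shifted x (i - 1) (j - 1))"
    (is "?L \<longleftrightarrow> ?R")
proof
  assume L: ?L
  show ?R
  proof (intro allI impI, rule ccontr)
    fix i j assume ij: "2 \<le> j" "j \<le> i" "i \<le> p" "j \<le> q"
      and viol: "\<not> (\<Sum>e\<in>bar q (i, j). entry x e) \<le> min_shifted x (i - 1) (j - 1)"
    obtain c where "is_trace x (i + 1 - j) (j - 1) c"
      using is_trace_exists by blast
    note violated = shifted_column_violated[OF x ij viol[unfolded not_le] this]
    show False
      using violated(2) L violated(1) by blast
  qed
next
  assume R: ?R
  show ?L
  proof
    fix d assume "d \<in> orbitope_system p q - (range Row_Sum \<union> range Nonneg)"
    then obtain \<eta> j c where d: "d = Shifted_Column (bar q (diagonal \<eta> j)) (shifted_column \<eta> c)"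
      and *: "1 \<le> \<eta>" "2 \<le> j" "j \<le> q" "j + \<eta> - 1 \<le> p" and adm: "admissible \<eta> c (j - 1)"
      using orbitope_system_shifted_column_iff[of d p q] by blast
    have "(\<Sum>e\<in>bar q (diagonal \<eta> j). entry x e) \<le> min_shifted x (j + \<eta> - 1 - 1) (j - 1)"
      unfolding diagonal_def using R[rule_format, of j "j + \<eta> - 1"] * by simp
    also have "j + \<eta> - 1 - 1 = \<eta> + (j - 1) - 1"
      using * by simp
    also have "min_shifted x (\<eta> + (j - 1) - 1) (j - 1) \<le> shifted_sum x \<eta> c"
      using * by (intro min_shifted_le_shifted_sum[OF x adm]) auto
    finally show "satisfies x d"
      unfolding d satisfies_shifted_column[OF adm] .
  qed
qed

section \<open>Solutions are convex combinations of generators\<close>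

text \<open>\<open>X\<close> is a nonnegative combination of elements of \<open>V\<close> with total
  weight \<open>t\<close>. Leaving the weight unnormalized lets mass be split and merged freely,
  including mass 0.\<close>

inductive mix :: "'v::real_vector set \<Rightarrow> real \<Rightarrow> 'v \<Rightarrow> bool" for V where
  mix_zero: "mix V 0 0"
| mix_add: "mix V t X \<Longrightarrow> v \<in> V \<Longrightarrow> 0 \<le> a \<Longrightarrow> mix V (t + a) (X + a *\<^sub>R v)"

lemma mix_nonneg: "mix V t X \<Longrightarrow> 0 \<le> t"
  by (induction rule: mix.induct) auto

lemma mix_plus:
  assumes "mix V t X" "mix V u Y"
  shows "mix V (t + u) (X + Y)"
  using assms(2,1)
proof (induction rule: mix.induct)
  case (mix_add u Y v a)
  then have "mix V (t + u + a) (X + Y + a *\<^sub>R v)"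
    by (intro mix.mix_add) auto
  then show ?case
    by (simp add: add.assoc)
qed simp

lemma mix_scale:
  assumes "mix V t X" "0 \<le> c"
  shows "mix V (c * t) (c *\<^sub>R X)"
  using assms
proof (induction rule: mix.induct)
  case (mix_add t X v a)
  then have "mix V (c * t + c * a) (c *\<^sub>R X + (c * a) *\<^sub>R v)"
    by (intro mix.mix_add) auto
  then show ?case
    by (simp add: algebra_simps)
qed (simp add: mix_zero)

lemma mix_translate:
  assumes "mix V t X" "\<And>v. v \<in> V \<Longrightarrow> v + e \<in> V'"
  shows "mix V' t (X + t *\<^sub>R e)"
  using assms
proof (induction rule: mix.induct)
  case (mix_add t X v a)
  then have "mix V' (t + a) (X + t *\<^sub>R e + a *\<^sub>R (v + e))"
    by (intro mix.mix_add) auto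
  then show ?case
    by (simp add: algebra_simps)
qed (simp add: mix_zero)

lemma mix_mono:
  assumes "mix V t X" "V \<subseteq> V'"
  shows "mix V' t X"
  using assms(1) by (induction rule: mix.induct) (use assms(2) in \<open>auto intro: mix.intros\<close>)

lemma mix_zero_weight: "mix V 0 X \<Longrightarrow> X = 0"
proof -
  have "t = 0 \<Longrightarrow> X = 0" if "mix V t X" for t
    using that
  proof (induction rule: mix.induct)
    case (mix_add t X v a)
    then have "t = 0" "a = 0"
      using mix_nonneg[OF mix_add(1)] by auto
    with mix_add show ?case by simp
  qed simp
  then show "mix V 0 X \<Longrightarrow> X = 0" by blast
qed

lemma mix_sum:
  "finite K \<Longrightarrow> (\<And>k. k \<in> K \<Longrightarrow> mix V (t k) (X k)) \<Longrightarrow> mix V (\<Sum>k\<in>K. t k) (\<Sum>k\<in>K. X k)"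
  by (induction K rule: finite_induct) (auto intro: mix.intros mix_plus)

lemma mix_in_hull: "mix V t X \<Longrightarrow> 0 < t \<Longrightarrow> X /\<^sub>R t \<in> convex hull V"
proof (induction rule: mix.induct)
  case (mix_add t X v a)
  have v: "v \<in> convex hull V"
    using mix_add.hyps(2) by (rule hull_inc)
  show ?case
  proof (cases "t = 0")
    case True
    with mix_add mix_zero_weight v show ?thesis by fastforce
  next
    case False
    then have t: "0 < t"
      using mix_nonneg[OF mix_add.hyps(1)] by simp
    then have "t / (t + a) + a / (t + a) = 1"
      using mix_add.hyps(3) by (simp flip: add_divide_distrib)
    then have "(t / (t + a)) *\<^sub>R (X /\<^sub>R t) + (a / (t + a)) *\<^sub>R v \<in> convex hull V"
      using mix_add.IH[OF t] v mix_add.hyps(3) t by (intro convexD[OF convex_convex_hull]) auto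
    also have "(t / (t + a)) *\<^sub>R (X /\<^sub>R t) + (a / (t + a)) *\<^sub>R v = (X + a *\<^sub>R v) /\<^sub>R (t + a)"
      using t by (simp add: scaleR_add_right divide_inverse mult.commute)
    finally show ?thesis .
  qed
qed simp

text \<open>Every summand is divided in the ratio a : b. In this way the mass in one state of the
  row process branches.\<close>

lemma mix_split:
  assumes "mix V (a + b) X" "0 \<le> a" "0 \<le> b"
  shows "\<exists>Y Z. mix V a Y \<and> mix V b Z \<and> X = Y + Z"
proof (cases "a + b = 0")
  case True
  with assms have "a = 0" "b = 0" "X = 0"
    using mix_zero_weight by auto
  then show ?thesis
    using mix_zero by fastforce
next
  case False
  have "mix V (a / (a + b) * (a + b)) ((a / (a + b)) *\<^sub>R X)"
    "mix V (b / (a + b) * (a + b)) ((b / (a + b)) *\<^sub>R X)"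
    using mix_scale[OF assms(1), of "a / (a + b)"] mix_scale[OF assms(1), of "b / (a + b)"] assms(2,3)
    by simp_all
  moreover have "X = (a / (a + b)) *\<^sub>R X + (b / (a + b)) *\<^sub>R X"
    using False by (simp flip: scaleR_add_left add_divide_distrib)
  ultimately show ?thesis
    using False by auto
qed

text \<open>For each \<open>j\<close> a part of weight \<open>m j\<close> is split off and every
  vector in it is shifted by \<open>e j\<close>; the rest stays as it is, whence
  \<open>V \<subseteq> V'\<close>. Legality of a shift is required only for
  \<open>m j \<noteq> 0\<close>, since the forbidden pairs of the transport plan carry no
  mass.\<close>

lemma mix_distribute:
  assumes X: "mix V t X" and m: "finite J" "\<And>j. j \<in> J \<Longrightarrow> 0 \<le> m j" "(\<Sum>j\<in>J. m j) \<le> t"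
    and V: "V \<subseteq> V'" and e: "\<And>j v. j \<in> J \<Longrightarrow> m j \<noteq> 0 \<Longrightarrow> v \<in> V \<Longrightarrow> v + e j \<in> V'"
  shows "mix V' t (X + (\<Sum>j\<in>J. m j *\<^sub>R e j))"
  using m e X
proof (induction J arbitrary: t X rule: finite_induct)
  case empty
  then show ?case
    using mix_mono[OF _ V] by simp
next
  case (insert j J)
  have j: "0 \<le> m j" and rest: "0 \<le> (\<Sum>j\<in>J. m j)" "(\<Sum>j\<in>J. m j) \<le> t - m j"
    using insert.prems(1,2) insert.hyps by (auto intro!: sum_nonneg)
  obtain Y Z where YZ: "mix V (m j) Y" "mix V (t - m j) Z" "X = Y + Z"
    using mix_split[of V "m j" "t - m j" X] insert.prems(4) j rest by auto
  have "mix V' (t - m j) (Z + (\<Sum>j\<in>J. m j *\<^sub>R e j))"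
    using insert.prems rest(2) YZ(2) by (intro insert.IH) auto
  moreover have "mix V' (m j) (Y + m j *\<^sub>R e j)"
  proof (cases "m j = 0")
    case True
    then show ?thesis
      using YZ(1) mix_mono[OF _ V] by simp
  next
    case False
    then show ?thesis
      using insert.prems(3) by (intro mix_translate[OF YZ(1)]) auto
  qed
  ultimately have "mix V' (m j + (t - m j)) (Y + m j *\<^sub>R e j + (Z + (\<Sum>j\<in>J. m j *\<^sub>R e j)))"
    by (rule mix_plus[rotated])
  then show ?case
    using insert.hyps by (simp add: YZ(3) algebra_simps)
qed

text \<open>Groups the histories of the first \<open>i\<close> rows by the state \<open>k\<close> of
  the process; the legal moves in the next row depend on the state only.\<close>

definition patterns :: "nat \<Rightarrow> nat \<Rightarrow> nat \<Rightarrow> pos set set" where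
  "patterns q i k = {F. packing_pattern i q F \<and> snd ` F = {1..k}}"

lemma patterns_Suc: "F \<in> patterns q i k \<Longrightarrow> F \<in> patterns q (Suc i) k"
  unfolding patterns_def
proof (elim CollectE conjE, intro CollectI conjI)
  assume F: "packing_pattern i q F"
  show "packing_pattern (Suc i) q F"
  proof (rule packing_patternI)
    show "\<exists>i''<i'. (i'', j - 1) \<in> F" if "(i', j) \<in> F" "2 \<le> j" for i' j
      using F that by (simp add: packing_pattern_def)
    show "1 \<le> i' \<and> i' \<le> Suc i \<and> 1 \<le> j \<and> j \<le> q" if "(i', j) \<in> F" for i' j
      using packing_pattern_le[OF F that] by auto
  qed (fact packing_pattern_unique[OF F])
qed

text \<open>\<open>max k j\<close> handles both legal moves at once: for \<open>j \<le> k\<close>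
  the state is kept, for \<open>j = k + 1\<close> a column is opened.\<close>

lemma patterns_insert:
  assumes F: "F \<in> patterns q i k" and j: "1 \<le> j" "j \<le> Suc k" "j \<le> q"
  shows "insert (Suc i, j) F \<in> patterns q (Suc i) (max k j)"
    and "matrix_of (insert (Suc i, j) F) = matrix_of F + Poly_Mapping.single (Suc i, j) 1"
proof -
  have pat: "packing_pattern i q F" and cols: "snd ` F = {1..k}"
    using F by (auto simp: patterns_def)
  have new: "(Suc i, j') \<notin> F" for j'
    using packing_pattern_le(3)[OF pat, of "Suc i" j'] by auto
  show "matrix_of (insert (Suc i, j) F) = matrix_of F + Poly_Mapping.single (Suc i, j) 1"
    using packing_pattern_finite[OF pat] new by (simp add: matrix_of_def add.commute)
  have "packing_pattern (Suc i) q (insert (Suc i, j) F)"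
  proof (rule packing_patternI)
    fix i' j' assume *: "(i', j') \<in> insert (Suc i, j) F"
    show "1 \<le> i' \<and> i' \<le> Suc i \<and> 1 \<le> j' \<and> j' \<le> q"
      using * packing_pattern_le[OF pat, of i' j'] j by auto
    show "j' = j''" if "(i', j'') \<in> insert (Suc i, j) F" for j''
      using * that new packing_pattern_unique[OF pat, of i' j' j''] by auto
    show "\<exists>i''<i'. (i'', j' - 1) \<in> insert (Suc i, j) F" if "2 \<le> j'"
    proof (cases "(i', j') \<in> F")
      case True
      then have "\<exists>i''<i'. (i'', j' - 1) \<in> F"
        using pat that by (simp add: packing_pattern_def)
      then show ?thesis by auto
    next
      case False
      with * have eq: "i' = Suc i" "j' = j" by auto
      with that j have "j' - 1 \<in> snd ` F"
        unfolding cols by auto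
      then obtain i'' where i'': "(i'', j' - 1) \<in> F"
        by auto
      with packing_pattern_le(3)[OF pat this] eq show ?thesis
        by (intro exI[of _ i'']) auto
    qed
  qed
  moreover have "snd ` insert (Suc i, j) F = {1..max k j}"
    using j cols by auto
  ultimately show "insert (Suc i, j) F \<in> patterns q (Suc i) (max k j)"
    by (simp add: patterns_def)
qed

text \<open>The plan assigns to \<open>(k, j)\<close> the length of the overlap of \<open>[R (j + 1), R j]\<close>
  and \<open>[S (k + 1), S k]\<close>.\<close>

lemma transport_plan:
  fixes R S :: "nat \<Rightarrow> real"
  assumes R: "\<And>j. 1 \<le> j \<Longrightarrow> R (Suc j) \<le> R j" "R N = 0"
    and S: "\<And>k. S (Suc k) \<le> S k" "S N = 0"
    and RS: "\<And>j. 1 \<le> j \<Longrightarrow> j \<le> N \<Longrightarrow> R j \<le> S j" and N: "1 \<le> N"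
  obtains m :: "nat \<Rightarrow> nat \<Rightarrow> real" where
    "\<And>k j. 1 \<le> j \<Longrightarrow> 0 \<le> m k j"
    "\<And>k j. 1 \<le> j \<Longrightarrow> j \<le> N \<Longrightarrow> k < j \<Longrightarrow> m k j = 0"
    "\<And>j. 1 \<le> j \<Longrightarrow> j < N \<Longrightarrow> (\<Sum>k<N. m k j) = R j - R (Suc j)"
    "\<And>k. k < N \<Longrightarrow> (\<Sum>j=1..<N. m k j) \<le> S k - S (Suc k)"
proof -
  \<comment> \<open>A mixed second difference of \<open>min\<close>: it yields the overlap length in
    one formula, and both marginals telescope.\<close>
  define m where "m k j = (min (R j) (S k) - min (R (Suc j)) (S k)) -
    (min (R j) (S (Suc k)) - min (R (Suc j)) (S (Suc k)))" for k j
  have S_anti: "S l \<le> S k" if "k \<le> l" for k l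
    using that S(1) by (rule lift_Suc_antimono_le[rotated])
  have R_nonneg: "0 \<le> R j" if "1 \<le> j" "j \<le> N" for j
    using that(2,1)
  proof (induction rule: inc_induct)
    case base
    then show ?case by (simp add: R)
  next
    case (step j)
    then show ?case using R(1)[of j] by force
  qed
  show ?thesis
  proof (rule that[of m])
    show "0 \<le> m k j" if "1 \<le> j" for k j
      using R(1)[OF that] S(1)[of k] by (auto simp: m_def min_def)
    \<comment> \<open>Here \<open>RS\<close> acts as Hall condition:
      \<open>R j \<le> S j \<le> S (k + 1)\<close> leaves no overlap.\<close>
    show "m k j = 0" if "1 \<le> j" "j \<le> N" "k < j" for k j
    proof -
      have "R j \<le> S (Suc k)" "R j \<le> S k"
        using RS[OF that(1,2)] S_anti[of "Suc k" j] S(1)[of k] that by auto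
      then show ?thesis
        using R(1)[OF that(1)] by (simp add: m_def min_def)
    qed
    show "(\<Sum>k<N. m k j) = R j - R (Suc j)" if "1 \<le> j" "j < N" for j
    proof -
      have "(\<Sum>k<N. m k j) = (min (R j) (S 0) - min (R (Suc j)) (S 0)) - (min (R j) (S N) - min (R (Suc j)) (S N))"
        unfolding m_def by (rule sum_lessThan_telescope')
      moreover have "R j \<le> S 0" "R (Suc j) \<le> S 0"
        using RS[of j] S_anti[of 0 j] R(1)[of j] that by auto
      moreover have "0 \<le> R j" "0 \<le> R (Suc j)"
        using R_nonneg that by auto
      ultimately show ?thesis
        by (simp add: S(2) min_absorb1 min_absorb2)
    qed
    \<comment> \<open>Only an inequality, since the intervals of \<open>R\<close> cover just the
      part from 0 to \<open>R 1\<close>; the mass beyond leaves the row empty.\<close>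
    show "(\<Sum>j=1..<N. m k j) \<le> S k - S (Suc k)" if "k < N" for k
    proof -
      let ?f = "\<lambda>j. min (R j) (S k) - min (R j) (S (Suc k))"
      have "(\<Sum>j=1..<N. m k j) = - (\<Sum>j=1..<N. ?f (Suc j) - ?f j)"
        unfolding m_def sum_negf[symmetric] by (rule sum.cong) auto
      also have "(\<Sum>j=1..<N. ?f (Suc j) - ?f j) = ?f N - ?f 1"
        using N by (rule sum_Suc_diff')
      also have "- (?f N - ?f 1) \<le> S k - S (Suc k)"
        using S(1)[of k] S_anti[of k N] S_anti[of "Suc k" N] that by (auto simp: R(2) S(2) min_def)
      finally show ?thesis .
    qed
  qed
qed

text \<open>Here \<open>D i j\<close> is the probability that column \<open>j\<close> has been opened in the first \<open>i\<close> rows, so that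
  exactly \<open>k\<close> columns are open with probability \<open>D i k - D i (k + 1)\<close>. The ones that do not
  open a column are distributed by a transport plan.\<close>

lemma flow_decomposition:
  fixes x :: "pos \<Rightarrow> real"
  assumes D_zero: "\<And>i. D i 0 = 1" and D_init: "\<And>j. D 0 (Suc j) = 0"
    and D_beyond: "\<And>i j. q < j \<Longrightarrow> D i j = 0"
    and D_mono: "\<And>i j. D i j \<le> D (Suc i) j"
    and D_shift: "\<And>i j. D (Suc i) (Suc j) \<le> D i j"
    and D_step: "\<And>i j. 1 \<le> j \<Longrightarrow> i < p \<Longrightarrow> D (Suc i) j - D i j \<le> x (Suc i, j)"
    and D_bar: "\<And>i j. 1 \<le> j \<Longrightarrow> j \<le> q \<Longrightarrow> i < p \<Longrightarrow> (\<Sum>l=j..q. x (Suc i, l)) \<le> D (Suc i) j"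
  shows "i \<le> p \<Longrightarrow> \<exists>X. (\<forall>k\<le>q. mix (matrix_of ` patterns q i k) (D i k - D i (Suc k)) (X k)) \<and>
     (\<Sum>k\<le>q. X k) = (\<Sum>e\<in>{1..i} \<times> {1..q}. x e *\<^sub>R Poly_Mapping.single e 1)"
proof (induction i)
  case 0
  have "mix (matrix_of ` patterns q 0 k) (D 0 k - D 0 (Suc k)) 0" for k
  proof (cases k)
    case 0
    have "{} \<in> patterns q 0 0"
      by (simp add: patterns_def packing_pattern_def)
    then have "0 \<in> matrix_of ` patterns q 0 0"
      by (force simp: matrix_of_def)
    then have "mix (matrix_of ` patterns q 0 0) (0 + 1) (0 + 1 *\<^sub>R 0)"
      by (intro mix.intros) auto
    then show ?thesis
      using 0 by (simp add: D_zero D_init)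
  qed (simp add: D_init mix_zero)
  then show ?case
    by (intro exI[of _ "\<lambda>_. 0"]) simp
next
  case (Suc i)
  \<comment> \<open>Of the mass in state \<open>k\<close>, the amount \<open>a k\<close> opens
    column \<open>k + 1\<close> in the new row and \<open>s k\<close> keeps the state.
    \<open>r j\<close> is what column \<open>j\<close> must still receive from states in which it is
    open; \<open>R\<close> and \<open>S\<close> are tail sums of demand and supply.\<close>
  define a where "a k = D (Suc i) (Suc k) - D i (Suc k)" for k
  define s where "s k = D i k - D (Suc i) (Suc k)" for k
  define r where "r j = x (Suc i, j) - a (j - 1)" for j
  define R where "R j = (\<Sum>l=j..q. r l)" for j
  define S where "S k = (\<Sum>l=k..q. s l)" for k
  define E :: "nat \<Rightarrow> (pos \<Rightarrow>\<^sub>0 real)" where "E j = Poly_Mapping.single (Suc i, j) 1" for j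
  have a_nonneg: "0 \<le> a k" for k
    using D_mono by (simp add: a_def)
  have s_nonneg: "0 \<le> s k" for k
    using D_shift by (simp add: s_def)
  have r_nonneg: "0 \<le> r j" if "1 \<le> j" for j
    using D_step[of j i] Suc.prems that by (cases j) (auto simp: r_def a_def)
  have R_diff: "R j - R (Suc j) = (if j \<le> q then r j else 0)" for j
    by (auto simp: R_def sum.atLeast_Suc_atMost)
  have S_diff: "S j - S (Suc j) = (if j \<le> q then s j else 0)" for j
    by (auto simp: S_def sum.atLeast_Suc_atMost)
  \<comment> \<open>The sum telescopes: supply from the states \<open>j\<close> and above exceeds
    the demand of the columns from \<open>j\<close> on by exactly \<open>D (Suc i) j\<close> minus
    the bar sum.\<close>
  have RS: "R j \<le> S j" if "1 \<le> j" "j \<le> Suc q" for j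
  proof (cases "j = Suc q")
    case False
    then have j: "j \<le> q" using that by simp
    have "(\<Sum>l=j..q. s l + a (l - 1)) = (\<Sum>l=j..q. D (Suc i) l - D (Suc i) (Suc l))"
      using that(1) by (intro sum.cong) (auto simp: s_def a_def)
    also have "\<dots> = - (\<Sum>l=j..q. D (Suc i) (Suc l) - D (Suc i) l)"
      unfolding sum_negf[symmetric] by (rule sum.cong) auto
    also have "\<dots> = D (Suc i) j"
      using j by (simp add: sum_Suc_diff D_beyond)
    finally have "S j - R j = D (Suc i) j - (\<Sum>l=j..q. x (Suc i, l))"
      by (simp add: S_def R_def r_def sum.distrib sum_subtractf)
    with D_bar[of j i] that(1) j Suc.prems show ?thesis
      by simp
  qed (simp add: R_def S_def)
  have "R (Suc j) \<le> R j" if "1 \<le> j" for j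
    using R_diff[of j] r_nonneg[OF that] by (simp split: if_splits)
  moreover have "S (Suc k) \<le> S k" for k
    using S_diff[of k] s_nonneg[of k] by (simp split: if_splits)
  moreover have "R (Suc q) = 0" "S (Suc q) = 0"
    by (simp_all add: R_def S_def)
  ultimately obtain m where m: "\<And>k j. 1 \<le> j \<Longrightarrow> 0 \<le> m k j"
    "\<And>k j. 1 \<le> j \<Longrightarrow> j \<le> Suc q \<Longrightarrow> k < j \<Longrightarrow> m k j = 0"
    "\<And>j. 1 \<le> j \<Longrightarrow> j < Suc q \<Longrightarrow> (\<Sum>k<Suc q. m k j) = R j - R (Suc j)"
    "\<And>k. k < Suc q \<Longrightarrow> (\<Sum>j=1..<Suc q. m k j) \<le> S k - S (Suc k)"
    using RS by (elim transport_plan[of R "Suc q" S]) auto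
  obtain X where X: "\<And>k. k \<le> q \<Longrightarrow> mix (matrix_of ` patterns q i k) (D i k - D i (Suc k)) (X k)"
    and X_sum: "(\<Sum>k\<le>q. X k) = (\<Sum>e\<in>{1..i} \<times> {1..q}. x e *\<^sub>R Poly_Mapping.single e 1)"
    using Suc by auto
  have "\<exists>Y Z. mix (matrix_of ` patterns q i k) (s k) Y \<and> mix (matrix_of ` patterns q i k) (a k) Z \<and> X k = Y + Z"
    if "k \<le> q" for k
    using X[OF that] s_nonneg[of k] a_nonneg[of k] by (intro mix_split) (auto simp: s_def a_def)
  then obtain Y Z where Y: "\<And>k. k \<le> q \<Longrightarrow> mix (matrix_of ` patterns q i k) (s k) (Y k)"
    and Z: "\<And>k. k \<le> q \<Longrightarrow> mix (matrix_of ` patterns q i k) (a k) (Z k)"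
    and XYZ: "\<And>k. k \<le> q \<Longrightarrow> X k = Y k + Z k"
    by metis
  define Y' where "Y' k = Y k + (\<Sum>j=1..<Suc q. m k j *\<^sub>R E j)" for k
  define Z' where "Z' k = Z k + a k *\<^sub>R E (Suc k)" for k
  \<comment> \<open>State \<open>k\<close> after the row consists of the mass that stayed in
    \<open>k\<close> and the mass that arrived from \<open>k - 1\<close> by opening column
    \<open>k\<close>.\<close>
  define X' where "X' k = Y' k + (case k of 0 \<Rightarrow> 0 | Suc l \<Rightarrow> Z' l)" for k
  have Y': "mix (matrix_of ` patterns q (Suc i) k) (s k) (Y' k)" if "k \<le> q" for k
    unfolding Y'_def
  proof (rule mix_distribute[OF Y[OF that]])
    show "(\<Sum>j=1..<Suc q. m k j) \<le> s k"
      using m(4)[of k] S_diff[of k] that by auto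
    show "0 \<le> m k j" if "j \<in> {1..<Suc q}" for j
      using m(1) that by auto
    show "matrix_of ` patterns q i k \<subseteq> matrix_of ` patterns q (Suc i) k"
      using patterns_Suc by (intro image_mono) auto
    fix j v assume j: "j \<in> {1..<Suc q}" "m k j \<noteq> 0" and "v \<in> matrix_of ` patterns q i k"
    then obtain F where F: "F \<in> patterns q i k" "v = matrix_of F" by blast
    have "j \<le> k"
      using m(2)[of j k] j by (meson atLeastLessThan_iff less_imp_le not_le)
    then show "v + E j \<in> matrix_of ` patterns q (Suc i) k"
      using patterns_insert[OF F(1), of j] j by (force simp: F(2) E_def max_def)
  qed simp
  have Z': "mix (matrix_of ` patterns q (Suc i) (Suc k)) (a k) (Z' k)" if "k < q" for k
    unfolding Z'_def
  proof (rule mix_translate)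
    show "mix (matrix_of ` patterns q i k) (a k) (Z k)"
      using Z that by simp
    fix v assume "v \<in> matrix_of ` patterns q i k"
    then obtain F where F: "F \<in> patterns q i k" "v = matrix_of F" by blast
    then show "v + E (Suc k) \<in> matrix_of ` patterns q (Suc i) (Suc k)"
      using patterns_insert[OF F(1), of "Suc k"] that by (force simp: F(2) E_def max_def)
  qed
  have "mix (matrix_of ` patterns q (Suc i) k) (D (Suc i) k - D (Suc i) (Suc k)) (X' k)" if "k \<le> q" for k
  proof (cases k)
    case 0
    then show ?thesis
      using Y'[OF that] by (simp add: X'_def s_def D_zero)
  next
    case (Suc l)
    have "mix (matrix_of ` patterns q (Suc i) k) (s k + a l) (Y' k + Z' l)"
      using Y'[OF that] Z'[of l] Suc that by (intro mix_plus) auto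
    then show ?thesis
      using Suc by (simp add: X'_def s_def a_def)
  qed
  moreover have "(\<Sum>k\<le>q. X' k) = (\<Sum>e\<in>{1..Suc i} \<times> {1..q}. x e *\<^sub>R Poly_Mapping.single e 1)"
  proof -
    \<comment> \<open>In state \<open>q\<close> no column is left to open, so the opening part has
      weight 0.\<close>
    have "D (Suc i) (Suc q) = 0" "D i (Suc q) = 0"
      by (auto intro: D_beyond)
    then have "Z q = 0"
      using Z[of q] mix_zero_weight by (auto simp: a_def)
    have "(\<Sum>k\<le>q. case k of 0 \<Rightarrow> 0 | Suc l \<Rightarrow> Z' l) = (\<Sum>k<q. Z' k)"
      by (simp add: sum.atMost_shift)
    also have "\<dots> = (\<Sum>k<q. Z k) + (\<Sum>k<q. a k *\<^sub>R E (Suc k))"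
      by (simp add: Z'_def sum.distrib)
    also have "(\<Sum>k<q. Z k) = (\<Sum>k\<le>q. Z k)"
      using \<open>Z q = 0\<close> by (simp add: lessThan_Suc_atMost[symmetric])
    also have "(\<Sum>k<q. a k *\<^sub>R E (Suc k)) = (\<Sum>j=1..<Suc q. a (j - 1) *\<^sub>R E j)"
      unfolding One_nat_def sum.shift_bounds_Suc_ivl by (simp add: atLeast0LessThan)
    finally have Zs: "(\<Sum>k\<le>q. case k of 0 \<Rightarrow> 0 | Suc l \<Rightarrow> Z' l) =
      (\<Sum>k\<le>q. Z k) + (\<Sum>j=1..<Suc q. a (j - 1) *\<^sub>R E j)" .
    have "(\<Sum>k\<le>q. Y' k) = (\<Sum>k\<le>q. Y k) + (\<Sum>j=1..<Suc q. \<Sum>k\<le>q. m k j *\<^sub>R E j)"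
      unfolding Y'_def sum.distrib by (subst sum.swap) simp
    also have "(\<Sum>j=1..<Suc q. \<Sum>k\<le>q. m k j *\<^sub>R E j) = (\<Sum>j=1..<Suc q. r j *\<^sub>R E j)"
    proof (rule sum.cong)
      fix j assume j: "j \<in> {1..<Suc q}"
      then have "(\<Sum>k\<le>q. m k j) = r j"
        using m(3)[of j] R_diff[of j] by (simp add: lessThan_Suc_atMost)
      then show "(\<Sum>k\<le>q. m k j *\<^sub>R E j) = r j *\<^sub>R E j"
        by (simp flip: scaleR_sum_left)
    qed simp
    finally have "(\<Sum>k\<le>q. X' k) = (\<Sum>k\<le>q. Y k) + (\<Sum>k\<le>q. Z k) +
      ((\<Sum>j=1..<Suc q. r j *\<^sub>R E j) + (\<Sum>j=1..<Suc q. a (j - 1) *\<^sub>R E j))"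
      unfolding X'_def sum.distrib Zs by simp
    also have "(\<Sum>k\<le>q. Y k) + (\<Sum>k\<le>q. Z k) = (\<Sum>k\<le>q. X k)"
      by (simp add: XYZ sum.distrib)
    also have "(\<Sum>j=1..<Suc q. r j *\<^sub>R E j) + (\<Sum>j=1..<Suc q. a (j - 1) *\<^sub>R E j) = (\<Sum>j=1..<Suc q. x (Suc i, j) *\<^sub>R E j)"
      unfolding sum.distrib[symmetric] by (rule sum.cong) (auto simp: r_def algebra_simps)
    also have "\<dots> = (\<Sum>e\<in>{Suc i} \<times> {1..q}. x e *\<^sub>R Poly_Mapping.single e 1)"
    proof -
      have "{Suc i} \<times> {1..q} = Pair (Suc i) ` {1..<Suc q}"
        by auto
      moreover have "inj_on (Pair (Suc i)) {1..<Suc q}"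
        by (simp add: inj_on_def)
      ultimately show ?thesis
        by (simp only: sum.reindex E_def comp_def)
    qed
    also have "(\<Sum>k\<le>q. X k) + \<dots> = (\<Sum>e\<in>{1..i} \<times> {1..q} \<union> {Suc i} \<times> {1..q}. x e *\<^sub>R Poly_Mapping.single e 1)"
      unfolding X_sum by (rule sum.union_disjoint[symmetric]) auto
    also have "{1..i} \<times> {1..q} \<union> {Suc i} \<times> {1..q} = {1..Suc i} \<times> {1..q}"
      by auto
    finally show ?thesis .
  qed
  ultimately show ?case
    by blast
qed

section \<open>From solutions of the system to flows\<close>

lemma entry_scaleR: "entry (c *\<^sub>R x) e = c * entry x e" for x :: "pos \<Rightarrow>\<^sub>0 real"
proof -
  have "finite {e. c *\<^sub>R entry x e \<noteq> 0}"
    by (rule finite_subset[OF _ finite_keys[of x]]) (auto simp: in_keys_iff)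
  then show ?thesis
    by (simp add: scaleR_poly_mapping_def)
qed

lemma vectors_on_expansion:
  assumes "x \<in> vectors_on T" "T \<subseteq> T'" "finite T'"
  shows "(\<Sum>e\<in>T'. entry x e *\<^sub>R Poly_Mapping.single e 1) = x"
proof (rule poly_mapping_eqI)
  fix e
  show "entry (\<Sum>e\<in>T'. entry x e *\<^sub>R Poly_Mapping.single e 1) e = entry x e"
    using assms by (auto simp: entry_sum entry_scaleR lookup_single when_def vectors_on_def in_keys_iff
      if_distrib[of "times _"] cong: if_cong)
qed

text \<open>Prolongs the bar beyond the diagonal, where \<open>x\<close> vanishes; sums up to
  \<open>q\<close> suit both the telescoping and the right-to-left scan.\<close>

lemma sum_bar:
  assumes x: "x \<in> vectors_on (positions p q)" and "1 \<le> j"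
  shows "(\<Sum>e\<in>bar q (i, j). entry x e) = (\<Sum>l=j..q. entry x (i, l))"
proof -
  have "bar q (i, j) = Pair i ` {j..min i q}"
    by (auto simp: bar_def)
  then have "(\<Sum>e\<in>bar q (i, j). entry x e) = (\<Sum>l=j..min i q. entry x (i, l))"
    by (simp add: sum.reindex inj_on_def)
  also have "\<dots> = (\<Sum>l=j..q. entry x (i, l))"
    by (rule sum.mono_neutral_left) (auto simp: entry_outside[OF x])
  finally show ?thesis .
qed

lemma row_eq_bar: "row q i = bar q (i, 1)"
  by (simp add: row_def bar_def)

lemma solution_nonneg:
  assumes x: "x \<in> vectors_on (positions p q)" and "q \<le> p"
    and sat: "\<And>d. d \<in> orbitope_system p q \<Longrightarrow> satisfies x d"
    and diag: "\<And>j. 1 \<le> j \<Longrightarrow> Suc j \<le> q \<Longrightarrow> entry x (Suc j, Suc j) \<le> entry x (j, j)"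
  shows "0 \<le> entry x e"
proof -
  obtain i j where e: "e = (i, j)" by (cases e)
  have *: "0 \<le> entry x (i, j)" if "1 \<le> j" "j \<le> i" "i \<le> p" "j \<le> q" "j < i \<or> j = q" for i j
    using sat[OF nonneg_in_system[OF that]] by simp
  have "0 \<le> entry x (j, j)" if "j \<le> q" "1 \<le> j" for j
    using that
  proof (induction rule: inc_induct)
    case base
    then show ?case using * \<open>q \<le> p\<close> by simp
  next
    case (step j)
    then show ?case using diag[of j] by force
  qed
  with * show ?thesis
    unfolding e by (metis entry_outside[OF x] le_neq_implies_less order_refl)
qed

lemma packing_orbitope_solution_subset:
  assumes sol: "x \<in> solution_set p q (orbitope_system p q)" and "q \<le> p"
  shows "x \<in> packing_orbitope p q"
proof -
  have x: "x \<in> vectors_on (positions p q)" and sat: "\<And>d. d \<in> orbitope_system p q \<Longrightarrow> satisfies x d"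
    using sol by (auto simp: solution_set_def)
  let ?W = "min_shifted x"
  have bar_le: "(\<Sum>l=j..q. entry x (i, l)) \<le> ?W (i - 1) (j - 1)"
    if "2 \<le> j" "j \<le> i" "i \<le> p" "j \<le> q" for i j
  proof -
    have "(\<Sum>e\<in>bar q (i, j). entry x e) \<le> ?W (i - 1) (j - 1)"
      using shifted_columns_satisfied_iff[OF x] sat that by (meson DiffD1)
    then show ?thesis
      using that by (simp add: sum_bar[OF x])
  qed
  \<comment> \<open>The bar at \<open>(j + 1, j + 1)\<close> is a single position, and for \<eta> =
    1 its only shifted column consists of \<open>(j, j)\<close>.\<close>
  have diag_le: "entry x (Suc j, Suc j) \<le> entry x (j, j)" if "1 \<le> j" "Suc j \<le> q" for j
  proof -
    have "(\<Sum>l=Suc j..q. entry x (Suc j, l)) = entry x (Suc j, Suc j) + (\<Sum>l=Suc (Suc j)..q. entry x (Suc j, l))"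
      using that by (simp add: sum.atLeast_Suc_atMost)
    also have "(\<Sum>l=Suc (Suc j)..q. entry x (Suc j, l)) = 0"
      by (rule sum.neutral) (auto simp: entry_outside[OF x])
    finally show ?thesis
      using bar_le[of "Suc j" "Suc j"] that \<open>q \<le> p\<close> min_shifted_diagonal[OF x, of j] by simp
  qed
  have nonneg: "0 \<le> entry x e" for e
    using solution_nonneg[OF x \<open>q \<le> p\<close> sat diag_le] .
  have W_nonneg: "0 \<le> ?W i j" for i j
  proof (induction i arbitrary: j)
    case (Suc i)
    then show ?case
      using nonneg by (simp add: add_nonneg_nonneg)
  qed simp
  have W_beyond: "?W i j = 0" if "q < j" for i j
  proof (induction i)
    case (Suc i)
    then have "?W (Suc i) j \<le> 0"
      using min_shifted_le_above[of x i j] entry_outside[OF x, of j "Suc i"] that by simp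
    then show ?case
      using W_nonneg[of "Suc i" j] by (rule order_antisym)
  qed simp
  \<comment> \<open>Below the diagonal the recursion itself gives this bound; on the diagonal it is
    the constraint with \<eta> = 1, which the recursion leaves out.\<close>
  have W_shift: "?W (Suc i) (Suc j) \<le> ?W i j" if "1 \<le> j" for i j
  proof -
    consider "j < i" | "j = i" "Suc j \<le> q" | "q < Suc j" | "i < j"
      by linarith
    then show ?thesis
    proof cases
      case 1
      then show ?thesis
        using min_shifted_le_left[of "Suc j" i x] that by simp
    next
      case 2
      then show ?thesis
        using diag_le[OF that] by (simp only: min_shifted_diagonal[OF x])
    next
      case 3
      then show ?thesis
        using W_nonneg[of i j] by (simp only: W_beyond)
    next
      case 4
      then have "?W (Suc i) (Suc j) = 0"
        by (intro min_shifted_above[OF x]) simp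
      then show ?thesis
        using W_nonneg[of i j] by (simp only:)
    qed
  qed
  \<comment> \<open>If the minimum in the later row comes from the left, \<open>W_shift\<close> and
    monotonicity in column \<open>j - 1\<close> link the two rows; otherwise the increment is a
    nonnegative entry.\<close>
  have W_mono: "?W i j \<le> ?W (Suc i) j" for i j
  proof (induction i arbitrary: j)
    case 0
    show ?case
      using W_nonneg[of "Suc 0" j] by (simp only: min_shifted.simps(1))
  next
    case (Suc i)
    show ?case
    proof (cases "1 < j \<and> j < Suc (Suc i) \<and> ?W (Suc i) (j - 1) < ?W (Suc i) j + entry x (Suc (Suc i), j)")
      case True
      then have "1 < j"
        by blast
      then have "1 \<le> j - 1" "Suc (j - 1) = j"
        by simp_all
      then have "?W (Suc i) j \<le> ?W i (j - 1)"
        using W_shift[of "j - 1" i] by (simp only:)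
      also have "\<dots> \<le> ?W (Suc i) (j - 1)"
        by (rule Suc.IH)
      also have "\<dots> = ?W (Suc (Suc i)) j"
        by (rule trans[OF min_shifted.simps(2) if_P[OF True], symmetric])
      finally show ?thesis .
    next
      case False
      then have "?W (Suc (Suc i)) j = ?W (Suc i) j + entry x (Suc (Suc i), j)"
        by (subst min_shifted.simps) (simp only: if_False)
      then show ?thesis
        using nonneg[of "(Suc (Suc i), j)"] by linarith
    qed
  qed
  \<comment> \<open>If the minimum comes from the left, this is the bound of the system for the same
    bar. Otherwise the first entry is split off and the bound for the bar starting in column
    \<open>j + 1\<close> applies.\<close>
  have bar_le_W: "(\<Sum>l=j..q. entry x (Suc i, l)) \<le> ?W (Suc i) j" if "1 \<le> j" "j \<le> q" "i < p" for i j
  proof (cases "1 < j \<and> j < Suc i \<and> ?W i (j - 1) < ?W i j + entry x (Suc i, j)")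
    case True
    have "?W (Suc i) j = ?W i (j - 1)"
      by (rule trans[OF min_shifted.simps(2) if_P[OF True]])
    then show ?thesis
      using bar_le[of j "Suc i"] True that by (simp del: min_shifted.simps)
  next
    case False
    have "(\<Sum>l=Suc j..q. entry x (Suc i, l)) \<le> ?W i j"
    proof (cases "Suc j \<le> q \<and> j \<le> i")
      case True
      then show ?thesis
        using bar_le[of "Suc j" "Suc i"] that by simp
    next
      case False
      then have "(\<Sum>l=Suc j..q. entry x (Suc i, l)) = 0"
        by (intro sum.neutral) (auto simp: entry_outside[OF x])
      then show ?thesis
        using W_nonneg[of i j] by simp
    qed
    moreover have "?W (Suc i) j = ?W i j + entry x (Suc i, j)"
      using False by (simp only: min_shifted.simps if_False)
    ultimately show ?thesis
      using that by (simp add: sum.atLeast_Suc_atMost del: min_shifted.simps)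
  qed
  have bar_le_1: "(\<Sum>l=j..q. entry x (Suc i, l)) \<le> 1" if "1 \<le> j" "i < p" for i j
  proof -
    have "(\<Sum>l=j..q. entry x (Suc i, l)) \<le> (\<Sum>l=1..q. entry x (Suc i, l))"
      using that nonneg by (intro sum_mono2) auto
    also have "\<dots> \<le> 1"
      using sat[OF row_sum_in_system[of "Suc i" p q]] that
      by (simp add: row_eq_bar sum_bar[OF x])
    finally show ?thesis .
  qed
  \<comment> \<open>The cut-off at 1 turns \<open>min_shifted\<close> into probabilities, with
    column 0 regarded as always open. The row sums enter only here, through
    \<open>bar_le_1\<close>.\<close>
  define D where "D i j = (if j = 0 then 1 else min 1 (?W i j))" for i j
  note [simp del] = min_shifted.simps(2)
  have "\<exists>X. (\<forall>k\<le>q. mix (matrix_of ` patterns q p k) (D p k - D p (Suc k)) (X k)) \<and>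
     (\<Sum>k\<le>q. X k) = (\<Sum>e\<in>{1..p} \<times> {1..q}. entry x e *\<^sub>R Poly_Mapping.single e 1)"
  proof (rule flow_decomposition)
    show "D i 0 = 1" "D 0 (Suc j) = 0" for i j
      by (simp_all add: D_def)
    show "D i j = 0" if "q < j" for i j
      using that by (simp add: D_def W_beyond)
    show "D i j \<le> D (Suc i) j" for i j
      using W_mono[of i j] by (auto simp: D_def)
    show "D (Suc i) (Suc j) \<le> D i j" for i j
      using W_shift[of j i] by (auto simp: D_def)
    show "D (Suc i) j - D i j \<le> entry x (Suc i, j)" if "1 \<le> j" for i j
      using min_shifted_le_above[of x i j] nonneg[of "(Suc i, j)"] that by (auto simp: D_def min_def)
    show "(\<Sum>l=j..q. entry x (Suc i, l)) \<le> D (Suc i) j" if "1 \<le> j" "j \<le> q" "i < p" for i j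
      using bar_le_W[OF that] bar_le_1[OF that(1,3)] that(1) by (simp add: D_def)
  qed simp
  then obtain X where X: "\<And>k. k \<le> q \<Longrightarrow> mix (matrix_of ` patterns q p k) (D p k - D p (Suc k)) (X k)"
    and X_sum: "(\<Sum>k\<le>q. X k) = (\<Sum>e\<in>{1..p} \<times> {1..q}. entry x e *\<^sub>R Poly_Mapping.single e 1)"
    by blast
  have "mix (matrix_of ` {F. packing_pattern p q F}) (\<Sum>k\<le>q. D p k - D p (Suc k)) (\<Sum>k\<le>q. X k)"
    by (intro mix_sum mix_mono[OF X]) (auto simp: patterns_def)
  moreover have "(\<Sum>k\<le>q. D p k - D p (Suc k)) = 1"
    unfolding sum_telescope by (simp add: D_def W_beyond)
  moreover have "(\<Sum>k\<le>q. X k) = x"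
    unfolding X_sum by (rule vectors_on_expansion[OF x]) (auto simp: positions_def)
  ultimately show ?thesis
    using mix_in_hull by (fastforce simp: packing_orbitope_eq)
qed

section \<open>Convexity of the solution set\<close>

lemma satisfies_convex_combination:
  fixes x y :: "pos \<Rightarrow>\<^sub>0 real"
  assumes "satisfies x d" "satisfies y d" "0 \<le> u" "0 \<le> v" "u + v = 1"
  shows "satisfies (u *\<^sub>R x + v *\<^sub>R y) d"
proof -
  have *: "(\<Sum>e\<in>T. entry (u *\<^sub>R x + v *\<^sub>R y) e) = u * (\<Sum>e\<in>T. entry x e) + v * (\<Sum>e\<in>T. entry y e)" for T
    by (simp add: lookup_add entry_scaleR sum.distrib sum_distrib_left)
  show ?thesis
  proof (cases d)
    case (Row_Sum R)
    with assms show ?thesis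
      using convex_bound_le[of "\<Sum>e\<in>R. entry x e" 1 "\<Sum>e\<in>R. entry y e" u v] by (simp add: *)
  next
    case (Nonneg e)
    with assms show ?thesis
      by (simp add: lookup_add entry_scaleR)
  next
    case (Shifted_Column B S)
    with assms show ?thesis
      by (simp add: *) (intro add_mono mult_left_mono; simp)
  qed
qed

lemma vectors_on_combination:
  fixes x y :: "pos \<Rightarrow>\<^sub>0 real"
  assumes "x \<in> vectors_on T" "y \<in> vectors_on T"
  shows "u *\<^sub>R x + v *\<^sub>R y \<in> vectors_on T"
proof -
  have "e \<in> T" if "entry (u *\<^sub>R x + v *\<^sub>R y) e \<noteq> 0" for e
    using that assms by (cases "entry x e = 0"; cases "entry y e = 0")
      (auto simp: vectors_on_def in_keys_iff lookup_add entry_scaleR)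
  then show ?thesis
    by (auto simp: vectors_on_def in_keys_iff)
qed

lemma convex_solution_set: "convex (solution_set p q L)"
proof (rule convexI)
  fix x y :: "pos \<Rightarrow>\<^sub>0 real" and u v :: real
  assume *: "x \<in> solution_set p q L" "y \<in> solution_set p q L" "0 \<le> u" "0 \<le> v" "u + v = 1"
  then have "u *\<^sub>R x + v *\<^sub>R y \<in> vectors_on (positions p q)"
    by (intro vectors_on_combination) (simp_all add: solution_set_def)
  moreover have "satisfies (u *\<^sub>R x + v *\<^sub>R y) d" if "d \<in> L" for d
    using * that by (intro satisfies_convex_combination) (simp_all add: solution_set_def)
  ultimately show "u *\<^sub>R x + v *\<^sub>R y \<in> solution_set p q L"
    by (simp add: solution_set_def)
qed

theorem packing_orbitope_eq_solution_set:
  assumes "q \<le> p"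
  shows "packing_orbitope p q = solution_set p q (orbitope_system p q)"
proof
  have "matrix_of ` {F. packing_pattern p q F} \<subseteq> solution_set p q (orbitope_system p q)"
    using packing_pattern_solution by blast
  then show "packing_orbitope p q \<subseteq> solution_set p q (orbitope_system p q)"
    unfolding packing_orbitope_eq by (rule hull_minimal) (rule convex_solution_set)
qed (use packing_orbitope_solution_subset assms in blast)

section \<open>Non-redundancy\<close>

primrec slack :: "(pos \<Rightarrow>\<^sub>0 real) \<Rightarrow> lin_constraint \<Rightarrow> real" where
  "slack x (Row_Sum R) = 1 - (\<Sum>e\<in>R. entry x e)"
| "slack x (Nonneg e) = entry x e"
| "slack x (Shifted_Column B S) = (\<Sum>e\<in>S. entry x e) - (\<Sum>e\<in>B. entry x e)"

lemma satisfies_iff_slack: "satisfies x d \<longleftrightarrow> 0 \<le> slack x d"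
  by (cases d) auto

lemma slack_convex_combination:
  "slack ((1 - t) *\<^sub>R x + t *\<^sub>R y) d = (1 - t) * slack x d + t * slack y d"
proof -
  have *: "(\<Sum>e\<in>T. entry ((1 - t) *\<^sub>R x + t *\<^sub>R y) e) =
      (1 - t) * (\<Sum>e\<in>T. entry x e) + t * (\<Sum>e\<in>T. entry y e)" for T
    by (simp add: lookup_add entry_scaleR sum.distrib sum_distrib_left)
  show ?thesis
  proof (cases d)
    case (Nonneg e)
    then show ?thesis by (simp add: lookup_add entry_scaleR)
  qed (simp_all only: slack.simps *, simp_all add: algebra_simps)
qed

text \<open>\<open>tight\<close> starts the averaging, \<open>separated\<close> adds one constraint
  at a time, and the direction towards a point from \<open>violated\<close> leaves the facet. The
  finitely many other slacks stay positive for small steps by continuity.\<close>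

lemma non_redundant_criterion:
  assumes fin: "finite L"
    and violated: "\<And>d. d \<in> L \<Longrightarrow> \<exists>z \<in> vectors_on (positions p q). slack z d < 0"
    and tight: "\<And>d. d \<in> L \<Longrightarrow> \<exists>y \<in> solution_set p q L. slack y d = 0"
    and separated: "\<And>d d'. d \<in> L \<Longrightarrow> d' \<in> L \<Longrightarrow> d \<noteq> d' \<Longrightarrow>
      \<exists>y \<in> solution_set p q L. slack y d = 0 \<and> 0 < slack y d'"
  shows "non_redundant p q L"
  unfolding non_redundant_def
proof
  fix d assume d: "d \<in> L"
  have slack_nonneg: "0 \<le> slack y d'" if "y \<in> solution_set p q L" "d' \<in> L" for y d'
    using that by (simp add: solution_set_def satisfies_iff_slack)
  have "\<exists>y \<in> solution_set p q L. slack y d = 0 \<and> (\<forall>d'\<in>K. 0 < slack y d')"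
    if "finite K" "K \<subseteq> L - {d}" for K
    using that
  proof (induction K rule: finite_induct)
    case empty
    then show ?case using tight[OF d] by blast
  next
    case (insert d' K)
    then obtain y where y: "y \<in> solution_set p q L" "slack y d = 0" "\<forall>d'\<in>K. 0 < slack y d'"
      by blast
    obtain z where z: "z \<in> solution_set p q L" "slack z d = 0" "0 < slack z d'"
      using separated[OF d, of d'] insert.prems by auto
    \<comment> \<open>A midpoint is strict wherever one of its ends is, because the slacks of
      solutions are nonnegative.\<close>
    let ?w = "(1 - 1/2) *\<^sub>R y + (1/2) *\<^sub>R z"
    have "?w \<in> solution_set p q L"
      using y(1) z(1) by (intro convexD[OF convex_solution_set]) auto
    moreover have "slack ?w d = 0"
      unfolding slack_convex_combination by (simp add: y z)
    moreover have "0 < slack ?w d''" if "d'' \<in> insert d' K" for d''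
    proof -
      have "d'' \<in> L"
        using that insert.prems by blast
      then have "0 \<le> slack y d''" "0 \<le> slack z d''"
        using slack_nonneg y(1) z(1) by blast+
      moreover have "0 < slack y d'' \<or> 0 < slack z d''"
        using that y(3) z(3) by blast
      ultimately show ?thesis
        unfolding slack_convex_combination by auto
    qed
    ultimately show ?case by blast
  qed
  from this[of "L - {d}"] obtain y where y: "y \<in> solution_set p q L" "slack y d = 0"
    and y_pos: "\<forall>d'\<in>L - {d}. 0 < slack y d'"
    using fin by blast
  obtain z where z: "z \<in> vectors_on (positions p q)" "slack z d < 0"
    using violated[OF d] by blast
  have "eventually (\<lambda>t. \<forall>d'\<in>L - {d}. 0 < slack ((1 - t) *\<^sub>R y + t *\<^sub>R z) d') (at_right 0)"
    using fin
  proof (intro eventually_ball_finite ballI)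
    fix d' assume "d' \<in> L - {d}"
    then have pos: "0 < slack y d'" using y_pos by blast
    have "((\<lambda>t. (1 - t) * slack y d' + t * slack z d') \<longlongrightarrow> (1 - 0) * slack y d' + 0 * slack z d') (at_right 0)"
      by (intro tendsto_intros)
    then show "eventually (\<lambda>t. 0 < slack ((1 - t) *\<^sub>R y + t *\<^sub>R z) d') (at_right 0)"
      unfolding slack_convex_combination using pos by (intro order_tendstoD(1)) auto
  qed simp
  moreover have "eventually (\<lambda>t :: real. 0 < t) (at_right 0)"
    by (rule eventually_at_right_less)
  ultimately have "eventually (\<lambda>t. 0 < t \<and> (\<forall>d'\<in>L - {d}. 0 < slack ((1 - t) *\<^sub>R y + t *\<^sub>R z) d')) (at_right 0)"
    by eventually_elim simp
  then obtain t where t: "0 < t" "\<forall>d'\<in>L - {d}. 0 < slack ((1 - t) *\<^sub>R y + t *\<^sub>R z) d'"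
    using eventually_happens'[OF trivial_limit_at_right_real] by blast
  define w where "w = (1 - t) *\<^sub>R y + t *\<^sub>R z"
  have "w \<in> vectors_on (positions p q)"
    unfolding w_def using y(1) z(1) by (intro vectors_on_combination) (simp_all add: solution_set_def)
  then have "w \<in> solution_set p q (L - {d})"
    using t(2) by (auto simp: solution_set_def satisfies_iff_slack w_def intro: less_imp_le)
  moreover have "slack w d < 0"
    unfolding w_def slack_convex_combination using y(2) z(2) t(1) by (simp add: mult_pos_neg)
  then have "w \<notin> solution_set p q L"
    using slack_nonneg[of w d] d by force
  moreover have "solution_set p q L \<subseteq> solution_set p q (L - {d})"
    by (auto simp: solution_set_def)
  ultimately show "solution_set p q L \<subset> solution_set p q (L - {d})"
    by blast
qed

text \<open>Skeleton of the separating patterns, with one one per opened column; at most two more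
  ones are added by \<open>fill\<close>.\<close>

definition opening_path :: "(nat \<Rightarrow> nat) \<Rightarrow> nat \<Rightarrow> pos set" where
  "opening_path f M = (\<lambda>m. (f m, m)) ` {1..M}"

lemma mem_opening_path: "(a, m) \<in> opening_path f M \<longleftrightarrow> 1 \<le> m \<and> m \<le> M \<and> a = f m"
  by (auto simp: opening_path_def)

lemma packing_pattern_opening_path:
  assumes mono: "\<And>m m'. 1 \<le> m \<Longrightarrow> m < m' \<Longrightarrow> m' \<le> M \<Longrightarrow> f m < f m'"
    and bounds: "\<And>m. 1 \<le> m \<Longrightarrow> m \<le> M \<Longrightarrow> 1 \<le> f m \<and> f m \<le> p" and "M \<le> q"
  shows "packing_pattern p q (opening_path f M)"
proof (rule packing_patternI)
  show "1 \<le> i \<and> i \<le> p \<and> 1 \<le> j \<and> j \<le> q" if "(i, j) \<in> opening_path f M" for i j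
    using that bounds[of j] \<open>M \<le> q\<close> by (auto simp: mem_opening_path)
  show "j = j'" if "(i, j) \<in> opening_path f M" "(i, j') \<in> opening_path f M" for i j j'
    using that mono[of j j'] mono[of j' j] by (cases j j' rule: linorder_cases) (auto simp: mem_opening_path)
  show "\<exists>i'<i. (i', j - 1) \<in> opening_path f M" if "(i, j) \<in> opening_path f M" "2 \<le> j" for i j
    using that mono[of "j - 1" j] by (intro exI[of _ "f (j - 1)"]) (auto simp: mem_opening_path)
qed

text \<open>Guarantees a one in row \<open>i\<close> whether or not the path already has one there,
  without ever creating two.\<close>

definition fill :: "nat \<Rightarrow> nat \<Rightarrow> pos set \<Rightarrow> pos set" where
  "fill i j F = (if \<exists>l. (i, l) \<in> F then F else insert (i, j) F)"

lemma mem_fill: "(a, m) \<in> fill i j F \<longleftrightarrow> (a, m) \<in> F \<or> (a = i \<and> m = j \<and> (\<forall>l. (i, l) \<notin> F))"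
  by (auto simp: fill_def)

lemma packing_pattern_fill:
  assumes F: "packing_pattern p q F" and "1 \<le> i" "i \<le> p" "1 \<le> j" "j \<le> q"
    and earlier: "2 \<le> j \<Longrightarrow> \<exists>i'<i. (i', j - 1) \<in> F"
  shows "packing_pattern p q (fill i j F)"
proof (cases "\<exists>l. (i, l) \<in> F")
  case True
  then show ?thesis using F by (simp add: fill_def)
next
  case False
  show ?thesis
  proof (rule packing_patternI)
    show "1 \<le> a \<and> a \<le> p \<and> 1 \<le> m \<and> m \<le> q" if "(a, m) \<in> fill i j F" for a m
      using that assms(2-5) packing_pattern_le[OF F, of a m] by (auto simp: mem_fill)
    show "m = m'" if "(a, m) \<in> fill i j F" "(a, m') \<in> fill i j F" for a m m'
      using that packing_pattern_unique[OF F, of a m m'] by (auto simp: mem_fill)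
    show "\<exists>a'<a. (a', m - 1) \<in> fill i j F" if "(a, m) \<in> fill i j F" "2 \<le> m" for a m
    proof -
      have "\<exists>a'<a. (a', m - 1) \<in> F"
        using that earlier F by (auto simp: mem_fill packing_pattern_def)
      then show ?thesis
        by (auto simp: mem_fill)
    qed
  qed
qed

section \<open>Slack of generators\<close>

lemma slack_row_sum_zero:
  assumes F: "packing_pattern p q F" and "(i, j) \<in> F"
  shows "slack (matrix_of F) (Row_Sum (row q i)) = 0"
proof -
  have "(i, j) \<in> row q i \<inter> F"
    using packing_pattern_le[OF assms] assms(2) by (auto simp: row_def)
  then have "1 \<le> card (row q i \<inter> F)"
    by (simp add: Suc_le_eq card_gt_0_iff) blast
  moreover have "card (row q i \<inter> F) \<le> 1"
    by (rule packing_pattern_row_card[OF F, of _ i]) (auto simp: row_def)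
  ultimately show ?thesis
    by (simp add: sum_matrix_of packing_pattern_finite[OF F])
qed

lemma slack_row_sum_one:
  assumes F: "packing_pattern p q F" and "\<And>j. (i, j) \<notin> F"
  shows "slack (matrix_of F) (Row_Sum (row q i)) = 1"
proof -
  have "row q i \<inter> F = {}"
    using assms(2) by (auto simp: row_def)
  then show ?thesis
    by (simp add: sum_matrix_of packing_pattern_finite[OF F])
qed

lemma slack_nonneg_pattern:
  assumes "packing_pattern p q F"
  shows "slack (matrix_of F) (Nonneg e) = (if e \<in> F then 1 else 0)"
  by (simp add: entry_matrix_of packing_pattern_finite[OF assms])

lemma slack_shifted_pattern:
  assumes "packing_pattern p q F"
  shows "slack (matrix_of F) (Shifted_Column (bar q (diagonal \<eta> j)) (shifted_column \<eta> c)) =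
    real (card (shifted_column \<eta> c \<inter> F)) - real (card (bar q (diagonal \<eta> j) \<inter> F))"
  by (simp add: sum_matrix_of packing_pattern_finite[OF assms])

lemma mem_shifted_column:
  assumes "1 \<le> m" "m \<le> a"
  shows "(a, m) \<in> shifted_column \<eta> c \<longleftrightarrow> a + 1 - m \<le> \<eta> \<and> c (a + 1 - m) = m"
  using shifted_column_iff[of "a + 1 - m" m \<eta> c] assms by simp

lemma mem_bar_pattern:
  assumes "packing_pattern p q F" "(a, l) \<in> F"
  shows "(a, l) \<in> bar q (diagonal \<eta> j) \<longleftrightarrow> a = j + \<eta> - 1 \<and> j \<le> l"
  using packing_pattern_le[OF assms] by (auto simp: diagonal_def bar_iff)

lemma card_bar_le_1:
  assumes "packing_pattern p q F"
  shows "card (bar q e \<inter> F) \<le> 1"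
  by (rule packing_pattern_row_card[OF assms, of _ "fst e"]) (auto simp: bar_def)

lemma slack_shifted_hit:
  assumes F: "packing_pattern p q F" and "(j + \<eta> - 1, l) \<in> F" "j \<le> l"
    and "e \<in> F" "e \<in> shifted_column \<eta> c" and "\<And>e'. e' \<in> F \<Longrightarrow> e' \<in> shifted_column \<eta> c \<Longrightarrow> e' = e"
  shows "slack (matrix_of F) (Shifted_Column (bar q (diagonal \<eta> j)) (shifted_column \<eta> c)) = 0"
proof -
  have "shifted_column \<eta> c \<inter> F = {e}"
    using assms(4-6) by blast
  moreover have "(j + \<eta> - 1, l) \<in> bar q (diagonal \<eta> j) \<inter> F"
    using assms(2,3) mem_bar_pattern[OF F] by blast
  then have "1 \<le> card (bar q (diagonal \<eta> j) \<inter> F)"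
    by (simp add: Suc_le_eq card_gt_0_iff) blast
  ultimately show ?thesis
    using card_bar_le_1[OF F, of "diagonal \<eta> j"] unfolding slack_shifted_pattern[OF F] by simp
qed

lemma slack_shifted_miss:
  assumes F: "packing_pattern p q F" and "\<And>l. (j + \<eta> - 1, l) \<in> F \<Longrightarrow> l < j"
    and "\<And>e. e \<in> F \<Longrightarrow> e \<notin> shifted_column \<eta> c"
  shows "slack (matrix_of F) (Shifted_Column (bar q (diagonal \<eta> j)) (shifted_column \<eta> c)) = 0"
proof -
  have "shifted_column \<eta> c \<inter> F = {}"
    using assms(3) by blast
  moreover have "bar q (diagonal \<eta> j) \<inter> F = {}"
    using assms(2) mem_bar_pattern[OF F] by (force simp: not_le[symmetric])
  ultimately show ?thesis
    unfolding slack_shifted_pattern[OF F] by simp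
qed

lemma slack_shifted_pos:
  assumes F: "packing_pattern p q F" and "\<And>l. (j + \<eta> - 1, l) \<in> F \<Longrightarrow> l < j"
    and "e \<in> F" "e \<in> shifted_column \<eta> c"
  shows "0 < slack (matrix_of F) (Shifted_Column (bar q (diagonal \<eta> j)) (shifted_column \<eta> c))"
proof -
  have "0 < card (shifted_column \<eta> c \<inter> F)"
    using assms(3,4) by (simp add: card_gt_0_iff) blast
  moreover have "bar q (diagonal \<eta> j) \<inter> F = {}"
    using assms(2) mem_bar_pattern[OF F] by (force simp: not_le[symmetric])
  ultimately show ?thesis
    unfolding slack_shifted_pattern[OF F] by simp
qed

text \<open>The bar contributes at most 1, so two hits of the shifted column suffice even if the bar
  is met.\<close>

lemma slack_shifted_pos2:
  assumes F: "packing_pattern p q F" and "e \<in> F" "e \<in> shifted_column \<eta> c"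
    and "e' \<in> F" "e' \<in> shifted_column \<eta> c" "e \<noteq> e'"
  shows "0 < slack (matrix_of F) (Shifted_Column (bar q (diagonal \<eta> j)) (shifted_column \<eta> c))"
proof -
  have "card {e, e'} \<le> card (shifted_column \<eta> c \<inter> F)"
    using assms(2-5) by (intro card_mono) auto
  then show ?thesis
    using card_bar_le_1[OF F, of "diagonal \<eta> j"] assms(6) unfolding slack_shifted_pattern[OF F] by simp
qed

section \<open>A separating generator for every ordered pair of constraints\<close>

definition separates :: "nat \<Rightarrow> nat \<Rightarrow> lin_constraint \<Rightarrow> lin_constraint \<Rightarrow> bool" where
  "separates p q d d' \<longleftrightarrow>
     (\<exists>F. packing_pattern p q F \<and> slack (matrix_of F) d = 0 \<and> 0 < slack (matrix_of F) d')"

lemma separatesI: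
  "packing_pattern p q F \<Longrightarrow> slack (matrix_of F) d = 0 \<Longrightarrow> 0 < slack (matrix_of F) d' \<Longrightarrow> separates p q d d'"
  by (auto simp: separates_def)

text \<open>For \<open>d'\<close> of the other two kinds, \<open>fill i 1\<close> makes row
  \<open>i\<close> tight at no cost: a one in column 1 may be added to any empty row, and it lies in
  no bar that starts in column 2 or later.\<close>

lemma separates_row:
  assumes "2 \<le> q" "q \<le> p" and i: "1 \<le> i" "i \<le> p" and d': "d' \<in> orbitope_system p q" "d' \<noteq> Row_Sum (row q i)"
  shows "separates p q (Row_Sum (row q i)) d'"
  using d'(1)
proof (cases rule: orbitope_system_cases)
  case (row i')
  have F: "packing_pattern p q (opening_path (\<lambda>_. i) 1)"
    using assms by (intro packing_pattern_opening_path) auto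
  show ?thesis
  proof (rule separatesI[OF F])
    show "slack (matrix_of (opening_path (\<lambda>_. i) 1)) (Row_Sum (row q i)) = 0"
      by (rule slack_row_sum_zero[OF F, of _ 1]) (simp add: mem_opening_path)
    have "i' \<noteq> i"
      using d'(2) row(1) by auto
    then show "0 < slack (matrix_of (opening_path (\<lambda>_. i) 1)) d'"
      unfolding row(1) by (subst slack_row_sum_one[OF F]) (auto simp: mem_opening_path)
  qed
next
  case (nonneg i' j)
  let ?P = "opening_path (\<lambda>m. if m < j then m else i') j"
  let ?F = "fill i 1 ?P"
  have P: "packing_pattern p q ?P"
    using nonneg assms by (intro packing_pattern_opening_path) auto
  have F: "packing_pattern p q ?F"
    using i assms by (intro packing_pattern_fill[OF P]) auto
  show ?thesis
  proof (rule separatesI[OF F])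
    obtain l where "(i, l) \<in> ?F"
      by (metis mem_fill)
    then show "slack (matrix_of ?F) (Row_Sum (row q i)) = 0"
      by (rule slack_row_sum_zero[OF F])
    show "0 < slack (matrix_of ?F) d'"
      unfolding nonneg(1) slack_nonneg_pattern[OF F] using nonneg by (simp add: mem_fill mem_opening_path)
  qed
next
  case (shifted \<eta> j c)
  let ?P = "opening_path id (c 1)"
  let ?F = "fill i 1 ?P"
  have c: "1 \<le> c 1" "c 1 \<le> j - 1"
    using admissible_bounds[OF shifted(6), of 1] shifted(2) by auto
  have P: "packing_pattern p q ?P"
    using c shifted assms by (intro packing_pattern_opening_path) auto
  have F: "packing_pattern p q ?F"
    using i assms by (intro packing_pattern_fill[OF P]) auto
  show ?thesis
  proof (rule separatesI[OF F])
    obtain l where "(i, l) \<in> ?F"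
      by (metis mem_fill)
    then show "slack (matrix_of ?F) (Row_Sum (row q i)) = 0"
      by (rule slack_row_sum_zero[OF F])
    show "0 < slack (matrix_of ?F) d'"
      unfolding shifted(1)
    proof (rule slack_shifted_pos[OF F])
      show "(c 1, c 1) \<in> ?F"
        using c by (simp add: mem_fill mem_opening_path)
      show "(c 1, c 1) \<in> shifted_column \<eta> c"
        using c shifted(2) by (simp add: mem_shifted_column)
      show "l < j" if "(j + \<eta> - 1, l) \<in> ?F" for l
        using that c shifted(3) by (auto simp: mem_fill mem_opening_path)
    qed
  qed
qed

text \<open>The paths run down the main diagonal in columns before \<open>q\<close>, where the
  system has no nonnegativity constraints; in the second case a last one is placed at
  \<open>(i', j')\<close> itself. Hence \<open>(i, j)\<close> is never hit.\<close>

lemma separates_nonneg: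
  assumes "2 \<le> q" "q \<le> p" and ij: "1 \<le> j" "j \<le> i" "i \<le> p" "j \<le> q" "j < i \<or> j = q"
    and d': "d' \<in> orbitope_system p q" "d' \<noteq> Nonneg (i, j)"
  shows "separates p q (Nonneg (i, j)) d'"
  using d'(1)
proof (cases rule: orbitope_system_cases)
  case (row i')
  have F: "packing_pattern p q (opening_path id 0)"
    by (intro packing_pattern_opening_path) auto
  show ?thesis
    unfolding row(1)
  proof (rule separatesI[OF F])
    show "slack (matrix_of (opening_path id 0)) (Nonneg (i, j)) = 0"
      unfolding slack_nonneg_pattern[OF F] by (auto simp: mem_opening_path)
    show "0 < slack (matrix_of (opening_path id 0)) (Row_Sum (row q i'))"
      by (subst slack_row_sum_one[OF F]) (auto simp: mem_opening_path)
  qed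
next
  case (nonneg i' j')
  let ?P = "opening_path (\<lambda>m. if m < j' then m else i') j'"
  have P: "packing_pattern p q ?P"
    using nonneg assms by (intro packing_pattern_opening_path) auto
  show ?thesis
    unfolding nonneg(1)
  proof (rule separatesI[OF P])
    show "slack (matrix_of ?P) (Nonneg (i, j)) = 0"
      unfolding slack_nonneg_pattern[OF P] using ij nonneg d'(2) by (auto simp: mem_opening_path)
    show "0 < slack (matrix_of ?P) (Nonneg (i', j'))"
      unfolding slack_nonneg_pattern[OF P] using nonneg by (simp add: mem_opening_path)
  qed
next
  case (shifted \<eta> j' c)
  let ?P = "opening_path id (c 1)"
  have c: "1 \<le> c 1" "c 1 \<le> j' - 1"
    using admissible_bounds[OF shifted(6), of 1] shifted(2) by auto
  have P: "packing_pattern p q ?P"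
    using c shifted assms by (intro packing_pattern_opening_path) auto
  show ?thesis
  proof (rule separatesI[OF P])
    show "slack (matrix_of ?P) (Nonneg (i, j)) = 0"
      unfolding slack_nonneg_pattern[OF P] using ij c shifted(3,4) by (auto simp: mem_opening_path)
    show "0 < slack (matrix_of ?P) d'"
      unfolding shifted(1)
    proof (rule slack_shifted_pos[OF P])
      show "(c 1, c 1) \<in> ?P"
        using c by (simp add: mem_opening_path)
      show "(c 1, c 1) \<in> shifted_column \<eta> c"
        using c shifted(2) by (simp add: mem_shifted_column)
      show "l < j'" if "(j' + \<eta> - 1, l) \<in> ?P" for l
        using that c shifted(3) by (auto simp: mem_opening_path)
    qed
  qed
qed

text \<open>In the tight patterns below, the first ones of the columns run along one diagonal and then
  along the next one, so that they meet the shifted column exactly once.\<close>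

lemma separates_shifted_nonneg:
  assumes qp: "2 \<le> q" "q \<le> p"
    and bar: "1 \<le> \<eta>" "2 \<le> j" "j \<le> q" "j + \<eta> - 1 \<le> p" and c: "admissible \<eta> c (j - 1)"
    and ij': "1 \<le> j'" "j' \<le> i'" "i' \<le> p" "j' \<le> q" "j' < i' \<or> j' = q"
  shows "separates p q (Shifted_Column (bar q (diagonal \<eta> j)) (shifted_column \<eta> c)) (Nonneg (i', j'))"
proof -
  define h where "h = i' + 1 - j'"
  have h: "1 \<le> h" "i' = j' + h - 1"
    using ij' by (auto simp: h_def)
  have c_bounds: "1 \<le> c k \<and> c k < j" if "1 \<le> k" "k \<le> \<eta>" for k
    using admissible_bounds[OF c that] bar by auto
  have mem_S: "(m + h - 1, m) \<in> shifted_column \<eta> c \<longleftrightarrow> h \<le> \<eta> \<and> c h = m" if "1 \<le> m" for m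
    using shifted_column_iff[OF h(1) that] .
  show ?thesis
  proof (cases "h \<le> \<eta>")
    case True
    \<comment> \<open>The path follows the diagonal \<open>h\<close> of \<open>(i', j')\<close>,
      which meets the shifted column only in column \<open>c h\<close>, and it reaches at least
      column \<open>j\<close>. If it has no one in the row of the bar, one is added at the left end
      of the bar.\<close>
    let ?P = "opening_path (\<lambda>m. m + h - 1) (max j j')"
    let ?F = "fill (j + \<eta> - 1) j ?P"
    have P: "packing_pattern p q ?P"
      using bar ij' h True by (intro packing_pattern_opening_path) auto
    have F: "packing_pattern p q ?F"
    proof (rule packing_pattern_fill[OF P])
      show "\<exists>i'<j + \<eta> - 1. (i', j - 1) \<in> ?P"
        using bar h True by (intro exI[of _ "j - 1 + h - 1"]) (auto simp: mem_opening_path)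
    qed (use bar in auto)
    show ?thesis
    proof (rule separatesI[OF F])
      have "\<exists>l\<ge>j. (j + \<eta> - 1, l) \<in> ?F"
      proof (cases "\<exists>l. (j + \<eta> - 1, l) \<in> ?P")
        case True
        then obtain l where "(j + \<eta> - 1, l) \<in> ?P" by blast
        moreover from this \<open>h \<le> \<eta>\<close> h bar have "j \<le> l"
          by (auto simp: mem_opening_path)
        ultimately show ?thesis by (auto simp: mem_fill)
      next
        case False
        then show ?thesis by (auto simp: mem_fill)
      qed
      then obtain l where l: "(j + \<eta> - 1, l) \<in> ?F" "j \<le> l" by blast
      show "slack (matrix_of ?F) (Shifted_Column (bar q (diagonal \<eta> j)) (shifted_column \<eta> c)) = 0"
      proof (rule slack_shifted_hit[OF F l])
        show "(c h + h - 1, c h) \<in> ?F"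
          using c_bounds[OF h(1) True] by (auto simp: mem_fill mem_opening_path)
        show "(c h + h - 1, c h) \<in> shifted_column \<eta> c"
          using mem_S[of "c h"] c_bounds[OF h(1) True] True by simp
        fix e assume e: "e \<in> ?F" "e \<in> shifted_column \<eta> c"
        obtain a m where am: "e = (a, m)" by (cases e)
        show "e = (c h + h - 1, c h)"
        proof (cases "(a, m) \<in> ?P")
          case True
          then show ?thesis
            using e(2) mem_S[of m] by (auto simp: am mem_opening_path)
        next
          case False
          then have "a = j + \<eta> - 1" "m = j"
            using e(1) by (auto simp: am mem_fill)
          then have "c \<eta> = j"
            using e(2) shifted_column_iff[of \<eta> j \<eta> c] bar by (simp add: am)
          then show ?thesis
            using c_bounds[of \<eta>] bar(1) by simp
        qed
      qed
      show "0 < slack (matrix_of ?F) (Nonneg (i', j'))"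
        unfolding slack_nonneg_pattern[OF F] using ij' h by (simp add: mem_fill mem_opening_path)
    qed
  next
    case False
    \<comment> \<open>The shifted column does not extend to diagonal \<open>h\<close>, and this
      diagonal crosses the row of the bar in a column before \<open>j\<close>: both are
      missed.\<close>
    let ?P = "opening_path (\<lambda>m. m + h - 1) j'"
    have P: "packing_pattern p q ?P"
      using ij' h by (intro packing_pattern_opening_path) auto
    show ?thesis
    proof (rule separatesI[OF P])
      show "slack (matrix_of ?P) (Shifted_Column (bar q (diagonal \<eta> j)) (shifted_column \<eta> c)) = 0"
      proof (rule slack_shifted_miss[OF P])
        show "l < j" if "(j + \<eta> - 1, l) \<in> ?P" for l
          using that False h bar by (auto simp: mem_opening_path)
        show "e \<notin> shifted_column \<eta> c" if "e \<in> ?P" for e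
          using that mem_S[of "snd e"] False by (auto simp: opening_path_def)
      qed
      show "0 < slack (matrix_of ?P) (Nonneg (i', j'))"
        unfolding slack_nonneg_pattern[OF P] using ij' h by (simp add: mem_opening_path)
    qed
  qed
qed

text \<open>The two shifted columns are compared diagonal by diagonal. If some diagonal meets the
  primed one strictly earlier, or meets only that one, the path down this diagonal separates.
  Otherwise \<open>\<eta>' \<le> \<eta>\<close> and \<open>c k \<le> c' k\<close> for all
  \<open>k \<le> \<eta>'\<close>; then \<open>?d\<close> is made tight by one hit of its bar and one
  of its shifted column, while the primed bar is missed or the primed shifted column is hit
  twice.\<close>

lemma separates_shifted_shifted:
  assumes qp: "2 \<le> q" "q \<le> p"
    and bar: "1 \<le> \<eta>" "2 \<le> j" "j \<le> q" "j + \<eta> - 1 \<le> p" and c: "admissible \<eta> c (j - 1)"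
    and bar': "1 \<le> \<eta>'" "2 \<le> j'" "j' \<le> q" "j' + \<eta>' - 1 \<le> p" and c': "admissible \<eta>' c' (j' - 1)"
    and neq: "Shifted_Column (bar q (diagonal \<eta>' j')) (shifted_column \<eta>' c') \<noteq>
      Shifted_Column (bar q (diagonal \<eta> j)) (shifted_column \<eta> c)"
  shows "separates p q (Shifted_Column (bar q (diagonal \<eta> j)) (shifted_column \<eta> c))
    (Shifted_Column (bar q (diagonal \<eta>' j')) (shifted_column \<eta>' c'))"
    (is "separates p q ?d ?d'")
proof -
  define i where "i = j + \<eta> - 1"
  define i' where "i' = j' + \<eta>' - 1"
  note ii' = i_def i'_def
  have c_bounds: "1 \<le> c k \<and> c k < j" if "1 \<le> k" "k \<le> \<eta>" for k
    using admissible_bounds[OF c that] bar by auto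
  have c'_bounds: "1 \<le> c' k \<and> c' k < j'" if "1 \<le> k" "k \<le> \<eta>'" for k
    using admissible_bounds[OF c' that] bar' by auto
  have c2: "c 2 = c 1" if "2 \<le> \<eta>"
    using c that by (simp add: admissible_def)
  have c'2: "c' 2 = c' 1" if "2 \<le> \<eta>'"
    using c' that by (simp add: admissible_def)
  have mem_S: "(a, m) \<in> shifted_column \<eta> c \<longleftrightarrow> a + 1 - m \<le> \<eta> \<and> c (a + 1 - m) = m"
    if "1 \<le> m" "m \<le> a" for a m
    by (rule mem_shifted_column[OF that])
  have mem_S': "(a, m) \<in> shifted_column \<eta>' c' \<longleftrightarrow> a + 1 - m \<le> \<eta>' \<and> c' (a + 1 - m) = m"
    if "1 \<le> m" "m \<le> a" for a m
    by (rule mem_shifted_column[OF that])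
  have ij_notin: "(i, j) \<notin> shifted_column \<eta> c"
    using mem_S[of j i] c_bounds[of \<eta>] bar by (auto simp: ii')
  have on_S: "(c k + k - 1, c k) \<in> shifted_column \<eta> c" if "1 \<le> k" "k \<le> \<eta>" for k
    using mem_S[of "c k" "c k + k - 1"] c_bounds[OF that] that by simp
  have on_S': "(c' k + k - 1, c' k) \<in> shifted_column \<eta>' c'" if "1 \<le> k" "k \<le> \<eta>'" for k
    using mem_S'[of "c' k" "c' k + k - 1"] c'_bounds[OF that] that by simp
  have hit: "slack (matrix_of F) ?d = 0"
    if "packing_pattern p q F" "(i, l) \<in> F" "j \<le> l" "e \<in> F" "e \<in> shifted_column \<eta> c"
      "\<And>a m. (a, m) \<in> F \<Longrightarrow> (a, m) \<in> shifted_column \<eta> c \<Longrightarrow> (a, m) = e" for F l e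
    by (rule slack_shifted_hit[OF that(1) that(2)[unfolded ii'] that(3-5)]) (use that(6) in auto)
  show ?thesis
  proof (cases "\<exists>h. 1 \<le> h \<and> h \<le> \<eta>' \<and> (\<eta> < h \<or> c' h < c h)")
    case True
    then obtain h where h: "1 \<le> h" "h \<le> \<eta>'" "\<eta> < h \<or> c' h < c h" by blast
    \<comment> \<open>The path ends on the primed shifted column, before diagonal \<open>h\<close>
      can reach the other one, and meets neither bar.\<close>
    let ?P = "opening_path (\<lambda>m. m + h - 1) (c' h)"
    have P: "packing_pattern p q ?P"
      using c'_bounds[OF h(1,2)] h bar' by (intro packing_pattern_opening_path) auto
    show ?thesis
    proof (rule separatesI[OF P])
      show "slack (matrix_of ?P) ?d = 0"
      proof (rule slack_shifted_miss[OF P])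
        show "l < j" if "(j + \<eta> - 1, l) \<in> ?P" for l
        proof (cases "h \<le> \<eta>")
          case True
          then show ?thesis
            using that h c_bounds[of h] by (auto simp: mem_opening_path)
        next
          case False
          then show ?thesis
            using that h bar by (auto simp: mem_opening_path)
        qed
        show "e \<notin> shifted_column \<eta> c" if e: "e \<in> ?P" for e
        proof -
          obtain m where m: "e = (m + h - 1, m)" "1 \<le> m" "m \<le> c' h"
            using e by (auto simp: opening_path_def)
          then show ?thesis
            using mem_S[of m "m + h - 1"] h by auto
        qed
      qed
      show "0 < slack (matrix_of ?P) ?d'"
      proof (rule slack_shifted_pos[OF P])
        show "(c' h + h - 1, c' h) \<in> ?P"
          using c'_bounds[OF h(1,2)] by (auto simp: mem_opening_path)
        show "(c' h + h - 1, c' h) \<in> shifted_column \<eta>' c'"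
          by (rule on_S'[OF h(1,2)])
        show "l < j'" if "(j' + \<eta>' - 1, l) \<in> ?P" for l
          using that c'_bounds[OF h(1,2)] by (auto simp: mem_opening_path)
      qed
    qed
  next
    case False
    then have le: "\<eta>' \<le> \<eta>" and ge: "c k \<le> c' k" if "1 \<le> k" "k \<le> \<eta>'" for k
      using that bar' by (auto simp: not_less)
    then have le: "\<eta>' \<le> \<eta>"
      using bar' by blast
    have c1: "1 \<le> c 1" "c 1 < j" "c 1 \<le> c' 1" "c' 1 < j'"
      using c_bounds[of 1] c'_bounds[of 1] ge[of 1] bar bar' by auto
    consider "j < j'" | "j' \<le> j" "c 1 < c' 1" | "j' \<le> j" "c 1 = c' 1" "(i, j) \<noteq> (i', j')"
      | "c 1 = c' 1" "(i, j) = (i', j')"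
      using c1(3) by fastforce
    then show ?thesis
    proof cases
      case 1
      \<comment> \<open>All columns stay before \<open>j'\<close>, so the primed bar is missed,
        while row \<open>i\<close> receives its one in column \<open>j\<close> or later.\<close>
      let ?P = "opening_path id (max j (c' 1))"
      let ?F = "fill i j ?P"
      have P: "packing_pattern p q ?P"
        using c1 bar bar' qp by (intro packing_pattern_opening_path) auto
      have F: "packing_pattern p q ?F"
      proof (rule packing_pattern_fill[OF P])
        show "\<exists>i'<i. (i', j - 1) \<in> ?P"
          using bar by (intro exI[of _ "j - 1"]) (auto simp: mem_opening_path ii')
      qed (use bar in \<open>auto simp: ii'\<close>)
      have "\<exists>l\<ge>j. (i, l) \<in> ?F"
      proof (cases "i \<le> max j (c' 1)")
        case True
        then have "(i, i) \<in> ?F" "j \<le> i"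
          using bar by (auto simp: mem_fill mem_opening_path ii')
        then show ?thesis by blast
      next
        case False
        then have "(i, j) \<in> ?F"
          using bar by (auto simp: mem_fill mem_opening_path)
        then show ?thesis by blast
      qed
      then obtain l where l: "(i, l) \<in> ?F" "j \<le> l" by blast
      show ?thesis
      proof (rule separatesI[OF F])
        show "slack (matrix_of ?F) ?d = 0"
        proof (rule hit[OF F l])
          show "(c 1, c 1) \<in> ?F"
            using c1 by (auto simp: mem_fill mem_opening_path)
          show "(c 1, c 1) \<in> shifted_column \<eta> c"
            using on_S[of 1] bar by simp
          show "(a, m) = (c 1, c 1)" if "(a, m) \<in> ?F" "(a, m) \<in> shifted_column \<eta> c" for a m
            using that ij_notin mem_S[of m a] by (auto simp: mem_fill mem_opening_path)
        qed
        show "0 < slack (matrix_of ?F) ?d'"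
        proof (rule slack_shifted_pos[OF F])
          show "(c' 1, c' 1) \<in> ?F"
            using c1 by (auto simp: mem_fill mem_opening_path)
          show "(c' 1, c' 1) \<in> shifted_column \<eta>' c'"
            using on_S'[of 1] bar' by simp
          show "l < j'" if "(j' + \<eta>' - 1, l) \<in> ?F" for l
            using that 1 c1 bar' by (auto simp: mem_fill mem_opening_path)
        qed
      qed
    next
      case 2
      have \<eta>: "2 \<le> \<eta>"
      proof (rule ccontr)
        assume "\<not> 2 \<le> \<eta>"
        then have "\<eta> = 1" using bar by simp
        then have "c 1 = j - 1"
          using c by (simp add: admissible_def)
        then show False
          using 2 c1 by linarith
      qed
      \<comment> \<open>The path leaves row \<open>Suc (c' 1)\<close> free for a second one in
        column \<open>c' 1\<close>. The unprimed shifted column stays in column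
        \<open>c 1 < c' 1\<close> on the first two diagonals and is met only once.\<close>
      let ?f = "\<lambda>m. if m \<le> c' 1 then m else Suc m"
      let ?P = "opening_path ?f j"
      let ?Q = "fill (Suc (c' 1)) (c' 1) ?P"
      let ?F = "fill i j ?Q"
      have P: "packing_pattern p q ?P"
        using c1 bar \<eta> 2 by (intro packing_pattern_opening_path) auto
      have Q: "packing_pattern p q ?Q"
      proof (rule packing_pattern_fill[OF P])
        show "\<exists>i'<Suc (c' 1). (i', c' 1 - 1) \<in> ?P" if "2 \<le> c' 1"
          using c1 2 that by (intro exI[of _ "c' 1 - 1"]) (auto simp: mem_opening_path)
      qed (use bar bar' qp c1 in auto)
      have F: "packing_pattern p q ?F"
      proof (rule packing_pattern_fill[OF Q])
        have "(?f (j - 1), j - 1) \<in> ?Q"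
          using bar by (auto simp: mem_fill mem_opening_path)
        moreover have "?f (j - 1) < i"
          using bar \<eta> by (auto simp: ii')
        ultimately show "\<exists>i'<i. (i', j - 1) \<in> ?Q" by blast
      qed (use bar in \<open>auto simp: ii'\<close>)
      have "(i, l) \<in> ?Q \<Longrightarrow> l = j" for l
        using 2 c1 bar \<eta> by (auto simp: mem_fill mem_opening_path ii' split: if_splits)
      then have ij: "(i, j) \<in> ?F"
        by (auto simp: mem_fill[of i j i j])
      have extra: "(Suc (c' 1), c' 1) \<in> ?F"
        using 2 c1 by (auto simp: mem_fill mem_opening_path split: if_splits)
      have first: "(m, m) \<in> ?F" if "1 \<le> m" "m \<le> c' 1" for m
        using that 2 c1 by (auto simp: mem_fill mem_opening_path)
      show ?thesis
      proof (rule separatesI[OF F])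
        show "slack (matrix_of ?F) ?d = 0"
        proof (rule hit[OF F ij order_refl])
          show "(c 1, c 1) \<in> ?F"
            using first[of "c 1"] c1 by simp
          show "(c 1, c 1) \<in> shifted_column \<eta> c"
            using on_S[of 1] bar by simp
          show "(a, m) = (c 1, c 1)" if "(a, m) \<in> ?F" "(a, m) \<in> shifted_column \<eta> c" for a m
          proof -
            have "(a, m) \<noteq> (i, j)"
              using that(2) ij_notin by auto
            then have "1 \<le> m" "a = m \<or> (a = Suc m \<and> c' 1 \<le> m)"
              using that(1) c1 by (auto simp: mem_fill mem_opening_path split: if_splits)
            then show ?thesis
              using that(2) mem_S[of m a] c2[OF \<eta>] 2 by (auto simp: numeral_2_eq_2)
          qed
        qed
        \<comment> \<open>The extra one is a second hit of the primed shifted column; for \<eta>' =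
          1 it instead occupies the row of the primed bar, in a column before it.\<close>
        show "0 < slack (matrix_of ?F) ?d'"
        proof (cases "2 \<le> \<eta>'")
          case True
          show ?thesis
          proof (rule slack_shifted_pos2[OF F])
            show "(c' 1, c' 1) \<in> ?F"
              using first c1 by simp
            show "(c' 1, c' 1) \<in> shifted_column \<eta>' c'"
              using on_S'[of 1] bar' by simp
            show "(Suc (c' 1), c' 1) \<in> ?F"
              by (rule extra)
            show "(Suc (c' 1), c' 1) \<in> shifted_column \<eta>' c'"
              using on_S'[of 2] True c'2 by simp
          qed simp
        next
          case False
          then have \<eta>': "\<eta>' = 1" using bar' by simp
          then have "c' 1 = j' - 1"
            using c' by (simp add: admissible_def)
          then have j': "j' = Suc (c' 1)"
            using bar' by simp
          show ?thesis
          proof (rule slack_shifted_pos[OF F])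
            show "(c' 1, c' 1) \<in> ?F"
              using first c1 by simp
            show "(c' 1, c' 1) \<in> shifted_column \<eta>' c'"
              using on_S'[of 1] bar' by simp
            show "l < j'" if "(j' + \<eta>' - 1, l) \<in> ?F" for l
              using packing_pattern_unique[OF F extra, of l] that \<eta>' j' by simp
          qed
        qed
      qed
    next
      case 3
      have lt: "i' < i" and \<eta>: "2 \<le> \<eta>"
      proof -
        have "i' \<le> i"
          using le 3 by (simp add: ii')
        moreover have "i' \<noteq> i"
          using le 3 bar bar' by (auto simp: ii')
        ultimately show "i' < i" by simp
        show "2 \<le> \<eta>"
        proof (rule ccontr)
          assume "\<not> 2 \<le> \<eta>"
          then have *: "\<eta> = 1" "\<eta>' = 1" using bar bar' le by simp_all
          then have "c 1 = j - 1" "c' 1 = j' - 1"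
            using c c' by (simp_all add: admissible_def)
          then show False
            using 3 * bar bar' by (auto simp: ii')
        qed
      qed
      \<comment> \<open>Row \<open>i'\<close> is skipped, so the primed bar is missed. The skip
        comes after the shared position \<open>(c 1, c 1)\<close> and puts the rest on the second
        diagonal, to the right of \<open>c 2 = c 1\<close>.\<close>
      let ?f = "\<lambda>m. if m < i' then m else Suc m"
      let ?P = "opening_path ?f j"
      let ?F = "fill i j ?P"
      have P: "packing_pattern p q ?P"
        using bar \<eta> by (intro packing_pattern_opening_path) auto
      have F: "packing_pattern p q ?F"
      proof (rule packing_pattern_fill[OF P])
        have "(?f (j - 1), j - 1) \<in> ?P"
          using bar by (auto simp: mem_opening_path)
        moreover have "?f (j - 1) < i"
          using bar \<eta> by (auto simp: ii')
        ultimately show "\<exists>i'<i. (i', j - 1) \<in> ?P" by blast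
      qed (use bar in \<open>auto simp: ii'\<close>)
      have "(i, l) \<in> ?P \<Longrightarrow> l = j" for l
        using bar \<eta> by (auto simp: mem_opening_path ii' split: if_splits)
      then have ij: "(i, j) \<in> ?F"
        by (auto simp: mem_fill[of i j i j])
      have ci: "c 1 < i'"
        using 3 c1 bar' by (simp add: ii')
      have first: "(c 1, c 1) \<in> ?F"
        using ci c1 by (auto simp: mem_fill mem_opening_path)
      show ?thesis
      proof (rule separatesI[OF F])
        show "slack (matrix_of ?F) ?d = 0"
        proof (rule hit[OF F ij order_refl])
          show "(c 1, c 1) \<in> ?F"
            by (rule first)
          show "(c 1, c 1) \<in> shifted_column \<eta> c"
            using on_S[of 1] bar by simp
          show "(a, m) = (c 1, c 1)" if "(a, m) \<in> ?F" "(a, m) \<in> shifted_column \<eta> c" for a m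
          proof -
            have "(a, m) \<noteq> (i, j)"
              using that(2) ij_notin by auto
            then have "1 \<le> m" "a = m \<or> (a = Suc m \<and> i' \<le> m)"
              using that(1) by (auto simp: mem_fill mem_opening_path split: if_splits)
            then show ?thesis
              using that(2) mem_S[of m a] c2[OF \<eta>] ci by (auto simp: numeral_2_eq_2)
          qed
        qed
        show "0 < slack (matrix_of ?F) ?d'"
        proof (rule slack_shifted_pos[OF F _ first])
          show "(c 1, c 1) \<in> shifted_column \<eta>' c'"
            using on_S'[of 1] bar' 3 by simp
          show "l < j'" if "(j' + \<eta>' - 1, l) \<in> ?F" for l
            using that lt unfolding i'_def[symmetric] by (auto simp: mem_fill mem_opening_path split: if_splits)
        qed
      qed
    next
      case 4
      have eq: "j' = j" "\<eta>' = \<eta>" "i' = i"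
        using 4 bar bar' by (auto simp: ii')
      have "\<exists>k. 1 \<le> k \<and> k \<le> \<eta> \<and> c k \<noteq> c' k"
      proof (rule ccontr)
        assume "\<not> ?thesis"
        then have "shifted_column \<eta>' c' = shifted_column \<eta> c"
          unfolding shifted_column_def eq by (intro image_cong) auto
        then show False
          using neq eq by simp
      qed
      define h where "h = (LEAST k. 1 \<le> k \<and> k \<le> \<eta> \<and> c k \<noteq> c' k)"
      have h: "1 \<le> h" "h \<le> \<eta>" "c h \<noteq> c' h"
        unfolding h_def using LeastI_ex[OF \<open>\<exists>k. 1 \<le> k \<and> k \<le> \<eta> \<and> c k \<noteq> c' k\<close>] by blast+
      have before: "c k = c' k" if "1 \<le> k" "k < h" for k
        using not_less_Least[of k "\<lambda>k. 1 \<le> k \<and> k \<le> \<eta> \<and> c k \<noteq> c' k"] that h unfolding h_def[symmetric] by auto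
      have "h \<noteq> 1"
        using h(3) 4 by auto
      then have h2: "2 \<le> h" using h(1) by simp
      have ch: "c h < c' h" "c (h - 1) \<le> c h" "c' (h - 1) = c (h - 1)" "1 \<le> c (h - 1)"
        "c' h < j" "1 \<le> h - 1" "h - 1 \<le> \<eta>" "c h < j"
        using ge[of h] h h2 eq admissible_mono[OF c, of "h - 1" h] before[of "h - 1"]
          c_bounds[of "h - 1"] c_bounds[of h] c'_bounds[of h] by auto
      \<comment> \<open>The path runs on diagonal \<open>h - 1\<close> up to column
        \<open>c h\<close> and on diagonal \<open>h\<close> from then on. It takes the position
        shared on diagonal \<open>h - 1\<close>, jumps past \<open>c h\<close> and still meets
        \<open>c' h\<close>: one hit against two.\<close>
      let ?f = "\<lambda>m. if m \<le> c h then m + h - 2 else m + h - 1"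
      let ?P = "opening_path ?f j"
      let ?F = "fill i j ?P"
      have P: "packing_pattern p q ?P"
        using bar h h2 by (intro packing_pattern_opening_path) auto
      have F: "packing_pattern p q ?F"
      proof (rule packing_pattern_fill[OF P])
        have "(?f (j - 1), j - 1) \<in> ?P"
          using bar by (auto simp: mem_opening_path)
        moreover have "?f (j - 1) < i"
          using bar h h2 by (auto simp: ii')
        ultimately show "\<exists>i'<i. (i', j - 1) \<in> ?P" by blast
      qed (use bar in \<open>auto simp: ii'\<close>)
      have "(i, l) \<in> ?P \<Longrightarrow> l = j" for l
        using bar h h2 ch by (auto simp: mem_opening_path ii' split: if_splits)
      then have ij: "(i, j) \<in> ?F"
        by (auto simp: mem_fill[of i j i j])
      have first: "(c (h - 1) + (h - 1) - 1, c (h - 1)) \<in> ?F"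
        using ch by (auto simp: mem_fill mem_opening_path numeral_2_eq_2)
      show ?thesis
      proof (rule separatesI[OF F])
        show "slack (matrix_of ?F) ?d = 0"
        proof (rule hit[OF F ij order_refl first])
          show "(c (h - 1) + (h - 1) - 1, c (h - 1)) \<in> shifted_column \<eta> c"
            using on_S ch by blast
          show "(a, m) = (c (h - 1) + (h - 1) - 1, c (h - 1))" if "(a, m) \<in> ?F" "(a, m) \<in> shifted_column \<eta> c" for a m
          proof -
            have "(a, m) \<noteq> (i, j)"
              using that(2) ij_notin by auto
            then have "(a, m) \<in> ?P"
              using that(1) by (auto simp: mem_fill)
            then have m: "1 \<le> m" and a: "a = ?f m"
              by (auto simp: mem_opening_path)
            show ?thesis
            proof (cases "m \<le> c h")
              case True
              then have "a + 1 - m = h - 1" "a = m + (h - 1) - 1" "m \<le> a"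
                using a h2 by auto
              then show ?thesis
                using that(2) mem_S[OF m, of a] by auto
            next
              case False
              then have "a + 1 - m = h" "m \<le> a"
                using a h2 by auto
              then show ?thesis
                using that(2) mem_S[OF m, of a] False by auto
            qed
          qed
        qed
        show "0 < slack (matrix_of ?F) ?d'"
        proof (rule slack_shifted_pos2[OF F first])
          show "(c (h - 1) + (h - 1) - 1, c (h - 1)) \<in> shifted_column \<eta>' c'"
            using on_S'[of "h - 1"] ch eq by simp
          show "(c' h + h - 1, c' h) \<in> ?F"
            using ch by (auto simp: mem_fill mem_opening_path)
          show "(c' h + h - 1, c' h) \<in> shifted_column \<eta>' c'"
            using on_S' h eq by blast
          show "(c (h - 1) + (h - 1) - 1, c (h - 1)) \<noteq> (c' h + h - 1, c' h)"
            using ch by auto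
        qed
      qed
    qed
  qed
qed

lemma single_in_vectors_on: "e \<in> T \<Longrightarrow> Poly_Mapping.single e a \<in> vectors_on T"
  by (auto simp: vectors_on_def in_keys_iff lookup_single when_def split: if_splits)

lemma orbitope_system_violated:
  assumes "2 \<le> q" "q \<le> p" and "d \<in> orbitope_system p q"
  shows "\<exists>z \<in> vectors_on (positions p q). slack z d < 0"
  using assms(3)
proof (cases rule: orbitope_system_cases)
  case (row i)
  have mem: "(i, 1) \<in> row q i" "(i, 1) \<in> positions p q"
    using row assms by (auto simp: row_def positions_def)
  show ?thesis
  proof (rule bexI)
    show "slack (Poly_Mapping.single (i, 1) 2) d < 0"
      using mem(1) by (simp add: row(1) lookup_single when_def)
    show "Poly_Mapping.single (i, 1) 2 \<in> vectors_on (positions p q)"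
      using mem(2) by (rule single_in_vectors_on)
  qed
next
  case (nonneg i j)
  show ?thesis
  proof (rule bexI)
    show "slack (Poly_Mapping.single (i, j) (- 1)) d < 0"
      by (simp add: nonneg(1))
    show "Poly_Mapping.single (i, j) (- 1) \<in> vectors_on (positions p q)"
      using nonneg by (intro single_in_vectors_on) (simp add: positions_def)
  qed
next
  case (shifted \<eta> j c)
  let ?e = "(j + \<eta> - 1, j)"
  have "?e \<in> bar q (diagonal \<eta> j)"
    using shifted by (auto simp: bar_def diagonal_def)
  moreover have "?e \<notin> shifted_column \<eta> c"
    using shifted shifted_column_iff[of \<eta> j \<eta> c] admissible_bounds[OF shifted(6), of \<eta>] by auto
  ultimately have "slack (Poly_Mapping.single ?e 1) d < 0"
    by (simp add: shifted(1) lookup_single when_def)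
  moreover have "Poly_Mapping.single ?e 1 \<in> vectors_on (positions p q)"
    using shifted by (intro single_in_vectors_on) (auto simp: positions_def)
  ultimately show ?thesis ..
qed

lemma separates_orbitope_system:
  assumes "2 \<le> q" "q \<le> p" and d: "d \<in> orbitope_system p q" and d': "d' \<in> orbitope_system p q" "d \<noteq> d'"
  shows "separates p q d d'"
  using d
proof (cases rule: orbitope_system_cases)
  case (row i)
  then show ?thesis
    using separates_row[OF assms(1,2) row(2,3) d'(1)] d'(2) by simp
next
  case (nonneg i j)
  then show ?thesis
    using separates_nonneg[OF assms(1,2) nonneg(2-6) d'(1)] d'(2) by simp
next
  case d: (shifted \<eta> j c)
  show ?thesis
    using d'(1)
  proof (cases rule: orbitope_system_cases)
    case (row i)
    have F: "packing_pattern p q {}"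
      by (rule packing_patternI) auto
    show ?thesis
    proof (rule separatesI[OF F])
      show "slack (matrix_of {}) d = 0"
        unfolding d(1) slack_shifted_pattern[OF F] by simp
      show "0 < slack (matrix_of {}) d'"
        unfolding row(1) by (subst slack_row_sum_one[OF F]) auto
    qed
  next
    case (nonneg i' j')
    then show ?thesis
      unfolding d(1) nonneg(1) by (intro separates_shifted_nonneg assms d) auto
  next
    case (shifted \<eta>' j' c')
    then show ?thesis
      using d'(2) unfolding d(1) shifted(1) by (intro separates_shifted_shifted assms d) auto
  qed
qed

theorem non_redundant_orbitope_system:
  assumes qp: "2 \<le> q" "q \<le> p"
  shows "non_redundant p q (orbitope_system p q)"
proof (rule non_redundant_criterion)
  let ?L = "orbitope_system p q"
  show separated: "\<exists>y \<in> solution_set p q ?L. slack y d = 0 \<and> 0 < slack y d'"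
    if dd': "d \<in> ?L" "d' \<in> ?L" "d \<noteq> d'" for d d'
  proof -
    obtain F where "packing_pattern p q F" "slack (matrix_of F) d = 0" "0 < slack (matrix_of F) d'"
      using separates_orbitope_system[OF qp dd'] unfolding separates_def by blast
    then show ?thesis
      by (intro bexI[of _ "matrix_of F"] conjI packing_pattern_solution)
  qed
  show "\<exists>y \<in> solution_set p q ?L. slack y d = 0" if "d \<in> ?L" for d
  proof -
    \<comment> \<open>Two distinct constraints exist, so some \<open>d'\<close> differs from
      \<open>d\<close>, and the point separating them is tight for \<open>d\<close>.\<close>
    have "(1, 1) \<in> row q 1" "(1, 1) \<notin> row q 2"
      using qp by (simp_all add: row_def)
    then have "Row_Sum (row q 1) \<noteq> Row_Sum (row q 2)"
      by (metis lin_constraint.inject(1))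
    moreover have "Row_Sum (row q 1) \<in> ?L" "Row_Sum (row q 2) \<in> ?L"
      using qp by (auto intro!: row_sum_in_system)
    ultimately obtain d' where "d' \<in> ?L" "d \<noteq> d'"
      by metis
    from separated[OF that this] show ?thesis
      by blast
  qed
qed (use finite_orbitope_system orbitope_system_violated[OF qp] in auto)

section \<open>Separation in linear time\<close>

text \<open>Total correctness with an upper bound on the time in place of the exact value, so that
  one number covers both branches and all iterations.\<close>

definition runs :: "com \<Rightarrow> state \<Rightarrow> nat \<Rightarrow> (state \<Rightarrow> bool) \<Rightarrow> bool" where
  "runs P s n Q \<longleftrightarrow> (\<exists>t s'. exec P s t s' \<and> t \<le> n \<and> Q s')"

lemma runs_Seq: "runs P s n (\<lambda>s'. runs R s' m Q) \<Longrightarrow> n + m \<le> k \<Longrightarrow> runs (Seq P R) s k Q"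
  unfolding runs_def by (meson add_mono exec.Seq le_trans)

lemma runs_Cond:
  assumes "bval s b \<Longrightarrow> runs P s n Q" "\<not> bval s b \<Longrightarrow> runs R s n Q" "1 + bcost b + n \<le> k"
  shows "runs (Cond b P R) s k Q"
proof (cases "bval s b")
  case True
  then obtain t s' where "exec P s t s'" "t \<le> n" "Q s'"
    using assms(1) by (auto simp: runs_def)
  then show ?thesis
    using exec.CondTrue[OF True] assms(3) unfolding runs_def
    by (intro exI[of _ "1 + bcost b + t"] exI[of _ s']) auto
next
  case False
  then obtain t s' where "exec R s t s'" "t \<le> n" "Q s'"
    using assms(2) by (auto simp: runs_def)
  then show ?thesis
    using exec.CondFalse[OF False] assms(3) unfolding runs_def
    by (intro exI[of _ "1 + bcost b + t"] exI[of _ s']) auto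
qed

text \<open>\<open>I n s\<close> says that \<open>n\<close> iterations remain.\<close>

lemma runs_While:
  assumes "I n s"
    and step: "\<And>n s. I (Suc n) s \<Longrightarrow> bval s b \<and> runs P s K (I n)"
    and stop: "\<And>s. I 0 s \<Longrightarrow> \<not> bval s b"
    and k: "n * (1 + bcost b + K) + (1 + bcost b) \<le> k"
  shows "runs (While b P) s k (I 0)"
proof -
  have "\<exists>t s'. exec (While b P) s t s' \<and> t \<le> n * (1 + bcost b + K) + (1 + bcost b) \<and> I 0 s'"
    using \<open>I n s\<close>
  proof (induction n arbitrary: s)
    case 0
    then show ?case
      using exec.WhileFalse[OF stop[OF 0]] by fastforce
  next
    case (Suc n)
    obtain t s' where s': "exec P s t s'" "t \<le> K" "I n s'"
      using step[OF Suc.prems] by (auto simp: runs_def)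
    obtain u s'' where s'': "exec (While b P) s' u s''" "u \<le> n * (1 + bcost b + K) + (1 + bcost b)" "I 0 s''"
      using Suc.IH[OF s'(3)] by blast
    have "exec (While b P) s (1 + bcost b + t + u) s''"
      using step[OF Suc.prems] s'(1) s''(1) by (intro exec.WhileTrue) auto
    then show ?case
      using s'(2) s''(2,3) by (intro exI[of _ "1 + bcost b + t + u"] exI[of _ s'']) auto
  qed
  then show ?thesis
    using k unfolding runs_def by (meson le_trans)
qed

lemma runs_mono: "runs P s n Q \<Longrightarrow> n \<le> m \<Longrightarrow> (\<And>s. Q s \<Longrightarrow> Q' s) \<Longrightarrow> runs P s m Q'"
  unfolding runs_def by (meson le_trans)

text \<open>Loop-free blocks are run symbolically through \<open>effect\<close> and
  \<open>max_cost\<close>; invariants are then needed only for the three loops.\<close>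

fun loop_free :: "com \<Rightarrow> bool" where
  "loop_free (Seq P Q) \<longleftrightarrow> loop_free P \<and> loop_free Q"
| "loop_free (Cond b P Q) \<longleftrightarrow> loop_free P \<and> loop_free Q"
| "loop_free (While b P) \<longleftrightarrow> False"
| "loop_free _ \<longleftrightarrow> True"

fun effect :: "com \<Rightarrow> state \<Rightarrow> state" where
  "effect (IAssign a es e) s = s\<lparr>ints := (ints s)(a := (ints s a)(map (ival s) es := ival s e))\<rparr>"
| "effect (RAssign a es e) s = s\<lparr>rats := (rats s)(a := (rats s a)(map (ival s) es := rval s e))\<rparr>"
| "effect (Seq P Q) s = effect Q (effect P s)"
| "effect (Cond b P Q) s = (if bval s b then effect P s else effect Q s)"
| "effect _ s = s"

fun max_cost :: "com \<Rightarrow> nat" where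
  "max_cost (IAssign a es e) = 1 + sum_list (map icost es) + icost e"
| "max_cost (RAssign a es e) = 1 + sum_list (map icost es) + rcost e"
| "max_cost (Seq P Q) = max_cost P + max_cost Q"
| "max_cost (Cond b P Q) = 1 + bcost b + max (max_cost P) (max_cost Q)"
| "max_cost _ = 1"

lemma runs_loop_free: "loop_free P \<Longrightarrow> Q (effect P s) \<Longrightarrow> max_cost P \<le> k \<Longrightarrow> runs P s k Q"
proof -
  have "loop_free P \<Longrightarrow> \<exists>t. exec P s t (effect P s) \<and> t \<le> max_cost P" for P s
  proof (induction P arbitrary: s)
    case (Seq P Q)
    then obtain t u where "exec P s t (effect P s)" "t \<le> max_cost P"
      "exec Q (effect P s) u (effect Q (effect P s))" "u \<le> max_cost Q"
      by force
    then show ?case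
      by (intro exI[of _ "t + u"]) (auto intro: exec.Seq)
  next
    case (Cond b P Q)
    show ?case
    proof (cases "bval s b")
      case True
      obtain t where "exec P s t (effect P s)" "t \<le> max_cost P"
        using Cond by force
      with True show ?thesis
        by (intro exI[of _ "1 + bcost b + t"]) (auto intro: exec.CondTrue[simplified])
    next
      case False
      obtain t where "exec Q s t (effect Q s)" "t \<le> max_cost Q"
        using Cond by force
      with False show ?thesis
        by (intro exI[of _ "1 + bcost b + t"]) (auto intro: exec.CondFalse[simplified])
    qed
  qed (auto intro: exec.intros[simplified])
  then show "loop_free P \<Longrightarrow> Q (effect P s) \<Longrightarrow> max_cost P \<le> k \<Longrightarrow> runs P s k Q"
    unfolding runs_def by (meson le_trans)
qed

section \<open>The separation program\<close>

abbreviation "IV v \<equiv> IRef v []"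
abbreviation "RV v \<equiv> RRef v []"
abbreviation "ISet v \<equiv> IAssign v []"
abbreviation "RSet v \<equiv> RAssign v []"
abbreviation "pred e \<equiv> ISub e (IConst 1)"

text \<open>One step of both recursions at \<open>(r, k)\<close>: \<open>w\<close> tabulates
  \<open>min_shifted\<close>, \<open>t\<close> tabulates \<open>last_column\<close>, and only row
  \<open>r - 1\<close> is read.\<close>

definition table_com :: com where
  "table_com =
    Cond (Conj (ILess (IConst 1) (IV ''k'')) (Conj (ILess (IV ''k'') (IV ''r''))
        (RLess (RRef ''w'' [pred (IV ''r''), pred (IV ''k'')])
          (RAdd (RRef ''w'' [pred (IV ''r''), IV ''k'']) (RRef ''x'' [IV ''r'', IV ''k''])))))
      (Seq (RAssign ''w'' [IV ''r'', IV ''k''] (RRef ''w'' [pred (IV ''r''), pred (IV ''k'')]))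
        (IAssign ''t'' [IV ''r'', IV ''k''] (IRef ''t'' [pred (IV ''r''), pred (IV ''k'')])))
      (Seq (RAssign ''w'' [IV ''r'', IV ''k'']
          (RAdd (RRef ''w'' [pred (IV ''r''), IV ''k'']) (RRef ''x'' [IV ''r'', IV ''k''])))
        (IAssign ''t'' [IV ''r'', IV ''k''] (IV ''k'')))"

definition report_com :: "int \<Rightarrow> com" where
  "report_com v = Seq (ISet ''verdict'' (IConst v)) (Seq (ISet ''i'' (IV ''r'')) (ISet ''j'' (IV ''k'')))"

text \<open>Cells above the diagonal are tested like all others; \<open>x\<close> and
  \<open>w\<close> vanish there, so nothing is reported.\<close>

definition check_com :: com where
  "check_com =
    Seq (RSet ''b'' (RAdd (RV ''b'') (RRef ''x'' [IV ''r'', IV ''k''])))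
    (Seq (Cond (Conj (RLess (RRef ''x'' [IV ''r'', IV ''k'']) (RConst 0))
          (Neg (Conj (Neg (ILess (IV ''k'') (IV ''r''))) (ILess (IV ''k'') (IV ''q'')))))
        (report_com 2) Skip)
    (Seq (Cond (Conj (ILess (IConst 1) (IV ''k'')) (RLess (RRef ''w'' [pred (IV ''r''), pred (IV ''k'')]) (RV ''b'')))
        (report_com 3) Skip)
      (ISet ''k'' (pred (IV ''k'')))))"

definition scan_com :: com where
  "scan_com =
    While (ILess (IV ''r'') (IV ''p''))
      (Seq (Seq (ISet ''r'' (IAdd (IV ''r'') (IConst 1))) (Seq (RSet ''b'' (RConst 0)) (ISet ''k'' (IV ''q''))))
      (Seq (While (ILess (IConst 0) (IV ''k'')) (Seq table_com check_com))
        (Cond (RLess (RConst 1) (RV ''b'')) (report_com 1) Skip)))"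

text \<open>\<open>n\<close> counts down the diagonals from \<eta> = i - (j - 1); \<open>l\<close>
  is the column chosen on the previous diagonal, initially \<open>j - 1\<close>. Column
  \<open>l\<close> meets diagonal \<open>n\<close> in row \<open>n + l - 1\<close>.\<close>

definition trace_com :: com where
  "trace_com =
    Seq (Seq (ISet ''l'' (pred (IV ''j''))) (ISet ''n'' (ISub (IV ''i'') (pred (IV ''j'')))))
      (While (ILess (IConst 0) (IV ''n''))
        (Seq (ISet ''l'' (IRef ''t'' [pred (IAdd (IV ''n'') (IV ''l'')), IV ''l'']))
        (Seq (IAssign ''c'' [IV ''n''] (IV ''l''))
          (ISet ''n'' (pred (IV ''n''))))))"

text \<open>The shifted column is reconstructed once, after the scan, for the last reported
  violation. Tracing at every violation would cost a further factor \<open>p\<close>.\<close>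

definition separation_com :: com where
  "separation_com = Seq scan_com (Cond (ILess (IConst 2) (IV ''verdict'')) trace_com Skip)"

definition row_excess :: "nat \<Rightarrow> (pos \<Rightarrow>\<^sub>0 rat) \<Rightarrow> nat \<Rightarrow> bool" where
  "row_excess q x i \<longleftrightarrow> 1 < (\<Sum>l=1..q. entry x (i, l))"

definition negative_at :: "nat \<Rightarrow> (pos \<Rightarrow>\<^sub>0 rat) \<Rightarrow> nat \<Rightarrow> nat \<Rightarrow> bool" where
  "negative_at q x i j \<longleftrightarrow> entry x (i, j) < 0 \<and> (j < i \<or> j = q)"

definition bar_excess :: "nat \<Rightarrow> (pos \<Rightarrow>\<^sub>0 rat) \<Rightarrow> nat \<Rightarrow> nat \<Rightarrow> bool" where
  "bar_excess q x i j \<longleftrightarrow> 2 \<le> j \<and> min_shifted x (i - 1) (j - 1) < (\<Sum>l=j..q. entry x (i, l))"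

text \<open>Rows are scanned from right to left, so that the variable \<open>b\<close> runs through the bar sums.\<close>

definition scanned :: "nat \<Rightarrow> nat \<Rightarrow> nat \<Rightarrow> nat \<Rightarrow> bool" where
  "scanned r k i j \<longleftrightarrow> i < r \<or> (i = r \<and> k < j)"

text \<open>Row 0 belongs to the table \<open>w\<close>, whose cells start at 0, the value of
  \<open>min_shifted x 0 j\<close>. The cells of \<open>t\<close> in row 0 do not hold
  \<open>last_column x 0 j\<close>, hence the premise \<open>1 \<le> i\<close>.\<close>

definition tables :: "nat \<Rightarrow> nat \<Rightarrow> (pos \<Rightarrow>\<^sub>0 rat) \<Rightarrow> nat \<Rightarrow> nat \<Rightarrow> state \<Rightarrow> bool" where
  "tables p q x r k s \<longleftrightarrow> ints s ''p'' [] = int p \<and> ints s ''q'' [] = int q \<and>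
     (\<forall>i j. rats s ''x'' [int i, int j] = entry x (i, j)) \<and>
     (\<forall>i j. scanned r k i j \<longrightarrow> 1 \<le> j \<longrightarrow> j \<le> q \<longrightarrow>
        rats s ''w'' [int i, int j] = min_shifted x i j \<and>
        (1 \<le> i \<longrightarrow> ints s ''t'' [int i, int j] = int (last_column x i j)))"

text \<open>\<open>m\<close> counts the rows whose sums are known, separately from the scan
  position, because a row sum is complete only after all cells of its row. Some valid finding is
  asserted rather than the first one, as later reports overwrite earlier ones.\<close>

definition findings :: "nat \<Rightarrow> nat \<Rightarrow> (pos \<Rightarrow>\<^sub>0 rat) \<Rightarrow> nat \<Rightarrow> nat \<Rightarrow> nat \<Rightarrow> state \<Rightarrow> bool" where
  "findings p q x m r k s \<longleftrightarrow>
     (ints s ''verdict'' [] = 0 \<and> (\<forall>i. 1 \<le> i \<longrightarrow> i \<le> m \<longrightarrow> \<not> row_excess q x i) \<and>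
        (\<forall>i j. scanned r k i j \<longrightarrow> 1 \<le> i \<longrightarrow> 1 \<le> j \<longrightarrow> j \<le> q \<longrightarrow> \<not> negative_at q x i j \<and> \<not> bar_excess q x i j)) \<or>
     (\<exists>i j. ints s ''i'' [] = int i \<and> ints s ''j'' [] = int j \<and> 1 \<le> i \<and> i \<le> p \<and> j \<le> q \<and>
        (ints s ''verdict'' [] = 1 \<and> row_excess q x i \<or>
         ints s ''verdict'' [] = 2 \<and> 1 \<le> j \<and> negative_at q x i j \<or>
         ints s ''verdict'' [] = 3 \<and> bar_excess q x i j))"

section \<open>Correctness and running time of the program\<close>

lemma tables_cong:
  assumes "tables p q x r k s"
    and "ints s' ''p'' = ints s ''p''" "ints s' ''q'' = ints s ''q''" "ints s' ''t'' = ints s ''t''"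
    and "rats s' ''x'' = rats s ''x''" "rats s' ''w'' = rats s ''w''"
  shows "tables p q x r k s'"
  using assms unfolding tables_def by simp

lemma table_com_correct:
  assumes tab: "tables p q x (Suc i) (Suc n) s" and n: "Suc n \<le> q"
    and rk: "ints s ''r'' [] = int (Suc i)" "ints s ''k'' [] = int (Suc n)"
  defines "s' \<equiv> effect table_com s"
  shows "tables p q x (Suc i) n s'"
    and "a \<noteq> ''t'' \<Longrightarrow> ints s' a = ints s a" "a \<noteq> ''w'' \<Longrightarrow> rats s' a = rats s a"
proof -
  have x: "rats s ''x'' [int a, int b] = entry x (a, b)" for a b
    using tab by (simp add: tables_def)
  have w: "rats s ''w'' [int a, int b] = min_shifted x a b"
    "1 \<le> a \<Longrightarrow> ints s ''t'' [int a, int b] = int (last_column x a b)"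
    if "scanned (Suc i) (Suc n) a b" "1 \<le> b" "b \<le> q" for a b
    using tab that by (simp_all add: tables_def)
  have above: "rats s ''w'' [int i, 1 + int n] = min_shifted x i (Suc n)"
    using w(1)[of i "Suc n"] n by (simp add: scanned_def)
  \<comment> \<open>The left branch is entered only for \<open>1 < Suc n\<close> and
    \<open>Suc n < Suc i\<close>, so it reads columns and rows from 1 on, where both tables are
    valid.\<close>
  have left: "rats s ''w'' [int i, int n] = min_shifted x i n" if "1 \<le> n"
    using w(1)[of i n] n that by (simp add: scanned_def)
  have left': "ints s ''t'' [int i, int n] = int (last_column x i n)" if "1 \<le> n" "1 \<le> i"
    using w(2)[of i n] n that by (simp add: scanned_def)
  have here: "rats s ''x'' [1 + int i, 1 + int n] = entry x (Suc i, Suc n)"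
    using x[of "Suc i" "Suc n"] by simp
  show "a \<noteq> ''t'' \<Longrightarrow> ints s' a = ints s a" "a \<noteq> ''w'' \<Longrightarrow> rats s' a = rats s a"
    by (simp_all add: s'_def table_com_def)
  have new: "rats s' ''w'' = (rats s ''w'')([1 + int i, 1 + int n] := min_shifted x (Suc i) (Suc n))"
    "ints s' ''t'' = (ints s ''t'')([1 + int i, 1 + int n] := int (last_column x (Suc i) (Suc n)))"
    using rk above left left' here by (auto simp: s'_def table_com_def)
  show "tables p q x (Suc i) n s'"
    unfolding tables_def
  proof (intro conjI allI impI)
    fix a b assume ab: "scanned (Suc i) n a b" "1 \<le> b" "b \<le> q"
    have "a = Suc i \<and> b = Suc n \<or> scanned (Suc i) (Suc n) a b \<and> \<not> (int a = 1 + int i \<and> int b = 1 + int n)"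
      using ab(1) by (auto simp: scanned_def)
    then show "rats s' ''w'' [int a, int b] = min_shifted x a b"
      "1 \<le> a \<Longrightarrow> ints s' ''t'' [int a, int b] = int (last_column x a b)"
      using w[of a b] ab(2,3) unfolding new by (auto simp del: min_shifted.simps last_column.simps)
  qed (use tab in \<open>simp_all add: tables_def s'_def table_com_def\<close>)
qed

lemma scanned_step: "scanned r n i j \<longleftrightarrow> scanned r (Suc n) i j \<or> (i = r \<and> j = Suc n)"
  by (auto simp: scanned_def)

lemma check_com_correct:
  assumes tab: "tables p q x (Suc i) n s" and n: "Suc n \<le> q" and i: "Suc i \<le> p"
    and rk: "ints s ''r'' [] = int (Suc i)" "ints s ''k'' [] = int (Suc n)"
    and b: "rats s ''b'' [] = (\<Sum>l=Suc (Suc n)..q. entry x (Suc i, l))"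
    and find: "findings p q x i (Suc i) (Suc n) s"
    and x: "x \<in> vectors_on (positions p q)"
  defines "s' \<equiv> effect check_com s"
  shows "tables p q x (Suc i) n s'" "findings p q x i (Suc i) n s'"
    "ints s' ''r'' [] = int (Suc i)" "ints s' ''k'' [] = int n"
    "rats s' ''b'' [] = (\<Sum>l=Suc n..q. entry x (Suc i, l))"
proof -
  have here: "rats s ''x'' [1 + int i, 1 + int n] = entry x (Suc i, Suc n)"
    using tab unfolding tables_def by (metis of_nat_Suc)
  have left: "rats s ''w'' [int i, int n] = min_shifted x i n" if "1 \<le> n"
    using tab n that by (simp add: tables_def scanned_def)
  have sum: "(\<Sum>l=Suc n..q. entry x (Suc i, l)) = entry x (Suc i, Suc n) + (\<Sum>l=Suc (Suc n)..q. entry x (Suc i, l))"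
    using n by (simp add: sum.atLeast_Suc_atMost)
  have q: "ints s ''q'' [] = int q"
    using tab by (simp add: tables_def)
  show "tables p q x (Suc i) n s'"
    by (rule tables_cong[OF tab]) (simp_all add: s'_def check_com_def report_com_def)
  show "ints s' ''r'' [] = int (Suc i)" "ints s' ''k'' [] = int n"
    "rats s' ''b'' [] = (\<Sum>l=Suc n..q. entry x (Suc i, l))"
    using rk b here sum by (simp_all add: s'_def check_com_def report_com_def add.commute)
  have neg: "negative_at q x (Suc i) (Suc n) \<longleftrightarrow>
      entry x (Suc i, Suc n) < 0 \<and> \<not> (\<not> Suc n < Suc i \<and> Suc n < q)"
    using n by (auto simp: negative_at_def)
  have bar: "bar_excess q x (Suc i) (Suc n) \<longleftrightarrow> 1 \<le> n \<and> rats s ''w'' [int i, int n] < (\<Sum>l=Suc n..q. entry x (Suc i, l))"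
    using left by (auto simp: bar_excess_def)
  \<comment> \<open>The bar test runs last, so its report takes precedence at the same cell.\<close>
  have ij: "(ints s' ''verdict'' [], ints s' ''i'' [], ints s' ''j'' []) =
    (if bar_excess q x (Suc i) (Suc n) then (3, int (Suc i), int (Suc n))
     else if negative_at q x (Suc i) (Suc n) then (2, int (Suc i), int (Suc n))
     else (ints s ''verdict'' [], ints s ''i'' [], ints s ''j'' []))"
  proof -
    define B where "B = (\<Sum>l=Suc (Suc n)..q. entry x (Suc i, l))"
    show ?thesis
      unfolding neg bar sum B_def[symmetric] using rk b[folded B_def] here q
      by (auto simp: s'_def check_com_def report_com_def add.commute)
  qed
  show "findings p q x i (Suc i) n s'"
  proof (cases "bar_excess q x (Suc i) (Suc n) \<or> negative_at q x (Suc i) (Suc n)")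
    case True
    then show ?thesis
      unfolding findings_def using ij n i
      by (intro disjI2 exI[of _ "Suc i"] exI[of _ "Suc n"]) (auto split: if_splits)
  next
    case False
    then have same: "ints s' ''verdict'' [] = ints s ''verdict'' []" "ints s' ''i'' [] = ints s ''i'' []"
      "ints s' ''j'' [] = ints s ''j'' []"
      using ij by auto
    show ?thesis
      using find False unfolding findings_def same scanned_step[of _ n] by blast
  qed
qed

lemma findings_cong:
  assumes "findings p q x m r k s"
    and "ints s' ''verdict'' = ints s ''verdict''" "ints s' ''i'' = ints s ''i''" "ints s' ''j'' = ints s ''j''"
  shows "findings p q x m r k s'"
  using assms unfolding findings_def by simp

lemma max_cost_cell: "loop_free (Seq table_com check_com)" "max_cost (Seq table_com check_com) \<le> 100"
  by (simp_all add: table_com_def check_com_def report_com_def)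

lemma runs_row:
  assumes tab: "tables p q x i 0 s" and find: "findings p q x i i 0 s" and r: "ints s ''r'' [] = int i"
    and i: "Suc i \<le> p" and x: "x \<in> vectors_on (positions p q)" and "1 \<le> q"
  shows "runs (Seq (Seq (ISet ''r'' (IAdd (IV ''r'') (IConst 1))) (Seq (RSet ''b'' (RConst 0)) (ISet ''k'' (IV ''q''))))
      (Seq (While (ILess (IConst 0) (IV ''k'')) (Seq table_com check_com))
        (Cond (RLess (RConst 1) (RV ''b'')) (report_com 1) Skip))) s (200 * q)
    (\<lambda>s'. tables p q x (Suc i) 0 s' \<and> findings p q x (Suc i) (Suc i) 0 s' \<and> ints s' ''r'' [] = int (Suc i))"
proof (rule runs_Seq)
  define I where "I n s' \<longleftrightarrow> n \<le> q \<and> tables p q x (Suc i) n s' \<and> findings p q x i (Suc i) n s' \<and>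
    ints s' ''r'' [] = int (Suc i) \<and> ints s' ''k'' [] = int n \<and>
    rats s' ''b'' [] = (\<Sum>l=Suc n..q. entry x (Suc i, l))" for n s'
  let ?init = "Seq (ISet ''r'' (IAdd (IV ''r'') (IConst 1))) (Seq (RSet ''b'' (RConst 0)) (ISet ''k'' (IV ''q'')))"
  \<comment> \<open>Having finished row \<open>i\<close> is the same as not having begun row
    \<open>i + 1\<close>, within the columns 1 to \<open>q\<close>.\<close>
  have scanned: "scanned (Suc i) q a b \<longleftrightarrow> scanned i 0 a b" if "1 \<le> b" "b \<le> q" for a b
    using that by (auto simp: scanned_def)
  have init: "I q (effect ?init s)"
    unfolding I_def
  proof (intro conjI)
    have "tables p q x (Suc i) q s"
      using tab scanned unfolding tables_def by blast
    then show "tables p q x (Suc i) q (effect ?init s)"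
      by (rule tables_cong) simp_all
    have "findings p q x i (Suc i) q s"
      using find scanned unfolding findings_def by blast
    then show "findings p q x i (Suc i) q (effect ?init s)"
      by (rule findings_cong) simp_all
  qed (use r tab in \<open>simp_all add: tables_def\<close>)
  have step: "I n (effect (Seq table_com check_com) s')" if I: "I (Suc n) s'" for n s'
  proof -
    let ?t = "effect table_com s'"
    have Sn: "Suc n \<le> q" and rk: "ints s' ''r'' [] = int (Suc i)" "ints s' ''k'' [] = int (Suc n)"
      and tab': "tables p q x (Suc i) (Suc n) s'"
      using I by (simp_all add: I_def)
    note t = table_com_correct[OF tab' Sn rk]
    have "findings p q x i (Suc i) (Suc n) ?t"
      by (rule findings_cong[of p q x i "Suc i" "Suc n" s']) (use I t(2) in \<open>simp_all add: I_def\<close>)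
    moreover have "ints ?t ''r'' [] = int (Suc i)" "ints ?t ''k'' [] = int (Suc n)"
      "rats ?t ''b'' [] = (\<Sum>l=Suc (Suc n)..q. entry x (Suc i, l))"
      using I by (simp_all add: t(2,3) I_def)
    ultimately have "tables p q x (Suc i) n (effect check_com ?t)" "findings p q x i (Suc i) n (effect check_com ?t)"
      "ints (effect check_com ?t) ''r'' [] = int (Suc i)" "ints (effect check_com ?t) ''k'' [] = int n"
      "rats (effect check_com ?t) ''b'' [] = (\<Sum>l=Suc n..q. entry x (Suc i, l))"
      using check_com_correct[OF t(1) Sn i _ _ _ _ x] by blast+
    then show ?thesis
      using Sn by (simp add: I_def)
  qed
  show "runs ?init s 20
    (\<lambda>s'. runs (Seq (While (ILess (IConst 0) (IV ''k'')) (Seq table_com check_com))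
        (Cond (RLess (RConst 1) (RV ''b'')) (report_com 1) Skip)) s' (104 * q + 30)
    (\<lambda>s'. tables p q x (Suc i) 0 s' \<and> findings p q x (Suc i) (Suc i) 0 s' \<and> ints s' ''r'' [] = int (Suc i)))"
  proof (rule runs_loop_free)
    show "runs (Seq (While (ILess (IConst 0) (IV ''k'')) (Seq table_com check_com))
        (Cond (RLess (RConst 1) (RV ''b'')) (report_com 1) Skip)) (effect ?init s) (104 * q + 30)
      (\<lambda>s'. tables p q x (Suc i) 0 s' \<and> findings p q x (Suc i) (Suc i) 0 s' \<and> ints s' ''r'' [] = int (Suc i))"
    proof (rule runs_Seq)
      let ?end = "Cond (RLess (RConst 1) (RV ''b'')) (report_com 1) Skip"
      have "runs (While (ILess (IConst 0) (IV ''k'')) (Seq table_com check_com)) (effect ?init s)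
          (104 * q + 4) (I 0)"
      proof (rule runs_While[of I q, OF init])
        show "bval s' (ILess (IConst 0) (IV ''k'')) \<and> runs (Seq table_com check_com) s' 100 (I n)"
          if "I (Suc n) s'" for n s'
          using that step[OF that] max_cost_cell by (auto intro!: runs_loop_free simp: I_def simp del: max_cost.simps effect.simps)
        show "\<not> bval s' (ILess (IConst 0) (IV ''k''))" if "I 0 s'" for s'
          using that by (simp add: I_def)
      qed simp
      then show "runs (While (ILess (IConst 0) (IV ''k'')) (Seq table_com check_com)) (effect ?init s)
          (104 * q + 4) (\<lambda>s'. runs ?end s' 20
          (\<lambda>s'. tables p q x (Suc i) 0 s' \<and> findings p q x (Suc i) (Suc i) 0 s' \<and> ints s' ''r'' [] = int (Suc i)))"
      proof (rule runs_mono)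
        fix s' assume I: "I 0 s'"
        have exc: "row_excess q x (Suc i) \<longleftrightarrow> 1 < rats s' ''b'' []"
          using I by (simp add: I_def row_excess_def)
        show "runs ?end s' 20
          (\<lambda>s'. tables p q x (Suc i) 0 s' \<and> findings p q x (Suc i) (Suc i) 0 s' \<and> ints s' ''r'' [] = int (Suc i))"
        proof (rule runs_loop_free)
          have "tables p q x (Suc i) 0 (effect ?end s')"
            by (rule tables_cong[of p q x "Suc i" 0 s']) (use I in \<open>simp_all add: I_def report_com_def\<close>)
          moreover have "findings p q x (Suc i) (Suc i) 0 (effect ?end s')"
          proof (cases "row_excess q x (Suc i)")
            case True
            then have "ints (effect ?end s') ''verdict'' [] = 1" "ints (effect ?end s') ''i'' [] = int (Suc i)"
              "ints (effect ?end s') ''j'' [] = int 0"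
              using I by (simp_all add: exc I_def report_com_def)
            then show ?thesis
              unfolding findings_def using True i
              by (intro disjI2 exI[of _ "Suc i"] exI[of _ 0]) simp
          next
            case False
            then have "effect ?end s' = s'"
              by (simp add: exc)
            moreover have "findings p q x i (Suc i) 0 s'"
              using I by (simp add: I_def)
            then have "findings p q x (Suc i) (Suc i) 0 s'"
              using False unfolding findings_def le_Suc_eq by blast
            ultimately show ?thesis
              by simp
          qed
          moreover have "ints (effect ?end s') ''r'' [] = int (Suc i)"
            using I by (simp add: I_def report_com_def)
          ultimately show "tables p q x (Suc i) 0 (effect ?end s') \<and>
            findings p q x (Suc i) (Suc i) 0 (effect ?end s') \<and> ints (effect ?end s') ''r'' [] = int (Suc i)"
            by blast
        qed (simp_all add: report_com_def)
      qed simp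
    qed simp
  qed simp_all
  show "20 + (104 * q + 30) \<le> 200 * q"
    using \<open>1 \<le> q\<close> by simp
qed

lemma runs_scan:
  assumes x: "x \<in> vectors_on (positions p q)" and "1 \<le> q" "q \<le> p"
  shows "runs scan_com (separation_input p q x) (300 * (p * q))
    (\<lambda>s'. tables p q x p 0 s' \<and> findings p q x p p 0 s')"
proof -
  define I where "I n s \<longleftrightarrow> n \<le> p \<and> tables p q x (p - n) 0 s \<and> findings p q x (p - n) (p - n) 0 s \<and>
    ints s ''r'' [] = int (p - n)" for n s
  have "runs scan_com (separation_input p q x) (300 * (p * q)) (I 0)"
    unfolding scan_com_def
  proof (rule runs_While[of I p])
    show "I p (separation_input p q x)"
      unfolding I_def
    proof (intro conjI)
      \<comment> \<open>Only row 0 counts as scanned, and its cells of \<open>w\<close> are 0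
        initially.\<close>
      show "tables p q x (p - p) 0 (separation_input p q x)"
        by (auto simp: tables_def separation_input_def scanned_def)
      show "findings p q x (p - p) (p - p) 0 (separation_input p q x)"
        by (auto simp: findings_def separation_input_def scanned_def)
    qed (simp_all add: separation_input_def)
    fix n s assume I: "I (Suc n) s"
    define i where "i = p - Suc n"
    have i: "p - n = Suc i" "Suc i \<le> p" "n \<le> p"
      using I by (auto simp: I_def i_def)
    have "bval s (ILess (IV ''r'') (IV ''p''))"
      using I i by (auto simp: I_def i_def tables_def)
    moreover note runs_row[of p q x i s, OF _ _ _ i(2) x \<open>1 \<le> q\<close>]
    ultimately show "bval s (ILess (IV ''r'') (IV ''p'')) \<and>
      runs (Seq (Seq (ISet ''r'' (IAdd (IV ''r'') (IConst 1))) (Seq (RSet ''b'' (RConst 0)) (ISet ''k'' (IV ''q''))))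
        (Seq (While (ILess (IConst 0) (IV ''k'')) (Seq table_com check_com))
          (Cond (RLess (RConst 1) (RV ''b'')) (report_com 1) Skip))) s (200 * q) (I n)"
      using I i unfolding I_def i_def[symmetric] by simp
  next
    show "\<not> bval s (ILess (IV ''r'') (IV ''p''))" if "I 0 s" for s
      using that by (simp add: I_def tables_def)
    define N where "N = p * q"
    have "p \<le> N" "1 \<le> N"
      using assms unfolding N_def by simp_all
    moreover have "p * (1 + bcost (ILess (IV ''r'') (IV ''p'')) + 200 * q) = 4 * p + 200 * N"
      by (simp add: N_def algebra_simps)
    ultimately show "p * (1 + bcost (ILess (IV ''r'') (IV ''p'')) + 200 * q) + (1 + bcost (ILess (IV ''r'') (IV ''p'')))
        \<le> 300 * (p * q)"
      unfolding N_def[symmetric] by simp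
  qed
  then show ?thesis
    by (rule runs_mono) (simp_all add: I_def)
qed

lemma runs_trace:
  assumes tab: "tables p q x p 0 s" and ij: "2 \<le> j" "j \<le> i" "i \<le> p" "j \<le> q"
    and s: "ints s ''i'' [] = int i" "ints s ''j'' [] = int j"
  shows "runs trace_com s (100 * p)
    (\<lambda>s'. ints s' ''verdict'' [] = ints s ''verdict'' [] \<and> ints s' ''i'' [] = int i \<and> ints s' ''j'' [] = int j \<and>
       is_trace x (i + 1 - j) (j - 1) (\<lambda>k. nat (ints s' ''c'' [int k])))"
proof -
  define \<eta> where "\<eta> = i + 1 - j"
  define col where "col s' k = nat (ints s' ''c'' [int k])" for s' :: state and k :: nat
  \<comment> \<open>The column from which \<open>c k\<close> is looked up on diagonal
    \<open>k\<close>.\<close>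
  define start where "start s' k = (if k = \<eta> then j - 1 else col s' (k + 1))" for s' k
  define I where "I n s' \<longleftrightarrow> n \<le> \<eta> \<and> tables p q x p 0 s' \<and>
    ints s' ''verdict'' [] = ints s ''verdict'' [] \<and> ints s' ''i'' [] = int i \<and> ints s' ''j'' [] = int j \<and>
    ints s' ''n'' [] = int n \<and> ints s' ''l'' [] = int (start s' n) \<and> 1 \<le> start s' n \<and> start s' n < j \<and>
    (\<forall>k. n < k \<longrightarrow> k \<le> \<eta> \<longrightarrow> col s' k = last_column x (k + start s' k - 1) (start s' k))" for n s'
  let ?init = "Seq (ISet ''l'' (pred (IV ''j''))) (ISet ''n'' (ISub (IV ''i'') (pred (IV ''j''))))"
  let ?body = "Seq (ISet ''l'' (IRef ''t'' [pred (IAdd (IV ''n'') (IV ''l'')), IV ''l'']))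
        (Seq (IAssign ''c'' [IV ''n''] (IV ''l'')) (ISet ''n'' (pred (IV ''n''))))"
  have init: "I \<eta> (effect ?init s)"
    unfolding I_def
  proof (intro conjI)
    show "tables p q x p 0 (effect ?init s)"
      by (rule tables_cong[OF tab]) simp_all
  qed (use ij s in \<open>auto simp: start_def \<eta>_def of_nat_diff\<close>)
  have step: "I n (effect ?body s')" if I: "I (Suc n) s'" for n s'
  proof -
    define u where "u = effect ?body s'"
    define l where "l = start s' (Suc n)"
    define l' where "l' = last_column x (n + l) l"
    have l: "1 \<le> l" "l < j" "ints s' ''l'' [] = int l" "ints s' ''n'' [] = int (Suc n)" "Suc n \<le> \<eta>"
      using I by (auto simp: I_def l_def)
    \<comment> \<open>Diagonal \<open>Suc n\<close> meets column \<open>l\<close> in row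
      \<open>n + l\<close>, which is less than \<open>i\<close> because
      \<open>Suc n \<le> \<eta>\<close> and \<open>l < j\<close>.\<close>
    have "scanned p 0 (n + l) l"
      using l ij by (auto simp: scanned_def \<eta>_def)
    moreover have "l \<le> q" "1 \<le> n + l"
      using l ij by auto
    moreover have "tables p q x p 0 s'"
      using I by (simp add: I_def)
    ultimately have "ints s' ''t'' [int (n + l), int l] = int l'"
      unfolding l'_def tables_def using l(1) by blast
    then have t: "ints s' ''t'' [int n + int l, int l] = int l'"
      by simp
    have l': "1 \<le> l'" "l' < j"
      using last_column_bounds[OF l(1), of x "n + l"] l(2) by (auto simp: l'_def)
    have eff: "ints u ''l'' [] = int l'" "ints u ''n'' [] = int n"
      "ints u ''c'' = (ints s' ''c'')([1 + int n] := int l')"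
      using l t by (simp_all add: u_def)
    have same: "ints u a = ints s' a" if "a \<noteq> ''l''" "a \<noteq> ''n''" "a \<noteq> ''c''" for a
      using that by (simp add: u_def)
    have "rats u = rats s'"
      by (simp add: u_def)
    have col: "col u k = (if k = Suc n then l' else col s' k)" for k
      unfolding col_def eff(3) by auto
    have start: "start u n = l'" "k > n \<Longrightarrow> start u k = start s' k" for k
      using l(5) by (auto simp: start_def col)
    show ?thesis
      unfolding u_def[symmetric] I_def
    proof (intro conjI allI impI)
      show "tables p q x p 0 u"
        by (rule tables_cong[of p q x p 0 s']) (use I \<open>rats u = rats s'\<close> in \<open>simp_all add: I_def same\<close>)
      fix k assume k: "n < k" "k \<le> \<eta>"
      show "col u k = last_column x (k + start u k - 1) (start u k)"
      proof (cases "k = Suc n")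
        case True
        then show ?thesis
          using start(2)[OF k(1)] by (simp add: col l'_def l_def)
      next
        case False
        then show ?thesis
          using start(2)[OF k(1)] I k by (simp add: col I_def)
      qed
    qed (use I l' eff start in \<open>simp_all add: I_def same\<close>)
  qed
  have "runs trace_com s (100 * p) (I 0)"
    unfolding trace_com_def
  proof (rule runs_Seq)
    show "runs ?init s 20 (\<lambda>s'. runs (While (ILess (IConst 0) (IV ''n'')) ?body) s' (44 * p + 4) (I 0))"
    proof (rule runs_loop_free)
      show "runs (While (ILess (IConst 0) (IV ''n'')) ?body) (effect ?init s) (44 * p + 4) (I 0)"
      proof (rule runs_While[of I \<eta>, OF init])
        show "bval s' (ILess (IConst 0) (IV ''n'')) \<and> runs ?body s' 40 (I n)" if "I (Suc n) s'" for n s'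
        proof
          show "bval s' (ILess (IConst 0) (IV ''n''))"
            using that by (simp add: I_def)
          show "runs ?body s' 40 (I n)"
            using step[OF that] by (rule runs_loop_free[rotated]) simp_all
        qed
        show "\<not> bval s' (ILess (IConst 0) (IV ''n''))" if "I 0 s'" for s'
          using that by (simp add: I_def)
        have "\<eta> \<le> p"
          using ij by (simp add: \<eta>_def)
        then show "\<eta> * (1 + bcost (ILess (IConst 0) (IV ''n'')) + 40) + (1 + bcost (ILess (IConst 0) (IV ''n'')))
            \<le> 44 * p + 4"
          by simp
      qed
    qed simp_all
    show "20 + (44 * p + 4) \<le> 100 * p"
      using ij by simp
  qed
  then show ?thesis
  proof (rule runs_mono)
    fix s' assume I: "I 0 s'"
    have "is_trace x \<eta> (j - 1) (col s')"
    proof (rule is_traceI)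
      have *: "col s' k = last_column x (k + start s' k - 1) (start s' k)" if "1 \<le> k" "k \<le> \<eta>" for k
        using I that by (simp add: I_def)
      show "col s' \<eta> = last_column x (\<eta> + (j - 1) - 1) (j - 1)" if "1 \<le> \<eta>"
        using *[OF that order_refl] by (simp add: start_def)
      show "col s' k = last_column x (k + col s' (k + 1) - 1) (col s' (k + 1))" if "1 \<le> k" "k < \<eta>" for k
        using *[of k] that by (simp add: start_def)
    qed
    then have "is_trace x (i + 1 - j) (j - 1) (\<lambda>k. nat (ints s' ''c'' [int k]))"
      by (simp add: \<eta>_def col_def[abs_def])
    with I show "ints s' ''verdict'' [] = ints s ''verdict'' [] \<and> ints s' ''i'' [] = int i \<and>
      ints s' ''j'' [] = int j \<and> is_trace x (i + 1 - j) (j - 1) (\<lambda>k. nat (ints s' ''c'' [int k]))"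
      by (simp add: I_def)
  qed simp
qed

lemma no_findings_satisfied:
  assumes x: "x \<in> vectors_on (positions p q)" and "q \<le> p"
    and rows: "\<And>i. 1 \<le> i \<Longrightarrow> i \<le> p \<Longrightarrow> \<not> row_excess q x i"
    and cells: "\<And>i j. 1 \<le> i \<Longrightarrow> i \<le> p \<Longrightarrow> 1 \<le> j \<Longrightarrow> j \<le> q \<Longrightarrow> \<not> negative_at q x i j \<and> \<not> bar_excess q x i j"
    and d: "d \<in> orbitope_system p q"
  shows "satisfies x d"
proof -
  have shifted_ok: "\<forall>d \<in> orbitope_system p q - (range Row_Sum \<union> range Nonneg). satisfies x d"
    unfolding shifted_columns_satisfied_iff[OF x]
  proof (intro allI impI)
    fix i j assume "2 \<le> j" "j \<le> i" "i \<le> p" "j \<le> q"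
    then show "(\<Sum>e\<in>bar q (i, j). entry x e) \<le> min_shifted x (i - 1) (j - 1)"
      using cells[of i j] by (simp add: sum_bar[OF x] bar_excess_def not_less)
  qed
  show ?thesis
    using d
  proof (cases rule: orbitope_system_cases)
    case (row i)
    then show ?thesis
      using rows[of i] by (simp add: row_eq_bar sum_bar[OF x] row_excess_def)
  next
    case (nonneg i j)
    then show ?thesis
      using cells[of i j] by (auto simp: negative_at_def)
  next
    case (shifted \<eta> j c)
    then have "d \<in> orbitope_system p q - (range Row_Sum \<union> range Nonneg)"
      using d by auto
    with shifted_ok show ?thesis
      by blast
  qed
qed

lemma correct_answerI:
  assumes "d \<in> orbitope_system p q" "reports q s d" "\<not> satisfies x d"
  shows "correct_answer p q x s"
  using assms unfolding correct_answer_def by auto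

theorem separation_com_correct:
  assumes x: "x \<in> vectors_on (positions p q)" and "1 \<le> q" "q \<le> p"
  shows "runs separation_com (separation_input p q x) (500 * (p * q)) (correct_answer p q x)"
  unfolding separation_com_def
proof (rule runs_Seq)
  let ?rest = "Cond (ILess (IConst 2) (IV ''verdict'')) trace_com Skip"
  show "runs scan_com (separation_input p q x) (300 * (p * q)) (\<lambda>s. runs ?rest s (4 + 100 * p) (correct_answer p q x))"
    using runs_scan[OF assms]
  proof (rule runs_mono)
    fix s assume "tables p q x p 0 s \<and> findings p q x p p 0 s"
    then have tab: "tables p q x p 0 s" and find: "findings p q x p p 0 s" by auto
    have skip: "runs ?rest s (4 + 100 * p) (correct_answer p q x)"
      if "correct_answer p q x s" "ints s ''verdict'' [] \<le> 2"
    proof (rule runs_Cond)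
      show "runs Skip s (100 * p) (correct_answer p q x)"
        using that(1) assms by (intro runs_loop_free) auto
    qed (use that(2) in simp_all)
    consider (none) "ints s ''verdict'' [] = 0" "\<forall>i. 1 \<le> i \<longrightarrow> i \<le> p \<longrightarrow> \<not> row_excess q x i"
        "\<forall>i j. scanned p 0 i j \<longrightarrow> 1 \<le> i \<longrightarrow> 1 \<le> j \<longrightarrow> j \<le> q \<longrightarrow> \<not> negative_at q x i j \<and> \<not> bar_excess q x i j"
      | (row) i where "ints s ''verdict'' [] = 1" "ints s ''i'' [] = int i" "1 \<le> i" "i \<le> p" "row_excess q x i"
      | (nonneg) i j where "ints s ''verdict'' [] = 2" "ints s ''i'' [] = int i" "ints s ''j'' [] = int j"
          "1 \<le> i" "i \<le> p" "1 \<le> j" "j \<le> q" "negative_at q x i j"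
      | (shifted) i j where "ints s ''verdict'' [] = 3" "ints s ''i'' [] = int i" "ints s ''j'' [] = int j"
          "1 \<le> i" "i \<le> p" "j \<le> q" "bar_excess q x i j"
      using find unfolding findings_def by blast
    then show "runs ?rest s (4 + 100 * p) (correct_answer p q x)"
    proof cases
      case none
      have "satisfies x d" if "d \<in> orbitope_system p q" for d
      proof (rule no_findings_satisfied[OF x \<open>q \<le> p\<close> _ _ that])
        show "\<not> negative_at q x i j \<and> \<not> bar_excess q x i j" if "1 \<le> i" "i \<le> p" "1 \<le> j" "j \<le> q" for i j
        proof -
          have "scanned p 0 i j"
            using that by (auto simp: scanned_def)
          then show ?thesis
            using none(3) that by blast
        qed
      qed (use none(2) in blast)
      then show ?thesis
        using none(1) by (intro skip) (simp_all add: correct_answer_def)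
    next
      case row
      show ?thesis
      proof (rule skip)
        show "correct_answer p q x s"
        proof (rule correct_answerI)
          show "Row_Sum (Defs.row q i) \<in> orbitope_system p q"
            using row by (intro row_sum_in_system) auto
          show "reports q s (Row_Sum (Defs.row q i))"
            using row by (simp add: reports_def)
          show "\<not> satisfies x (Row_Sum (Defs.row q i))"
            using row by (simp add: row_eq_bar sum_bar[OF x] row_excess_def)
        qed
      qed (use row in simp)
    next
      case nonneg
      have neg: "entry x (i, j) < 0" "j < i \<or> j = q"
        using nonneg by (auto simp: negative_at_def)
      then have "j \<le> i"
        using entry_outside[OF x, of j i] by fastforce
      show ?thesis
      proof (rule skip)
        show "correct_answer p q x s"
        proof (rule correct_answerI)
          show "Nonneg (i, j) \<in> orbitope_system p q"
            using nonneg neg(2) \<open>j \<le> i\<close> by (intro nonneg_in_system) auto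
          show "reports q s (Nonneg (i, j))"
            using nonneg by (simp add: reports_def)
          show "\<not> satisfies x (Nonneg (i, j))"
            using neg(1) by simp
        qed
      qed (use nonneg in simp)
    next
      case shifted
      have j: "2 \<le> j" and less: "min_shifted x (i - 1) (j - 1) < (\<Sum>l=j..q. entry x (i, l))"
        using shifted by (auto simp: bar_excess_def)
      have "j \<le> i"
      proof (rule ccontr)
        assume "\<not> j \<le> i"
        then have "(\<Sum>l=j..q. entry x (i, l)) = 0" "min_shifted x (i - 1) (j - 1) = 0"
          using shifted(4) by (auto intro!: sum.neutral entry_outside[OF x] min_shifted_above[OF x])
        with less show False by simp
      qed
      have less': "min_shifted x (i - 1) (j - 1) < (\<Sum>e\<in>bar q (i, j). entry x e)"
        using less j by (simp add: sum_bar[OF x])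
      show ?thesis
      proof (rule runs_Cond)
        show "runs trace_com s (100 * p) (correct_answer p q x)"
          using runs_trace[OF tab j \<open>j \<le> i\<close> shifted(5,6,2,3)]
        proof (rule runs_mono)
          fix s' :: state
          assume s': "ints s' ''verdict'' [] = ints s ''verdict'' [] \<and> ints s' ''i'' [] = int i \<and>
            ints s' ''j'' [] = int j \<and> is_trace x (i + 1 - j) (j - 1) (\<lambda>k. nat (ints s' ''c'' [int k]))"
          then have "is_trace x (i + 1 - j) (j - 1) (\<lambda>k. nat (ints s' ''c'' [int k]))"
            by blast
          note violated = shifted_column_violated[OF x j \<open>j \<le> i\<close> shifted(5,6) less' this]
          show "correct_answer p q x s'"
          proof (rule correct_answerI[OF violated(1) _ violated(2)])
            show "reports q s' (Shifted_Column (bar q (i, j)) (shifted_column (i + 1 - j) (\<lambda>k. nat (ints s' ''c'' [int k]))))"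
              using s' shifted(1) by (simp add: reports_def Let_def)
          qed
        qed simp
      qed (use shifted(1) in simp_all)
    qed
  qed simp
  define N where "N = p * q"
  have "p \<le> N" "1 \<le> N"
    using assms unfolding N_def by simp_all
  then show "300 * (p * q) + (4 + 100 * p) \<le> 500 * (p * q)"
    unfolding N_def[symmetric] by simp
qed

theorem theorem17:
  shows "(\<forall>p q :: nat. p \<ge> q \<and> q \<ge> 2 \<longrightarrow>
            packing_orbitope p q = solution_set p q (orbitope_system p q) \<and>
            non_redundant p q (orbitope_system p q))
       \<and> (\<exists>(P :: com) (C :: nat). \<forall>(p :: nat) (q :: nat) (x :: pos \<Rightarrow>\<^sub>0 rat).
            p \<ge> q \<and> q \<ge> 2 \<and> x \<in> vectors_on (positions p q) \<longrightarrow>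
            (\<exists>t s. exec P (separation_input p q x) t s \<and> t \<le> C * (p * q) \<and>
                   correct_answer p q x s))"
proof (intro conjI)
  show "\<forall>p q :: nat. p \<ge> q \<and> q \<ge> 2 \<longrightarrow>
      packing_orbitope p q = solution_set p q (orbitope_system p q) \<and> non_redundant p q (orbitope_system p q)"
    by (simp add: packing_orbitope_eq_solution_set non_redundant_orbitope_system)
  have "\<exists>t s. exec separation_com (separation_input p q x) t s \<and> t \<le> 500 * (p * q) \<and> correct_answer p q x s"
    if "p \<ge> q \<and> q \<ge> 2 \<and> x \<in> vectors_on (positions p q)" for p q x
    using separation_com_correct[of x p q] that by (simp add: runs_def)
  then show "\<exists>(P :: com) (C :: nat). \<forall>(p :: nat) (q :: nat) (x :: pos \<Rightarrow>\<^sub>0 rat).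
      p \<ge> q \<and> q \<ge> 2 \<and> x \<in> vectors_on (positions p q) \<longrightarrow>
      (\<exists>t s. exec P (separation_input p q x) t s \<and> t \<le> C * (p * q) \<and> correct_answer p q x s)"
    by blast
qed

end
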